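(* Let $(X,\mu)$ and $(Y,\nu)$ be standard $\sigma$-finite measure spaces. Every closable multiplier $\varphi:X\times Y\to\mathbb{C}$ is $\tau$-continuous.
   Context: Write $H_1=L^2(X,\mu)$, $H_2=L^2(Y,\nu)$; for $k\in L^2(X\times Y,\mu\times\nu)$ let $I_k:H_1\to H_2$ be the Hilbert–Schmidt operator $(I_k\xi)(y)=\int_X k(x,y)\xi(x)\,d\mu(x)$. For measurable $\varphi:X\times Y\to\mathbb{C}$ let $D(\varphi)=\{k\in L^2(X\times Y):\varphi k\in L^2(X\times Y)\}$ and let $S_\varphi$ be the densely defined operator on the space $\mathcal{K}(H_1,H_2)$ of compact operators (operator norm) with domain $\{I_k:k\in D(\varphi)\}$ given by $S_\varphi(I_k)=I_{\varphi k}$. A measurable function $\varphi$ is a closable multiplier if $S_\varphi$ is closable, i.e. the norm closure of its graph in $\mathcal{K}(H_1,H_2)\oplus\mathcal{K}(H_1,H_2)$ is the graph of an operator. A rectangle is a set $\alpha\times\beta$ with $\alpha\subseteq X$, $\beta\subseteq Y$ measurable. A set $E\subseteq X\times Y$ is $\tau$-open if there is a countable union $F$ of rectangles such that the symmetric difference of $E$ and $F$ is $\mu\times\nu$-null. A function $\varphi:X\times Y\to\mathbb{C}$ is $\tau$-continuous if $\varphi^{-1}(U)$ is $\tau$-open for every open $U\subseteq\mathbb{C}$. *)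

theory Defs
  imports "HOL-Analysis.Analysis"
begin

definition standard_borel :: "'a measure \<Rightarrow> bool" where
  "standard_borel M \<longleftrightarrow>
     (\<exists>T. topspace T = space M \<and> completely_metrizable_space T \<and> second_countable T \<and>
          sets M = sigma_sets (space M) {U. openin T U})"

definition standard_sigma_finite :: "'a measure \<Rightarrow> bool" where
  "standard_sigma_finite M \<longleftrightarrow> standard_borel M \<and> sigma_finite_measure M"

text \<open>
  Elements of the Hilbert space \<open>L\<^sup>2(M)\<close> are handled through their representatives: \<open>L2 M\<close> is the
  set of square integrable functions, and two of them denote the same vector iff they agree almost
  everywhere. Correspondingly an operator from \<open>L\<^sup>2(M)\<close> to \<open>L\<^sup>2(N)\<close> is a map on representatives,
  linear up to null sets (its values outside \<open>L2 M\<close> are irrelevant); boundedness makes it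
  respect equality almost everywhere. Equality of operators is \<open>op_eq\<close>.
\<close>

definition L2 :: "'a measure \<Rightarrow> ('a \<Rightarrow> complex) set" where
  "L2 M = {f \<in> borel_measurable M. integrable M (\<lambda>x. (cmod (f x))\<^sup>2)}"

definition l2norm :: "'a measure \<Rightarrow> ('a \<Rightarrow> complex) \<Rightarrow> real" where
  "l2norm M f = sqrt (\<integral>x. (cmod (f x))\<^sup>2 \<partial>M)"

type_synonym ('a, 'b) l2op = "('a \<Rightarrow> complex) \<Rightarrow> 'b \<Rightarrow> complex"

definition op_eq :: "'a measure \<Rightarrow> 'b measure \<Rightarrow> ('a, 'b) l2op \<Rightarrow> ('a, 'b) l2op \<Rightarrow> bool" where
  "op_eq M N A B \<longleftrightarrow> (\<forall>f\<in>L2 M. AE y in N. A f y = B f y)"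

definition bounded_op :: "'a measure \<Rightarrow> 'b measure \<Rightarrow> ('a, 'b) l2op \<Rightarrow> bool" where
  "bounded_op M N T \<longleftrightarrow>
     (\<forall>f\<in>L2 M. T f \<in> L2 N) \<and>
     (\<forall>f\<in>L2 M. \<forall>g\<in>L2 M. AE y in N. T (\<lambda>x. f x + g x) y = T f y + T g y) \<and>
     (\<forall>c. \<forall>f\<in>L2 M. AE y in N. T (\<lambda>x. c * f x) y = c * T f y) \<and>
     (\<exists>C. \<forall>f\<in>L2 M. l2norm N (T f) \<le> C * l2norm M f)"

definition opnorm :: "'a measure \<Rightarrow> 'b measure \<Rightarrow> ('a, 'b) l2op \<Rightarrow> real" where
  "opnorm M N T = (SUP f\<in>{f \<in> L2 M. l2norm M f \<le> 1}. l2norm N (T f))"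

definition op_dist :: "'a measure \<Rightarrow> 'b measure \<Rightarrow> ('a, 'b) l2op \<Rightarrow> ('a, 'b) l2op \<Rightarrow> real" where
  "op_dist M N A B = opnorm M N (\<lambda>f y. A f y - B f y)"

text \<open>
  Compactness is stated sequentially: the image of the unit ball is relatively compact in norm.
\<close>

definition compact_ops :: "'a measure \<Rightarrow> 'b measure \<Rightarrow> ('a, 'b) l2op set" where
  "compact_ops M N = {T. bounded_op M N T \<and>
     (\<forall>u. (\<forall>n::nat. u n \<in> L2 M \<and> l2norm M (u n) \<le> 1) \<longrightarrow>
        (\<exists>r g. strict_mono r \<and> g \<in> L2 N \<and>
           (\<lambda>n. l2norm N (\<lambda>y. T (u (r n)) y - g y)) \<longlonglongrightarrow> 0))}"

definition HS_op :: "'a measure \<Rightarrow> ('a \<times> 'b \<Rightarrow> complex) \<Rightarrow> ('a, 'b) l2op" where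
  "HS_op M k = (\<lambda>\<xi> y. \<integral>x. k (x, y) * \<xi> x \<partial>M)"

definition mult_dom ::
  "'a measure \<Rightarrow> 'b measure \<Rightarrow> ('a \<times> 'b \<Rightarrow> complex) \<Rightarrow> ('a \<times> 'b \<Rightarrow> complex) set" where
  "mult_dom M N \<phi> = {k \<in> L2 (M \<Otimes>\<^sub>M N). (\<lambda>p. \<phi> p * k p) \<in> L2 (M \<Otimes>\<^sub>M N)}"

definition mult_graph ::
  "'a measure \<Rightarrow> 'b measure \<Rightarrow> ('a \<times> 'b \<Rightarrow> complex) \<Rightarrow> (('a, 'b) l2op \<times> ('a, 'b) l2op) set" where
  "mult_graph M N \<phi> = {(HS_op M k, HS_op M (\<lambda>p. \<phi> p * k p)) | k. k \<in> mult_dom M N \<phi>}"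

text \<open>Norm closure in the direct sum of two copies of the space of compact operators.\<close>

definition graph_closure ::
  "'a measure \<Rightarrow> 'b measure \<Rightarrow> (('a, 'b) l2op \<times> ('a, 'b) l2op) set
     \<Rightarrow> (('a, 'b) l2op \<times> ('a, 'b) l2op) set" where
  "graph_closure M N G =
     {(A, B). A \<in> compact_ops M N \<and> B \<in> compact_ops M N \<and>
        (\<forall>\<epsilon>>0. \<exists>(P, Q)\<in>G. op_dist M N A P < \<epsilon> \<and> op_dist M N B Q < \<epsilon>)}"

text \<open>
  For the closure of \<open>mult_graph\<close>, which is a linear subspace, being the graph of an operator means
  being single valued, where equality of operators is \<open>op_eq\<close>.
\<close>

definition is_op_graph ::
  "'a measure \<Rightarrow> 'b measure \<Rightarrow> (('a, 'b) l2op \<times> ('a, 'b) l2op) set \<Rightarrow> bool" where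
  "is_op_graph M N G \<longleftrightarrow>
     (\<forall>(A, B)\<in>G. \<forall>(A', B')\<in>G. op_eq M N A A' \<longrightarrow> op_eq M N B B')"

definition closable_multiplier ::
  "'a measure \<Rightarrow> 'b measure \<Rightarrow> ('a \<times> 'b \<Rightarrow> complex) \<Rightarrow> bool" where
  "closable_multiplier M N \<phi> \<longleftrightarrow>
     \<phi> \<in> borel_measurable (M \<Otimes>\<^sub>M N) \<and>
     is_op_graph M N (graph_closure M N (mult_graph M N \<phi>))"

definition rectangles :: "'a measure \<Rightarrow> 'b measure \<Rightarrow> ('a \<times> 'b) set set" where
  "rectangles M N = {\<alpha> \<times> \<beta> | \<alpha> \<beta>. \<alpha> \<in> sets M \<and> \<beta> \<in> sets N}"

definition tau_open :: "'a measure \<Rightarrow> 'b measure \<Rightarrow> ('a \<times> 'b) set \<Rightarrow> bool" where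
  "tau_open M N E \<longleftrightarrow>
     (\<exists>R. countable R \<and> R \<subseteq> rectangles M N \<and> sym_diff E (\<Union>R) \<in> null_sets (M \<Otimes>\<^sub>M N))"

definition tau_continuous ::
  "'a measure \<Rightarrow> 'b measure \<Rightarrow> ('a \<times> 'b \<Rightarrow> complex) \<Rightarrow> bool" where
  "tau_continuous M N \<phi> \<longleftrightarrow>
     (\<forall>U. open U \<longrightarrow> tau_open M N (\<phi> -` U \<inter> space (M \<Otimes>\<^sub>M N)))"

end

theory Submission
  imports Defs "HOL-Complex_Analysis.Great_Picard"
begin

text \<open>
  The compact operators have the trace class as their dual. A trace class operator has a kernel of
  the form \<open>b(x, y) = \<Sum>\<^sub>i f\<^sub>i(x) g\<^sub>i(y)\<close> with \<open>\<Sum>\<^sub>i \<parallel>f\<^sub>i\<parallel>\<^sup>2\<close> and \<open>\<Sum>\<^sub>i \<parallel>g\<^sub>i\<parallel>\<^sup>2\<close> finite, and it pairs with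
  \<open>I\<^sub>k\<close> to \<open>\<integral> b k\<close>. The kernel \<open>b\<close> lies in the domain of the adjoint of \<open>S\<^sub>\<phi>\<close> when \<open>\<phi> b\<close> is of that form
  again. Closability of \<open>S\<^sub>\<phi>\<close> means that these \<open>b\<close> are total: if a square integrable \<open>k\<^sub>0\<close> satisfies
  \<open>\<integral> k\<^sub>0 b = 0\<close> for all of them, then \<open>k\<^sub>0 = 0\<close>. Applied to a \<open>k\<^sub>0\<close> that lives where all \<open>b\<close> vanish, this
  says that countably many of the sets \<open>{b \<noteq> 0}\<close> cover the product up to a null set. On such a set \<open>\<phi>\<close> is
  the quotient of \<open>\<phi> b\<close> and \<open>b\<close>. Up to null sets, each of the two is a pairing \<open>\<langle>F(x), G(y)\<rangle>\<close> of measurable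
  maps into the separable space \<open>\<ell>\<^sup>2\<close>; preimages of open sets under such a pairing are countable unions of
  rectangles.
  
  The duality enters in two places. The separation of \<open>(0, I\<^sub>k\<^sub>0)\<close> from the closed graph is done in the
  Hilbert space \<open>L\<^sup>2(X \<times> Y)\<close>, by a nearest point in a convex set (\<open>L2_projection_convex\<close>,
  \<open>graph_closure_or_annihilator\<close>). It yields square integrable functions \<open>d\<close> for which \<open>k \<mapsto> \<integral> d k\<close> is
  bounded in the operator norm of \<open>I\<^sub>k\<close>. That such a \<open>d\<close> has the required form is read off its singular
  value decomposition: testing against \<open>k = \<Sum>\<^sub>i u\<^sub>i \<otimes> cnj v\<^sub>i\<close>, which is a contraction, bounds the sum of the
  singular values (\<open>hilbert_factorable_if_op_bounded\<close>). The singular vectors exist because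
  Hilbert--Schmidt operators are compact (\<open>HS_compact_subseq\<close>). Compactness is also what places
  \<open>(0, I\<^sub>k\<^sub>0)\<close> inside the space of pairs of compact operators in which the closure is taken.
\<close>

section \<open>Square integrable functions\<close>

lemma borel_measurable_cnj [measurable (raw)]:
  "f \<in> borel_measurable M \<Longrightarrow> (\<lambda>x. cnj (f x)) \<in> borel_measurable M"
  by (rule borel_measurable_continuous_on[OF _ _, where f=cnj]) (auto intro: continuous_intros)

lemma L2_measurable [measurable_dest]: "f \<in> L2 M \<Longrightarrow> f \<in> borel_measurable M"
  by (simp add: L2_def)

lemma L2_integrable_square: "f \<in> L2 M \<Longrightarrow> integrable M (\<lambda>x. (cmod (f x))\<^sup>2)"
  by (simp add: L2_def)

lemma L2_dominated:
  assumes "f \<in> borel_measurable M" "integrable M w" "AE x in M. (cmod (f x))\<^sup>2 \<le> w x"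
  shows "f \<in> L2 M"
  unfolding L2_def
proof (safe intro!: assms)
  show "integrable M (\<lambda>x. (cmod (f x))\<^sup>2)"
    by (rule Bochner_Integration.integrable_bound[OF assms(2)]) (use assms in auto)
qed

lemma L2_add: 
  assumes f: "f \<in> L2 M" and g: "g \<in> L2 M" shows "(\<lambda>x. f x + g x) \<in> L2 M"
proof (rule L2_dominated)
  show "integrable M (\<lambda>x. 2 * (cmod (f x))\<^sup>2 + 2 * (cmod (g x))\<^sup>2)"
    by (intro Bochner_Integration.integrable_add integrable_mult_right L2_integrable_square f g)
  have "(cmod (a + b))\<^sup>2 \<le> 2 * (cmod a)\<^sup>2 + 2 * (cmod b)\<^sup>2" for a b
  proof -
    have "(cmod (a + b))\<^sup>2 \<le> (cmod a + cmod b)\<^sup>2"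
      by (intro power_mono norm_triangle_ineq) auto
    also have "\<dots> \<le> 2 * (cmod a)\<^sup>2 + 2 * (cmod b)\<^sup>2"
      using zero_le_power2[of "cmod a - cmod b"] by (simp add: power2_eq_square algebra_simps)
    finally show ?thesis .
  qed
  then show "AE x in M. (cmod (f x + g x))\<^sup>2 \<le> 2 * (cmod (f x))\<^sup>2 + 2 * (cmod (g x))\<^sup>2"
    by simp
qed (use f g in measurable)

lemma L2_mult_bounded:
  assumes f: "f \<in> L2 M" and [measurable]: "w \<in> borel_measurable M" and w: "\<And>x. cmod (w x) \<le> K"
  shows "(\<lambda>x. w x * f x) \<in> L2 M"
proof (rule L2_dominated)
  note [measurable] = L2_measurable[OF f]
  show "(\<lambda>x. w x * f x) \<in> borel_measurable M" by measurable
  show "integrable M (\<lambda>x. K\<^sup>2 * (cmod (f x))\<^sup>2)"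
    using f by (auto dest: L2_integrable_square)
  show "AE x in M. (cmod (w x * f x))\<^sup>2 \<le> K\<^sup>2 * (cmod (f x))\<^sup>2"
    using w by (auto simp: norm_mult power_mult_distrib intro!: mult_right_mono power_mono)
qed

lemma L2_scale: "f \<in> L2 M \<Longrightarrow> (\<lambda>x. c * f x) \<in> L2 M"
  by (rule L2_mult_bounded[where K="cmod c"]) auto

lemma L2_zero: "(\<lambda>x. 0) \<in> L2 M"
  by (simp add: L2_def)

lemma L2_diff: "f \<in> L2 M \<Longrightarrow> g \<in> L2 M \<Longrightarrow> (\<lambda>x. f x - g x) \<in> L2 M"
  using L2_add[of f M "\<lambda>x. (-1) * g x"] L2_scale[of g M "-1"] by simp

lemma L2_cnj: "f \<in> L2 M \<Longrightarrow> (\<lambda>x. cnj (f x)) \<in> L2 M"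
  by (auto simp: L2_def intro: borel_measurable_cnj)

lemma L2_sum: "(\<And>i. i \<in> I \<Longrightarrow> f i \<in> L2 M) \<Longrightarrow> (\<lambda>x. \<Sum>i\<in>I. f i x) \<in> L2 M"
  by (induction I rule: infinite_finite_induct) (auto simp: L2_zero L2_add)

lemmas L2_intros = L2_zero L2_add L2_diff L2_scale L2_cnj L2_sum

lemma l2norm_nonneg [simp]: "0 \<le> l2norm M f"
  by (simp add: l2norm_def)

lemma l2norm_square: "(l2norm M f)\<^sup>2 = (\<integral>x. (cmod (f x))\<^sup>2 \<partial>M)"
  by (simp add: l2norm_def)

lemma l2norm_cong_AE:
  assumes "f \<in> borel_measurable M" "g \<in> borel_measurable M" "AE x in M. f x = g x"
  shows "l2norm M f = l2norm M g"
  unfolding l2norm_def using assms by (auto intro!: arg_cong[where f=sqrt] integral_cong_AE)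

lemma l2norm_cnj [simp]: "l2norm M (\<lambda>x. cnj (f x)) = l2norm M f"
  by (simp add: l2norm_def)

lemma l2norm_zero [simp]: "l2norm M (\<lambda>x. 0) = 0"
  by (simp add: l2norm_def)

lemma l2norm_scale: "l2norm M (\<lambda>x. c * f x) = cmod c * l2norm M f"
  by (simp add: l2norm_def norm_mult power_mult_distrib real_sqrt_mult)

lemma l2norm_minus_commute: "l2norm M (\<lambda>x. f x - g x) = l2norm M (\<lambda>x. g x - f x)"
  by (simp add: l2norm_def norm_minus_commute)

lemma l2norm_mono:
  assumes "g \<in> L2 M" "f \<in> L2 M" "AE x in M. cmod (f x) \<le> cmod (g x)"
  shows "l2norm M f \<le> l2norm M g"
  unfolding l2norm_def
  by (intro real_sqrt_le_mono integral_mono_AE L2_integrable_square assms)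
     (use assms(3) in eventually_elim, auto)

lemma l2norm_eq_0_iff:
  assumes "f \<in> L2 M" shows "l2norm M f = 0 \<longleftrightarrow> (AE x in M. f x = 0)"
  unfolding l2norm_def
  using integral_nonneg_eq_0_iff_AE[OF L2_integrable_square[OF assms]] by simp

definition inprod :: "'a measure \<Rightarrow> ('a \<Rightarrow> complex) \<Rightarrow> ('a \<Rightarrow> complex) \<Rightarrow> complex" where
  "inprod M f g = (\<integral>x. f x * cnj (g x) \<partial>M)"

lemma L2_integrable_mult:
  assumes f: "f \<in> L2 M" and g: "g \<in> L2 M" shows "integrable M (\<lambda>x. f x * g x)"
proof (rule Bochner_Integration.integrable_bound)
  note [measurable] = L2_measurable[OF f] L2_measurable[OF g]
  show "integrable M (\<lambda>x. (cmod (f x))\<^sup>2 + (cmod (g x))\<^sup>2)"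
    using f g by (auto dest: L2_integrable_square)
  show "(\<lambda>x. f x * g x) \<in> borel_measurable M" by measurable
  have "cmod (a * b) \<le> (cmod a)\<^sup>2 + (cmod b)\<^sup>2" for a b
  proof -
    have "2 * (cmod a * cmod b) \<le> (cmod a)\<^sup>2 + (cmod b)\<^sup>2"
      using sum_squares_bound[of "cmod a" "cmod b"] by simp
    moreover have "0 \<le> cmod a * cmod b" by simp
    ultimately show ?thesis unfolding norm_mult by linarith
  qed
  then show "AE x in M. cmod (f x * g x) \<le> norm ((cmod (f x))\<^sup>2 + (cmod (g x))\<^sup>2)"
    by auto
qed

lemma L2_integrable_mult_cnj:
  "f \<in> L2 M \<Longrightarrow> g \<in> L2 M \<Longrightarrow> integrable M (\<lambda>x. f x * cnj (g x))"
  by (intro L2_integrable_mult L2_cnj)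

lemma inprod_self: "inprod M f f = complex_of_real ((l2norm M f)\<^sup>2)"
  unfolding inprod_def l2norm_square complex_norm_square[symmetric] integral_complex_of_real ..

lemma inprod_commute: "inprod M g f = cnj (inprod M f g)"
proof -
  have "cnj (inprod M f g) = (\<integral>x. cnj (f x * cnj (g x)) \<partial>M)"
    unfolding inprod_def by (rule Bochner_Integration.integral_cnj[symmetric])
  then show ?thesis by (simp add: inprod_def mult.commute)
qed

lemma inprod_zero [simp]: "inprod M (\<lambda>x. 0) g = 0" "inprod M g (\<lambda>x. 0) = 0"
  by (simp_all add: inprod_def)

lemma inprod_add_left:
  assumes "f \<in> L2 M" "g \<in> L2 M" "h \<in> L2 M"
  shows "inprod M (\<lambda>x. f x + g x) h = inprod M f h + inprod M g h"
  unfolding inprod_def distrib_right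
  by (intro Bochner_Integration.integral_add L2_integrable_mult_cnj assms)

lemma inprod_diff_left:
  assumes "f \<in> L2 M" "g \<in> L2 M" "h \<in> L2 M"
  shows "inprod M (\<lambda>x. f x - g x) h = inprod M f h - inprod M g h"
  unfolding inprod_def left_diff_distrib
  by (intro Bochner_Integration.integral_diff L2_integrable_mult_cnj assms)

lemma inprod_scale_left: "inprod M (\<lambda>x. c * f x) h = c * inprod M f h"
  by (simp add: inprod_def mult.assoc)

lemma inprod_add_right:
  assumes "f \<in> L2 M" "g \<in> L2 M" "h \<in> L2 M"
  shows "inprod M h (\<lambda>x. f x + g x) = inprod M h f + inprod M h g"
  by (subst (1 2 3) inprod_commute) (simp add: inprod_add_left[OF assms])

lemma inprod_scale_right: "inprod M h (\<lambda>x. c * f x) = cnj c * inprod M h f"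
  by (subst (1 2) inprod_commute) (simp add: inprod_scale_left)

lemma inprod_sum_left:
  assumes "\<And>i. i \<in> I \<Longrightarrow> f i \<in> L2 M" "h \<in> L2 M"
  shows "inprod M (\<lambda>x. \<Sum>i\<in>I. f i x) h = (\<Sum>i\<in>I. inprod M (f i) h)"
  unfolding inprod_def sum_distrib_right
  by (intro Bochner_Integration.integral_sum L2_integrable_mult_cnj assms)

lemma inprod_cong_AE:
  assumes "f \<in> borel_measurable M" "f' \<in> borel_measurable M"
    "g \<in> borel_measurable M" "g' \<in> borel_measurable M"
    "AE x in M. f x = f' x" "AE x in M. g x = g' x"
  shows "inprod M f g = inprod M f' g'"
  unfolding inprod_def
  by (intro integral_cong_AE borel_measurable_times borel_measurable_cnj assms)
     (use assms(5,6) in eventually_elim, auto)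

lemma cauchy_schwarz_integral:
  assumes f: "f \<in> L2 M" and g: "g \<in> L2 M"
  shows "cmod (\<integral>x. f x * g x \<partial>M) \<le> l2norm M f * l2norm M g"
proof -
  note [measurable] = L2_measurable[OF f] L2_measurable[OF g]
  have int: "integrable M (\<lambda>x. cmod (f x * g x))"
    using L2_integrable_mult[OF f g] by simp
  have "(\<integral>\<^sup>+x. ennreal (cmod (f x)) * ennreal (cmod (g x)) \<partial>M)\<^sup>2
      \<le> (\<integral>\<^sup>+x. (ennreal (cmod (f x)))\<^sup>2 \<partial>M) * (\<integral>\<^sup>+x. (ennreal (cmod (g x)))\<^sup>2 \<partial>M)"
    by (rule Cauchy_Schwarz_nn_integral) auto
  also have "(\<integral>\<^sup>+x. ennreal (cmod (f x)) * ennreal (cmod (g x)) \<partial>M)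
      = ennreal (\<integral>x. cmod (f x * g x) \<partial>M)"
    using nn_integral_eq_integral[OF int] by (simp add: norm_mult ennreal_mult)
  also have "(\<integral>\<^sup>+x. (ennreal (cmod (f x)))\<^sup>2 \<partial>M) = ennreal ((l2norm M f)\<^sup>2)"
    using nn_integral_eq_integral[OF L2_integrable_square[OF f]]
    by (simp add: l2norm_square ennreal_power)
  also have "(\<integral>\<^sup>+x. (ennreal (cmod (g x)))\<^sup>2 \<partial>M) = ennreal ((l2norm M g)\<^sup>2)"
    using nn_integral_eq_integral[OF L2_integrable_square[OF g]]
    by (simp add: l2norm_square ennreal_power)
  finally have "(\<integral>x. cmod (f x * g x) \<partial>M)\<^sup>2 \<le> (l2norm M f * l2norm M g)\<^sup>2"
    by (simp add: ennreal_power ennreal_mult[symmetric] power_mult_distrib)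
  then have "(\<integral>x. cmod (f x * g x) \<partial>M) \<le> l2norm M f * l2norm M g"
    by (rule power2_le_imp_le) simp
  then show ?thesis using integral_norm_bound[of M "\<lambda>x. f x * g x"] by linarith
qed

lemma cauchy_schwarz_inprod:
  "f \<in> L2 M \<Longrightarrow> g \<in> L2 M \<Longrightarrow> cmod (inprod M f g) \<le> l2norm M f * l2norm M g"
  unfolding inprod_def using cauchy_schwarz_integral[of f M "\<lambda>x. cnj (g x)"] by (simp add: L2_cnj)

lemma l2norm_add_square:
  assumes "f \<in> L2 M" "g \<in> L2 M"
  shows "(l2norm M (\<lambda>x. f x + g x))\<^sup>2 = (l2norm M f)\<^sup>2 + 2 * Re (inprod M f g) + (l2norm M g)\<^sup>2"
proof -
  have "complex_of_real ((l2norm M (\<lambda>x. f x + g x))\<^sup>2)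
      = inprod M f f + inprod M f g + cnj (inprod M f g) + inprod M g g"
    using assms
    by (simp only: inprod_self[symmetric] inprod_add_left[OF assms L2_add[OF assms]]
        inprod_add_right[OF assms assms(1)] inprod_add_right[OF assms assms(2)]
        inprod_commute[of M g f] add.assoc)
  also have "\<dots> = complex_of_real ((l2norm M f)\<^sup>2 + 2 * Re (inprod M f g) + (l2norm M g)\<^sup>2)"
    by (simp add: inprod_self complex_eq_iff)
  finally show ?thesis by (simp only: of_real_eq_iff)
qed

lemma l2norm_diff_square:
  assumes "f \<in> L2 M" "g \<in> L2 M"
  shows "(l2norm M (\<lambda>x. f x - g x))\<^sup>2 = (l2norm M f)\<^sup>2 - 2 * Re (inprod M f g) + (l2norm M g)\<^sup>2"
  using l2norm_add_square[OF assms(1) L2_scale[OF assms(2), of "-1"]]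
    inprod_scale_right[of M f "-1" g] l2norm_scale[of M "-1" g] by simp

lemma l2norm_triangle:
  assumes "f \<in> L2 M" "g \<in> L2 M"
  shows "l2norm M (\<lambda>x. f x + g x) \<le> l2norm M f + l2norm M g"
proof (rule power2_le_imp_le)
  have "Re (inprod M f g) \<le> l2norm M f * l2norm M g"
    using cauchy_schwarz_inprod[OF assms] complex_Re_le_cmod order_trans by blast
  then show "(l2norm M (\<lambda>x. f x + g x))\<^sup>2 \<le> (l2norm M f + l2norm M g)\<^sup>2"
    by (simp add: l2norm_add_square[OF assms] power2_sum)
qed simp

lemma l2norm_triangle_between:
  assumes "f \<in> L2 M" "g \<in> L2 M" "h \<in> L2 M"
  shows "l2norm M (\<lambda>x. f x - h x) \<le> l2norm M (\<lambda>x. f x - g x) + l2norm M (\<lambda>x. g x - h x)"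
  using l2norm_triangle[OF L2_diff[OF assms(1,2)] L2_diff[OF assms(2,3)]] by simp

lemma l2norm_triangle_reverse:
  assumes "f \<in> L2 M" "g \<in> L2 M"
  shows "\<bar>l2norm M f - l2norm M g\<bar> \<le> l2norm M (\<lambda>x. f x - g x)"
  using l2norm_triangle[OF L2_diff[OF assms] assms(2)]
    l2norm_triangle[OF L2_diff[OF assms(2,1)] assms(1)] l2norm_minus_commute[of M f g]
  by simp

lemma l2norm_sum_le:
  assumes "finite I" "\<And>i. i \<in> I \<Longrightarrow> f i \<in> L2 M"
  shows "l2norm M (\<lambda>x. \<Sum>i\<in>I. f i x) \<le> (\<Sum>i\<in>I. l2norm M (f i))"
  using assms
proof (induction I rule: finite_induct)
  case (insert i I)
  have "l2norm M (\<lambda>x. f i x + (\<Sum>i\<in>I. f i x)) \<le> l2norm M (f i) + l2norm M (\<lambda>x. \<Sum>i\<in>I. f i x)"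
    using insert by (intro l2norm_triangle L2_sum) auto
  then show ?case using insert by fastforce
qed simp

lemma l2norm_limit:
  assumes "\<And>n. u n \<in> L2 M" "g \<in> L2 M" "(\<lambda>n. l2norm M (\<lambda>x. u n x - g x)) \<longlonglongrightarrow> 0"
  shows "(\<lambda>n. l2norm M (u n)) \<longlonglongrightarrow> l2norm M g"
proof (rule LIM_zero_cancel, rule Lim_null_comparison[OF _ assms(3)])
  show "\<forall>\<^sub>F n in sequentially. norm (l2norm M (u n) - l2norm M g) \<le> l2norm M (\<lambda>x. u n x - g x)"
    using l2norm_triangle_reverse[OF assms(1,2)] by simp
qed

lemma l2norm_limit_unique:
  assumes "\<And>n. u n \<in> L2 M" "g \<in> L2 M" "h \<in> L2 M"
    and "(\<lambda>n. l2norm M (\<lambda>x. u n x - g x)) \<longlonglongrightarrow> 0" "(\<lambda>n. l2norm M (\<lambda>x. u n x - h x)) \<longlonglongrightarrow> 0"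
  shows "AE x in M. g x = h x"
proof -
  have "l2norm M (\<lambda>x. g x - h x) \<le> 0"
  proof (rule LIMSEQ_le_const)
    show "(\<lambda>n. l2norm M (\<lambda>x. u n x - g x) + l2norm M (\<lambda>x. u n x - h x)) \<longlonglongrightarrow> 0"
      using tendsto_add[OF assms(4,5)] by simp
    show "\<exists>N. \<forall>n\<ge>N. l2norm M (\<lambda>x. g x - h x)
        \<le> l2norm M (\<lambda>x. u n x - g x) + l2norm M (\<lambda>x. u n x - h x)"
      using l2norm_triangle_between[OF assms(2) assms(1) assms(3)]
      by (auto simp: l2norm_minus_commute[of M g])
  qed
  then have "l2norm M (\<lambda>x. g x - h x) = 0" by (simp add: order_antisym)
  then show ?thesis using l2norm_eq_0_iff[OF L2_diff[OF assms(2,3)]] by simp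
qed

text \<open>
  Apply the corresponding fact for \<open>L\<^sup>1\<close> to the squared moduli.
\<close>

lemma l2norm_tendsto_0_AE_subseq:
  assumes "\<And>n. u n \<in> L2 M" "(\<lambda>n. l2norm M (u n)) \<longlonglongrightarrow> 0"
  shows "\<exists>r::nat\<Rightarrow>nat. strict_mono r \<and> (AE x in M. (\<lambda>n. u (r n) x) \<longlonglongrightarrow> 0)"
proof -
  have "(\<lambda>n. \<integral>x. norm ((cmod (u n x))\<^sup>2) \<partial>M) \<longlonglongrightarrow> 0"
    using tendsto_power[OF assms(2), of 2] by (simp add: l2norm_square)
  then obtain r :: "nat \<Rightarrow> nat" where r: "strict_mono r" "AE x in M. (\<lambda>n. (cmod (u (r n) x))\<^sup>2) \<longlonglongrightarrow> 0"
    using tendsto_L1_AE_subseq[of M "\<lambda>n x. (cmod (u n x))\<^sup>2"] L2_integrable_square[OF assms(1)] by auto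
  have "AE x in M. (\<lambda>n. u (r n) x) \<longlonglongrightarrow> 0"
    using r(2)
  proof eventually_elim
    case (elim x)
    from tendsto_real_sqrt[OF elim] show ?case by (simp add: tendsto_norm_zero_iff)
  qed
  with r show ?thesis by blast
qed

section \<open>Completeness of square integrable functions and nearest points\<close>

lemma L2_nn_integral_bound:
  assumes [measurable]: "f \<in> borel_measurable M"
    and le: "(\<integral>\<^sup>+x. ennreal ((cmod (f x))\<^sup>2) \<partial>M) \<le> ennreal (C\<^sup>2)" and "0 \<le> C"
  shows "f \<in> L2 M" "l2norm M f \<le> C"
proof -
  show f: "f \<in> L2 M" unfolding L2_def
    using le by (auto intro!: integrableI_bounded simp: less_top[symmetric] top_unique)
  have "(l2norm M f)\<^sup>2 \<le> C\<^sup>2"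
    using le nn_integral_eq_integral[OF L2_integrable_square[OF f]] by (simp add: l2norm_square)
  then show "l2norm M f \<le> C" using \<open>0 \<le> C\<close> by (rule power2_le_imp_le)
qed

lemma nn_integral_L2: "f \<in> L2 M \<Longrightarrow> (\<integral>\<^sup>+x. ennreal ((cmod (f x))\<^sup>2) \<partial>M) = ennreal ((l2norm M f)\<^sup>2)"
  using nn_integral_eq_integral[OF L2_integrable_square] by (simp add: l2norm_square)

text \<open>
  The Riesz--Fischer theorem. Along a subsequence whose increments have norms below \<open>2\<^sup>-\<^sup>n\<close>, the
  functions converge almost everywhere; by Fatou's lemma the pointwise limit is a limit in norm.
\<close>

lemma L2_complete:
  fixes u :: "nat \<Rightarrow> 'a \<Rightarrow> complex"
  assumes u: "\<And>n. u n \<in> L2 M"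
    and cauchy: "\<And>e. e > 0 \<Longrightarrow> \<exists>K. \<forall>m\<ge>K. \<forall>n\<ge>K. l2norm M (\<lambda>x. u m x - u n x) < e"
  obtains g where "g \<in> L2 M" "(\<lambda>n. l2norm M (\<lambda>x. u n x - g x)) \<longlonglongrightarrow> 0"
proof -
  note [measurable] = L2_measurable[OF u]
  have "\<exists>K. \<forall>m\<ge>K. \<forall>p\<ge>K. l2norm M (\<lambda>x. u m x - u p x) < (1/2)^n" for n
    using cauchy[of "(1/2)^n"] by simp
  then obtain K where K: "\<And>n m p. m \<ge> K n \<Longrightarrow> p \<ge> K n \<Longrightarrow> l2norm M (\<lambda>x. u m x - u p x) < (1/2)^n"
    by metis
  define r where "r n = n + (\<Sum>i\<le>n. K i)" for n
  have rK: "r n \<ge> K n" "r (Suc n) \<ge> K n" "r n \<ge> n" for n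
  proof -
    have "K n \<le> (\<Sum>i\<le>n. K i)" by (rule member_le_sum) auto
    then show "r n \<ge> K n" "r (Suc n) \<ge> K n" "r n \<ge> n"
      by (simp_all add: r_def)
  qed
  define d where "d n x = u (r (Suc n)) x - u (r n) x" for n x
  have d: "d n \<in> L2 M" "l2norm M (d n) < (1/2)^n" for n
    unfolding d_def[abs_def] using u K rK by (auto intro: L2_diff)
  note [measurable] = L2_measurable[OF d(1)]
  (* Absolute convergence of the increments follows from that of the weighted squares,
     since a <= 2^n * a^2 + 2^(-n); the squares can be integrated termwise. *)
  have "(\<integral>\<^sup>+x. (\<Sum>n. ennreal (2^n * (cmod (d n x))\<^sup>2)) \<partial>M)
      = (\<Sum>n. \<integral>\<^sup>+x. ennreal (2^n) * ennreal ((cmod (d n x))\<^sup>2) \<partial>M)"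
    by (subst nn_integral_suminf) (auto simp: ennreal_mult)
  also have "\<dots> = (\<Sum>n. ennreal (2^n * (l2norm M (d n))\<^sup>2))"
    by (subst nn_integral_cmult) (auto simp: nn_integral_L2[OF d(1)] ennreal_mult)
  also have "\<dots> \<le> (\<Sum>n. ennreal ((1/2)^n))"
  proof (intro suminf_le allI ennreal_leI)
    fix n
    have "(l2norm M (d n))\<^sup>2 \<le> ((1/2)^n)\<^sup>2"
      using d(2)[of n] by (intro power_mono) auto
    then have "2^n * (l2norm M (d n))\<^sup>2 \<le> 2^n * ((1/2)^n)\<^sup>2" by simp
    also have "\<dots> = (1/2)^n" by (simp add: power2_eq_square power_one_over)
    finally show "2^n * (l2norm M (d n))\<^sup>2 \<le> (1/2)^n" .
  qed auto
  also have "\<dots> < \<infinity>"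
    unfolding infinity_ennreal_def less_top[symmetric]
    by (intro ennreal_suminf_neq_top summable_geometric) auto
  finally have "AE x in M. (\<Sum>n. ennreal (2^n * (cmod (d n x))\<^sup>2)) \<noteq> \<infinity>"
    by (intro nn_integral_PInf_AE) auto
  then have conv: "AE x in M. convergent (\<lambda>n. u (r n) x)"
  proof eventually_elim
    case (elim x)
    then have "summable (\<lambda>n. 2^n * (cmod (d n x))\<^sup>2)"
      by (intro summable_suminf_not_top) auto
    then have "summable (\<lambda>n. 2^n * (cmod (d n x))\<^sup>2 + (1/2)^n)"
      by (intro summable_add summable_geometric) auto
    then have "summable (\<lambda>n. d n x)"
    proof (rule summable_comparison_test'[where N=0])
      fix n
      define a where "a = cmod (d n x)"
      define b where "b = (2::real)^n"
      have ab: "a \<ge> 0" "b > 0" by (auto simp: a_def b_def)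
      have "0 \<le> (b * a - 1)\<^sup>2" by simp
      then have "a * (2 * b) \<le> (b * a\<^sup>2 + 1 / b) * b"
        using ab by (simp add: power2_eq_square algebra_simps)
      also have "\<dots> \<le> (b * a\<^sup>2 + 1 / b) * (2 * b)"
        using ab by (intro mult_left_mono) auto
      finally have "a \<le> b * a\<^sup>2 + 1 / b" using ab by simp
      then show "norm (d n x) \<le> 2^n * (cmod (d n x))\<^sup>2 + (1/2)^n"
        by (simp add: a_def b_def power_one_over)
    qed
    then have "convergent (\<lambda>n. (\<Sum>i<n. d i x) + u (r 0) x)"
      by (intro convergent_add convergent_const) (simp add: summable_iff_convergent)
    moreover have "(\<Sum>i<n. d i x) + u (r 0) x = u (r n) x" for n
      by (induction n) (auto simp: d_def algebra_simps)
    ultimately show ?case by simp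
  qed
  define g where "g x = lim (\<lambda>n. u (r n) x)" for x
  have [measurable]: "g \<in> borel_measurable M"
    unfolding g_def[abs_def] by (rule borel_measurable_lim_metric) auto
  have bound: "(\<lambda>x. u m x - g x) \<in> L2 M \<and> l2norm M (\<lambda>x. u m x - g x) \<le> e"
    if e: "e > 0" and N: "\<forall>m\<ge>N. \<forall>n\<ge>N. l2norm M (\<lambda>x. u m x - u n x) < e" and m: "m \<ge> N" for e N m
  proof -
    have "(\<integral>\<^sup>+x. ennreal ((cmod (u m x - g x))\<^sup>2) \<partial>M)
        \<le> (\<integral>\<^sup>+x. liminf (\<lambda>n. ennreal ((cmod (u m x - u (r n) x))\<^sup>2)) \<partial>M)"
    proof (rule nn_integral_mono_AE)
      show "AE x in M. ennreal ((cmod (u m x - g x))\<^sup>2)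
          \<le> liminf (\<lambda>n. ennreal ((cmod (u m x - u (r n) x))\<^sup>2))"
        using conv
      proof eventually_elim
        case (elim x)
        then have "(\<lambda>n. u (r n) x) \<longlonglongrightarrow> g x" unfolding g_def by (simp add: convergent_LIMSEQ_iff)
        then have "(\<lambda>n. ennreal ((cmod (u m x - u (r n) x))\<^sup>2)) \<longlonglongrightarrow> ennreal ((cmod (u m x - g x))\<^sup>2)"
          by (intro tendsto_intros)
        then show ?case by (metis lim_imp_Liminf sequentially_bot order_refl)
      qed
    qed
    also have "\<dots> \<le> liminf (\<lambda>n. \<integral>\<^sup>+x. ennreal ((cmod (u m x - u (r n) x))\<^sup>2) \<partial>M)"
      by (rule nn_integral_liminf) auto
    also have "\<dots> \<le> ennreal (e\<^sup>2)"
    proof (rule Liminf_le)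
      have "(\<integral>\<^sup>+x. ennreal ((cmod (u m x - u (r n) x))\<^sup>2) \<partial>M) \<le> ennreal (e\<^sup>2)" if "n \<ge> N" for n
      proof -
        have "l2norm M (\<lambda>x. u m x - u (r n) x) < e"
          using N m that rK(3)[of n] by (meson order_trans)
        then show ?thesis
          unfolding nn_integral_L2[OF L2_diff[OF u u]] by (intro ennreal_leI power_mono) auto
      qed
      then show "\<forall>\<^sub>F n in sequentially. (\<integral>\<^sup>+x. ennreal ((cmod (u m x - u (r n) x))\<^sup>2) \<partial>M) \<le> ennreal (e\<^sup>2)"
        by (auto simp: eventually_sequentially)
    qed auto
    finally show ?thesis
      using L2_nn_integral_bound[of "\<lambda>x. u m x - g x" M e] e by simp
  qed
  obtain N where "\<forall>m\<ge>N. \<forall>n\<ge>N. l2norm M (\<lambda>x. u m x - u n x) < 1"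
    using cauchy[of 1] by auto
  then have "(\<lambda>x. u N x - (u N x - g x)) \<in> L2 M"
    using L2_diff[OF u[of N] conjunct1[OF bound[of 1 N N]]] by simp
  then have g: "g \<in> L2 M" by simp
  have "(\<lambda>n. l2norm M (\<lambda>x. u n x - g x)) \<longlonglongrightarrow> 0"
  proof (rule LIMSEQ_I)
    fix e :: real assume e: "e > 0"
    obtain N where N: "\<forall>m\<ge>N. \<forall>n\<ge>N. l2norm M (\<lambda>x. u m x - u n x) < e / 2"
      using cauchy[of "e / 2"] e by auto
    show "\<exists>N. \<forall>n\<ge>N. norm (l2norm M (\<lambda>x. u n x - g x) - 0) < e"
      using bound[OF _ N] e by (force intro!: exI[of _ N])
  qed
  with g show ?thesis by (rule that)
qed

text \<open>
  Hilbert space separation: \<open>r\<close> is the difference between \<open>p\<close> and its nearest point in the closure of \<open>Z\<close>,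
  so \<open>Z\<close> lies in the half space through that point orthogonal to \<open>r\<close>. If \<open>r\<close> vanishes, then \<open>p\<close> is a limit of
  elements of \<open>Z\<close>; otherwise \<open>r\<close> separates \<open>p\<close> from \<open>Z\<close>. The set \<open>Z\<close> need not be closed, which is why
  the nearest point appears only through a sequence.
\<close>

lemma L2_projection_convex:
  fixes Z :: "('a \<Rightarrow> complex) set"
  assumes Z: "Z \<subseteq> L2 M" "Z \<noteq> {}" and p: "p \<in> L2 M"
    and convex: "\<And>f g t. f \<in> Z \<Longrightarrow> g \<in> Z \<Longrightarrow> 0 \<le> t \<Longrightarrow> t \<le> 1
      \<Longrightarrow> (\<lambda>x. complex_of_real (1 - t) * f x + complex_of_real t * g x) \<in> Z"
  obtains r z where "r \<in> L2 M" "\<And>n. z n \<in> Z"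
    "(\<lambda>n. l2norm M (\<lambda>x. (p x - z n x) - r x)) \<longlonglongrightarrow> 0"
    "\<And>w. w \<in> Z \<Longrightarrow> Re (inprod M w r) \<le> Re (inprod M p r) - (l2norm M r)\<^sup>2"
proof -
  define D where "D = (\<lambda>z. (l2norm M (\<lambda>x. p x - z x))\<^sup>2) ` Z"
  define d where "d = Inf D"
  have "D \<noteq> {}" "bdd_below D" using Z(2) by (auto simp: D_def intro!: bdd_belowI[of _ 0])
  have d_le: "d \<le> (l2norm M (\<lambda>x. p x - z x))\<^sup>2" if "z \<in> Z" for z
    unfolding d_def using that \<open>bdd_below D\<close> by (intro cInf_lower) (auto simp: D_def)
  have "\<exists>z\<in>Z. (l2norm M (\<lambda>x. p x - z x))\<^sup>2 < d + 1 / real (Suc n)" for n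
    using cInf_lessD[OF \<open>D \<noteq> {}\<close>, of "d + 1 / real (Suc n)"] unfolding d_def D_def by force
  then obtain z where z: "\<And>n. z n \<in> Z"
    and zd: "\<And>n. (l2norm M (\<lambda>x. p x - z n x))\<^sup>2 < d + 1 / real (Suc n)"
    by metis
  define R where "R n x = p x - z n x" for n x
  have R: "R n \<in> L2 M" for n unfolding R_def[abs_def] using p z Z by (auto intro: L2_diff)
  have parallelogram: "(l2norm M (\<lambda>x. R m x - R n x))\<^sup>2 \<le> 2 / real (Suc m) + 2 / real (Suc n)" for m n
  proof -
    have "(\<lambda>x. complex_of_real (1 - 1/2) * z m x + complex_of_real (1/2) * z n x) \<in> Z"
      using convex[OF z z, of "1/2"] by simp
    from d_le[OF this] have "d \<le> (l2norm M (\<lambda>x. (1/2) * (R m x + R n x)))\<^sup>2"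
      by (simp add: R_def field_simps)
    then have "4 * d \<le> (l2norm M (\<lambda>x. R m x + R n x))\<^sup>2"
      unfolding l2norm_scale power_mult_distrib by (simp add: power2_eq_square)
    then show ?thesis
      using zd[of m] zd[of n]
      unfolding l2norm_add_square[OF R R] l2norm_diff_square[OF R R] R_def[symmetric] by simp
  qed
  obtain r where r: "r \<in> L2 M" "(\<lambda>n. l2norm M (\<lambda>x. R n x - r x)) \<longlonglongrightarrow> 0"
  proof (rule L2_complete[OF R])
    fix e :: real assume e: "e > 0"
    obtain K where K: "4 / e\<^sup>2 < real K" using reals_Archimedean2 by blast
    have "l2norm M (\<lambda>x. R m x - R n x) < e" if "m \<ge> K" "n \<ge> K" for m n
    proof (rule power2_less_imp_less)
      have small: "2 / real (Suc i) < e\<^sup>2 / 2" if "i \<ge> K" for i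
      proof -
        have "4 / e\<^sup>2 < real (Suc i)" using K that by linarith
        then show ?thesis using e by (simp add: field_simps)
      qed
      show "(l2norm M (\<lambda>x. R m x - R n x))\<^sup>2 < e\<^sup>2"
        using parallelogram[of m n] small[OF that(1)] small[OF that(2)] by linarith
    qed (use e in simp)
    then show "\<exists>K. \<forall>m\<ge>K. \<forall>n\<ge>K. l2norm M (\<lambda>x. R m x - R n x) < e" by blast
  qed
  have r_norm: "(l2norm M r)\<^sup>2 \<le> d"
  proof (rule LIMSEQ_le)
    show "(\<lambda>n. (l2norm M (R n))\<^sup>2) \<longlonglongrightarrow> (l2norm M r)\<^sup>2"
      by (intro tendsto_power l2norm_limit R r)
    show "(\<lambda>n. d + 1 / real (Suc n)) \<longlonglongrightarrow> d"
      using tendsto_add[OF tendsto_const[of d] LIMSEQ_inverse_real_of_nat]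
      by (simp add: inverse_eq_divide)
    show "\<exists>N. \<forall>n\<ge>N. (l2norm M (R n))\<^sup>2 \<le> d + 1 / real (Suc n)"
      using zd unfolding R_def by (auto intro: less_imp_le)
  qed
  show ?thesis
  proof (rule that[OF r(1) z])
    show "(\<lambda>n. l2norm M (\<lambda>x. (p x - z n x) - r x)) \<longlonglongrightarrow> 0"
      using r(2) by (simp add: R_def)
  next
    fix w assume w: "w \<in> Z"
    then have wL: "w \<in> L2 M" using Z by auto
    define q where "q x = p x - w x - r x" for x
    have q: "q \<in> L2 M" unfolding q_def[abs_def] by (intro L2_intros p r wL)
    (* First variation: moving from the nearest point towards w by the fraction t stays in the
       closure of Z, and therefore does not decrease the distance to p. *)
    have var: "0 \<le> 2 * Re (inprod M r q) + t * (l2norm M q)\<^sup>2" if t: "0 < t" "t \<le> 1" for t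
    proof -
      have step: "d \<le> (l2norm M (\<lambda>x. r x + complex_of_real t * q x))\<^sup>2"
      proof (rule LIMSEQ_le_const)
        define v where "v n x = R n x + complex_of_real t * (p x - w x - R n x)" for n x
        have vL: "v n \<in> L2 M" for n
          unfolding v_def[abs_def] by (intro L2_intros R p wL)
        have "(\<lambda>n. l2norm M (\<lambda>x. v n x - (r x + complex_of_real t * q x))) \<longlonglongrightarrow> 0"
        proof -
          have "v n x - (r x + complex_of_real t * q x) = complex_of_real (1 - t) * (R n x - r x)" for n x
            by (simp add: v_def q_def algebra_simps)
          then show ?thesis
            using tendsto_mult_right_zero[OF r(2), of "1 - t"] t by (simp add: l2norm_scale del: of_real_diff)
        qed
        then show "(\<lambda>n. (l2norm M (v n))\<^sup>2) \<longlonglongrightarrow> (l2norm M (\<lambda>x. r x + complex_of_real t * q x))\<^sup>2"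
          by (intro tendsto_power l2norm_limit vL L2_intros r q)
        have "d \<le> (l2norm M (v n))\<^sup>2" for n
        proof -
          have "p x - (complex_of_real (1 - t) * z n x + complex_of_real t * w x) = v n x" for x
            by (simp add: v_def R_def algebra_simps)
          with d_le[OF convex[OF z w, of t n]] t show ?thesis by simp
        qed
        then show "\<exists>N. \<forall>n\<ge>N. d \<le> (l2norm M (v n))\<^sup>2" by blast
      qed
      have "(l2norm M r)\<^sup>2 \<le> (l2norm M (\<lambda>x. r x + complex_of_real t * q x))\<^sup>2"
        using step r_norm by linarith
      also have "\<dots> = (l2norm M r)\<^sup>2 + t * (2 * Re (inprod M r q) + t * (l2norm M q)\<^sup>2)"
        using l2norm_add_square[OF r(1) L2_scale[OF q, of "complex_of_real t"]]
        by (simp add: inprod_scale_right l2norm_scale power_mult_distrib power2_eq_square algebra_simps)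
      finally show ?thesis using t by (simp add: zero_le_mult_iff)
    qed
    have "0 \<le> 2 * Re (inprod M r q)"
    proof (rule tendsto_lowerbound)
      show "((\<lambda>t. 2 * Re (inprod M r q) + t * (l2norm M q)\<^sup>2) \<longlongrightarrow> 2 * Re (inprod M r q)) (at_right 0)"
        by (auto intro!: tendsto_eq_intros)
      show "\<forall>\<^sub>F t in at_right 0. 0 \<le> 2 * Re (inprod M r q) + t * (l2norm M q)\<^sup>2"
        using var by (auto simp: eventually_at_right[of 0 1] intro!: exI[of _ 1])
    qed simp
    moreover have "Re (inprod M r q) = Re (inprod M q r)"
      by (subst inprod_commute) simp
    moreover have "Re (inprod M q r) = Re (inprod M p r) - Re (inprod M w r) - (l2norm M r)\<^sup>2"
      unfolding q_def[abs_def] using p wL r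
      by (simp add: inprod_diff_left L2_diff inprod_self)
    ultimately show "Re (inprod M w r) \<le> Re (inprod M p r) - (l2norm M r)\<^sup>2" by simp
  qed
qed

section \<open>Operators with square integrable kernels\<close>

definition tensor :: "('a \<Rightarrow> complex) \<Rightarrow> ('b \<Rightarrow> complex) \<Rightarrow> 'a \<times> 'b \<Rightarrow> complex" where
  "tensor f g = (\<lambda>p. f (fst p) * g (snd p))"

text \<open>
  The kernel of the Hilbert space adjoint of \<open>I\<^sub>k\<close>.
\<close>

definition adj_kernel :: "('a \<times> 'b \<Rightarrow> complex) \<Rightarrow> 'b \<times> 'a \<Rightarrow> complex" where
  "adj_kernel k = (\<lambda>(y, x). cnj (k (x, y)))"

text \<open>
  \<open>C\<close> bounds the operator norm of \<open>I\<^sub>k\<close>. A predicate is preferred to the supremum \<open>opnorm\<close>, which is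
  meaningful only once boundedness is known.
\<close>

definition op_bound :: "'a measure \<Rightarrow> 'b measure \<Rightarrow> ('a \<times> 'b \<Rightarrow> complex) \<Rightarrow> real \<Rightarrow> bool" where
  "op_bound M N k C \<longleftrightarrow> (\<forall>f\<in>L2 M. l2norm N (HS_op M k f) \<le> C * l2norm M f)"

lemma op_boundD: "op_bound M N k C \<Longrightarrow> f \<in> L2 M \<Longrightarrow> l2norm N (HS_op M k f) \<le> C * l2norm M f"
  by (simp add: op_bound_def)

lemma HS_op_scale: "HS_op M k (\<lambda>x. c * f x) = (\<lambda>y. c * HS_op M k f y)"
  by (simp add: HS_op_def mult.left_commute)

lemma HS_op_kernel_scale: "HS_op M (\<lambda>p. c * k p) f = (\<lambda>y. c * HS_op M k f y)"
  by (simp add: HS_op_def mult.assoc)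

lemma HS_op_tensor: "HS_op M (tensor a b) f = (\<lambda>y. (\<integral>x. a x * f x \<partial>M) * b y)"
proof
  fix y
  have "(\<integral>x. a x * b y * f x \<partial>M) = (\<integral>x. (a x * f x) * b y \<partial>M)" by (simp add: mult_ac)
  then show "HS_op M (tensor a b) f y = (\<integral>x. a x * f x \<partial>M) * b y"
    by (simp add: HS_op_def tensor_def)
qed

lemma HS_op_zero [simp]: "HS_op M (\<lambda>p. 0) f = (\<lambda>y. 0)"
  by (simp add: HS_op_def)

lemma op_bound_scale: "op_bound M N k C \<Longrightarrow> op_bound M N (\<lambda>p. c * k p) (cmod c * C)"
  unfolding op_bound_def HS_op_kernel_scale l2norm_scale mult.assoc by (simp add: mult_left_mono)

context pair_sigma_finite
begin

abbreviation "P \<equiv> M1 \<Otimes>\<^sub>M M2"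

lemma tensor_L2:
  assumes f: "f \<in> L2 M1" and g: "g \<in> L2 M2"
  shows "tensor f g \<in> L2 P" and "l2norm P (tensor f g) = l2norm M1 f * l2norm M2 g"
proof -
  note [measurable] = L2_measurable[OF f] L2_measurable[OF g]
  have [measurable]: "tensor f g \<in> borel_measurable P" unfolding tensor_def by measurable
  have nn: "(\<integral>\<^sup>+p. ennreal ((cmod (tensor f g p))\<^sup>2) \<partial>P) = ennreal ((l2norm M1 f * l2norm M2 g)\<^sup>2)"
  proof -
    have "(\<integral>\<^sup>+p. ennreal ((cmod (tensor f g p))\<^sup>2) \<partial>P)
        = (\<integral>\<^sup>+x. \<integral>\<^sup>+y. ennreal ((cmod (f x))\<^sup>2) * ennreal ((cmod (g y))\<^sup>2) \<partial>M2 \<partial>M1)"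
      by (subst M2.nn_integral_fst[symmetric])
         (auto simp: tensor_def norm_mult power_mult_distrib ennreal_mult)
    also have "\<dots> = ennreal ((l2norm M1 f)\<^sup>2) * ennreal ((l2norm M2 g)\<^sup>2)"
      by (simp add: nn_integral_cmult nn_integral_multc nn_integral_L2 f g)
    finally show ?thesis by (simp add: ennreal_mult power_mult_distrib)
  qed
  show L: "tensor f g \<in> L2 P"
    using L2_nn_integral_bound(1)[of "tensor f g" P "l2norm M1 f * l2norm M2 g"] nn by simp
  have "(l2norm P (tensor f g))\<^sup>2 = (l2norm M1 f * l2norm M2 g)\<^sup>2"
    using nn nn_integral_L2[OF L] by simp
  then show "l2norm P (tensor f g) = l2norm M1 f * l2norm M2 g"
    by (simp add: power2_eq_iff_nonneg)
qed

text \<open>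
  Kernels are handled through their sections: by Fubini almost every one of them is square
  integrable, so \<open>I\<^sub>k f\<close> is defined almost everywhere by an absolutely convergent integral.
\<close>

lemma L2_section:
  assumes h: "h \<in> L2 P" shows "AE y in M2. (\<lambda>x. h (x, y)) \<in> L2 M1"
proof -
  note [measurable] = L2_measurable[OF h]
  have "integrable P (\<lambda>(x, y). (cmod (h (x, y)))\<^sup>2)"
    using L2_integrable_square[OF h] by (simp add: case_prod_unfold)
  from AE_integrable_snd[OF this] AE_space
  show ?thesis by eventually_elim (auto simp: L2_def)
qed

lemma HS_integrable:
  assumes h: "h \<in> L2 P" and f: "f \<in> L2 M1"
  shows "AE y in M2. integrable M1 (\<lambda>x. h (x, y) * f x)"
  using L2_section[OF h] by eventually_elim (auto intro: L2_integrable_mult f)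

lemma HS_measurable [measurable]:
  assumes h: "h \<in> borel_measurable P" and f: "f \<in> borel_measurable M1"
  shows "HS_op M1 h f \<in> borel_measurable M2"
proof -
  note [measurable] = h f
  show ?thesis unfolding HS_op_def by measurable
qed

lemma
  assumes h: "h \<in> L2 P" and f: "f \<in> L2 M1"
  shows HS_L2: "HS_op M1 h f \<in> L2 M2"
    and HS_bound: "l2norm M2 (HS_op M1 h f) \<le> l2norm P h * l2norm M1 f"
proof -
  note [measurable] = L2_measurable[OF h] L2_measurable[OF f]
  have "(\<integral>\<^sup>+y. ennreal ((cmod (HS_op M1 h f y))\<^sup>2) \<partial>M2)
      \<le> (\<integral>\<^sup>+y. (\<integral>\<^sup>+x. ennreal ((cmod (h (x, y)))\<^sup>2) \<partial>M1) * ennreal ((l2norm M1 f)\<^sup>2) \<partial>M2)"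
  proof (rule nn_integral_mono_AE)
    show "AE y in M2. ennreal ((cmod (HS_op M1 h f y))\<^sup>2)
        \<le> (\<integral>\<^sup>+x. ennreal ((cmod (h (x, y)))\<^sup>2) \<partial>M1) * ennreal ((l2norm M1 f)\<^sup>2)"
      using L2_section[OF h]
    proof eventually_elim
      case (elim y)
      have "(cmod (HS_op M1 h f y))\<^sup>2 \<le> (l2norm M1 (\<lambda>x. h (x, y)) * l2norm M1 f)\<^sup>2"
        unfolding HS_op_def by (intro power_mono cauchy_schwarz_integral elim f) auto
      then show ?case
        unfolding nn_integral_L2[OF elim]
        by (simp add: ennreal_mult[symmetric] power_mult_distrib ennreal_leI)
    qed
  qed
  also have "\<dots> = (\<integral>\<^sup>+p. ennreal ((cmod (h p))\<^sup>2) \<partial>P) * ennreal ((l2norm M1 f)\<^sup>2)"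
    by (subst nn_integral_multc) (auto simp: nn_integral_snd[symmetric])
  also have "\<dots> = ennreal ((l2norm P h * l2norm M1 f)\<^sup>2)"
    by (simp add: nn_integral_L2[OF h] ennreal_mult power_mult_distrib)
  finally have nn: "(\<integral>\<^sup>+y. ennreal ((cmod (HS_op M1 h f y))\<^sup>2) \<partial>M2) \<le> ennreal ((l2norm P h * l2norm M1 f)\<^sup>2)" .
  show "HS_op M1 h f \<in> L2 M2" "l2norm M2 (HS_op M1 h f) \<le> l2norm P h * l2norm M1 f"
    using L2_nn_integral_bound[OF _ nn] by simp_all
qed

lemma HS_add:
  assumes h: "h \<in> L2 P" and f: "f \<in> L2 M1" and g: "g \<in> L2 M1"
  shows "AE y in M2. HS_op M1 h (\<lambda>x. f x + g x) y = HS_op M1 h f y + HS_op M1 h g y"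
  using HS_integrable[OF h f] HS_integrable[OF h g]
  by eventually_elim (simp add: HS_op_def distrib_left)

lemma HS_diff:
  assumes h: "h \<in> L2 P" and f: "f \<in> L2 M1" and g: "g \<in> L2 M1"
  shows "AE y in M2. HS_op M1 h (\<lambda>x. f x - g x) y = HS_op M1 h f y - HS_op M1 h g y"
  using HS_integrable[OF h f] HS_integrable[OF h g]
  by eventually_elim (simp add: HS_op_def right_diff_distrib)

lemma HS_kernel_add:
  assumes h: "h \<in> L2 P" and k: "k \<in> L2 P" and f: "f \<in> L2 M1"
  shows "AE y in M2. HS_op M1 (\<lambda>p. h p + k p) f y = HS_op M1 h f y + HS_op M1 k f y"
  using HS_integrable[OF h f] HS_integrable[OF k f]
  by eventually_elim (simp add: HS_op_def distrib_right)

lemma HS_kernel_diff: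
  assumes h: "h \<in> L2 P" and k: "k \<in> L2 P" and f: "f \<in> L2 M1"
  shows "AE y in M2. HS_op M1 (\<lambda>p. h p - k p) f y = HS_op M1 h f y - HS_op M1 k f y"
  using HS_integrable[OF h f] HS_integrable[OF k f]
  by eventually_elim (simp add: HS_op_def left_diff_distrib)

text \<open>
  By Fubini, matrix coefficients of \<open>I\<^sub>h\<close> are inner products of \<open>h\<close> with rank-one kernels. This translates
  statements about operators into statements in \<open>L\<^sup>2(X \<times> Y)\<close>, and back.
\<close>

lemma inprod_HS:
  assumes h: "h \<in> L2 P" and f: "f \<in> L2 M1" and g: "g \<in> L2 M2"
  shows "inprod M2 (HS_op M1 h f) g = inprod P h (tensor (\<lambda>x. cnj (f x)) g)"
proof -
  have "integrable P (\<lambda>p. h p * cnj (tensor (\<lambda>x. cnj (f x)) g p))"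
    by (intro L2_integrable_mult_cnj h tensor_L2 L2_cnj f g)
  then have int: "integrable P (\<lambda>(x, y). h (x, y) * cnj (tensor (\<lambda>x. cnj (f x)) g (x, y)))"
    by (simp add: case_prod_unfold)
  have "inprod P h (tensor (\<lambda>x. cnj (f x)) g)
      = (\<integral>y. (\<integral>x. h (x, y) * cnj (tensor (\<lambda>x. cnj (f x)) g (x, y)) \<partial>M1) \<partial>M2)"
    unfolding inprod_def integral_snd[OF int] by (simp add: case_prod_unfold)
  also have "\<dots> = inprod M2 (HS_op M1 h f) g"
    unfolding inprod_def HS_op_def tensor_def by (simp add: mult.assoc[symmetric])
  finally show ?thesis by simp
qed

lemma adj_kernel_L2:
  assumes "h \<in> L2 P" shows "adj_kernel h \<in> L2 (M2 \<Otimes>\<^sub>M M1)"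
proof -
  note [measurable] = L2_measurable[OF assms]
  have eq: "(cmod (adj_kernel h q))\<^sup>2 = (case q of (y, x) \<Rightarrow> (cmod (h (x, y)))\<^sup>2)" for q
    by (simp add: adj_kernel_def case_prod_unfold)
  have "adj_kernel h \<in> borel_measurable (M2 \<Otimes>\<^sub>M M1)" unfolding adj_kernel_def by measurable
  moreover have "integrable (M2 \<Otimes>\<^sub>M M1) (\<lambda>q. (cmod (adj_kernel h q))\<^sup>2)"
    unfolding eq by (rule integrable_product_swap[OF L2_integrable_square[OF assms]])
  ultimately show "adj_kernel h \<in> L2 (M2 \<Otimes>\<^sub>M M1)" by (simp add: L2_def)
qed

lemma inprod_HS_adj:
  assumes h: "h \<in> L2 P" and f: "f \<in> L2 M1" and g: "g \<in> L2 M2"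
  shows "inprod M2 (HS_op M1 h f) g = inprod M1 f (HS_op M2 (adj_kernel h) g)"
proof -
  note [measurable] = L2_measurable[OF h] L2_measurable[OF f] L2_measurable[OF g]
  interpret Q: pair_sigma_finite M2 M1 ..
  have "inprod M1 f (HS_op M2 (adj_kernel h) g)
      = cnj (inprod (M2 \<Otimes>\<^sub>M M1) (adj_kernel h) (tensor (\<lambda>y. cnj (g y)) f))"
    by (subst inprod_commute, subst Q.inprod_HS[OF adj_kernel_L2[OF h] g f]) simp
  also have "\<dots> = (\<integral>q. (case q of (y, x) \<Rightarrow> h (x, y) * cnj (tensor (\<lambda>x. cnj (f x)) g (x, y))) \<partial>(M2 \<Otimes>\<^sub>M M1))"
    unfolding inprod_def Bochner_Integration.integral_cnj[symmetric]
    by (rule Bochner_Integration.integral_cong) (auto simp: adj_kernel_def tensor_def)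
  also have "\<dots> = (\<integral>p. h p * cnj (tensor (\<lambda>x. cnj (f x)) g p) \<partial>P)"
    unfolding tensor_def by (rule integral_product_swap) measurable
  finally show ?thesis unfolding inprod_HS[OF h f g] inprod_def[of P] by simp
qed

text \<open>
  With \<open>w = T\<^sup>* g\<close>, one has \<open>\<parallel>w\<parallel>\<^sup>2 = \<langle>T w, g\<rangle> \<le> C \<parallel>w\<parallel> \<parallel>g\<parallel>\<close>.
\<close>

lemma op_bound_adj:
  assumes h: "h \<in> L2 P" and C: "0 \<le> C" and b: "op_bound M1 M2 h C"
  shows "op_bound M2 M1 (adj_kernel h) C"
  unfolding op_bound_def
proof
  interpret Q: pair_sigma_finite M2 M1 ..
  fix g assume g: "g \<in> L2 M2"
  define w where "w = HS_op M2 (adj_kernel h) g"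
  have w: "w \<in> L2 M1" unfolding w_def by (rule Q.HS_L2[OF adj_kernel_L2[OF h] g])
  have "complex_of_real ((l2norm M1 w)\<^sup>2) = inprod M2 (HS_op M1 h w) g"
    unfolding inprod_HS_adj[OF h w g] w_def[symmetric] inprod_self ..
  then have "(l2norm M1 w)\<^sup>2 = cmod (inprod M2 (HS_op M1 h w) g)"
    by (metis abs_of_nonneg norm_of_real zero_le_power2)
  also have "\<dots> \<le> l2norm M2 (HS_op M1 h w) * l2norm M2 g"
    by (intro cauchy_schwarz_inprod HS_L2 h w g)
  also have "\<dots> \<le> (C * l2norm M1 w) * l2norm M2 g"
    by (intro mult_right_mono op_boundD[OF b w]) simp
  finally have "l2norm M1 w * l2norm M1 w \<le> (C * l2norm M2 g) * l2norm M1 w"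
    by (simp add: power2_eq_square mult_ac)
  then show "l2norm M1 (HS_op M2 (adj_kernel h) g) \<le> C * l2norm M2 g"
    unfolding w_def[symmetric] using C l2norm_nonneg[of M1 w]
    by (cases "l2norm M1 w = 0") auto
qed

lemma op_bound_l2norm: "h \<in> L2 P \<Longrightarrow> op_bound M1 M2 h (l2norm P h)"
  by (simp add: op_bound_def HS_bound)

lemma op_bound_add:
  assumes h: "h \<in> L2 P" and k: "k \<in> L2 P" and "op_bound M1 M2 h C" "op_bound M1 M2 k D"
  shows "op_bound M1 M2 (\<lambda>p. h p + k p) (C + D)"
  unfolding op_bound_def
proof
  fix f assume f: "f \<in> L2 M1"
  have "l2norm M2 (HS_op M1 (\<lambda>p. h p + k p) f) = l2norm M2 (\<lambda>y. HS_op M1 h f y + HS_op M1 k f y)"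
    using HS_kernel_add[OF h k f]
    by (intro l2norm_cong_AE L2_measurable[OF HS_L2] L2_measurable[OF L2_add] L2_add HS_L2 h k f)
  also have "\<dots> \<le> l2norm M2 (HS_op M1 h f) + l2norm M2 (HS_op M1 k f)"
    by (intro l2norm_triangle HS_L2 h k f)
  also have "\<dots> \<le> C * l2norm M1 f + D * l2norm M1 f"
    by (intro add_mono op_boundD assms f)
  finally show "l2norm M2 (HS_op M1 (\<lambda>p. h p + k p) f) \<le> (C + D) * l2norm M1 f"
    by (simp add: distrib_right)
qed

end

section \<open>Rank-one kernels are total and Hilbert--Schmidt operators are compact\<close>

lemma L2_indicator:
  "A \<in> sets M \<Longrightarrow> emeasure M A < \<infinity> \<Longrightarrow> (\<lambda>x. indicator A x) \<in> L2 M"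
  by (rule L2_dominated[where w="indicator A"])
     (auto simp: integrable_indicator_iff indicator_def)

text \<open>
  Kernels of finite rank operators, as sums of products. They are generated inductively because this
  is the form in which compactness is proved for them.
\<close>

inductive_set finite_rank :: "'a measure \<Rightarrow> 'b measure \<Rightarrow> ('a \<times> 'b \<Rightarrow> complex) set"
  for M :: "'a measure" and N :: "'b measure" where
  tensor: "f \<in> L2 M \<Longrightarrow> g \<in> L2 N \<Longrightarrow> tensor f g \<in> finite_rank M N"
| add: "z \<in> finite_rank M N \<Longrightarrow> w \<in> finite_rank M N \<Longrightarrow> (\<lambda>p. z p + w p) \<in> finite_rank M N"

lemma finite_rank_scale: "z \<in> finite_rank M N \<Longrightarrow> (\<lambda>p. c * z p) \<in> finite_rank M N"
proof (induction rule: finite_rank.induct)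
  case (tensor f g)
  have "(\<lambda>p. c * tensor f g p) = tensor (\<lambda>x. c * f x) g"
    by (auto simp: tensor_def mult.assoc)
  with tensor show ?case by (simp add: finite_rank.tensor L2_scale)
next
  case (add z w)
  then show ?case unfolding distrib_left by (intro finite_rank.add)
qed

text \<open>
  \<open>F\<close> is a set of test functions that controls the operator of \<open>z\<close>: convergence of the coefficients against \<open>F\<close>
  forces the images to be Cauchy in norm. For finite rank \<open>z\<close> a finite \<open>F\<close> suffices, and this reduces
  compactness to a diagonal argument over countably many scalar sequences.
\<close>

definition tests_kernel ::
  "'a measure \<Rightarrow> 'b measure \<Rightarrow> ('a \<Rightarrow> complex) set \<Rightarrow> ('a \<times> 'b \<Rightarrow> complex) \<Rightarrow> bool" where
  "tests_kernel M N F z \<longleftrightarrow>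
    (\<forall>u e. (\<forall>n::nat. u n \<in> L2 M) \<longrightarrow> (\<forall>f\<in>F. convergent (\<lambda>n. \<integral>x. f x * u n x \<partial>M)) \<longrightarrow> e > 0 \<longrightarrow>
      (\<exists>K. \<forall>m\<ge>K. \<forall>n\<ge>K. l2norm N (\<lambda>y. HS_op M z (u m) y - HS_op M z (u n) y) < e))"

lemma tests_kernelD:
  assumes "tests_kernel M N F z" "\<And>n::nat. u n \<in> L2 M"
    and "\<And>f. f \<in> F \<Longrightarrow> convergent (\<lambda>n. \<integral>x. f x * u n x \<partial>M)" and "e > 0"
  obtains K where "\<And>m n. m \<ge> K \<Longrightarrow> n \<ge> K \<Longrightarrow> l2norm N (\<lambda>y. HS_op M z (u m) y - HS_op M z (u n) y) < e"
  using assms unfolding tests_kernel_def by meson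

context pair_sigma_finite
begin

text \<open>
  Products of indicators of finite measure sets show that \<open>h\<close> has integral zero over all measurable
  rectangles inside a box of finite measure. Rectangles form an intersection-stable generator, so
  \<open>h\<close> has integral zero over every measurable subset of the box, hence vanishes there; boxes exhaust
  the product.
\<close>

lemma kernel_eq_0_if_orthogonal_tensors:
  assumes h: "h \<in> L2 P"
    and orth: "\<And>f g. f \<in> L2 M1 \<Longrightarrow> g \<in> L2 M2 \<Longrightarrow> inprod P h (tensor f g) = 0"
  shows "AE p in P. h p = 0"
proof -
  note [measurable] = L2_measurable[OF h]
  obtain A where A: "range A \<subseteq> sets M1" "(\<Union>i. A i) = space M1" "\<And>i::nat. emeasure M1 (A i) \<noteq> \<infinity>" "incseq A"
    using M1.sigma_finite_incseq by blast
  obtain B where B: "range B \<subseteq> sets M2" "(\<Union>i. B i) = space M2" "\<And>i::nat. emeasure M2 (B i) \<noteq> \<infinity>" "incseq B"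
    using M2.sigma_finite_incseq by blast
  have box: "AE p in P. indicator (A i \<times> B i) p * h p = 0" for i
  proof -
    have [measurable]: "A i \<in> sets M1" "B i \<in> sets M2" using A(1) B(1) by auto
    define k where "k p = indicator (A i \<times> B i) p * h p" for p
    have rect: "inprod P h (tensor (indicator (a \<inter> A i)) (indicator (b \<inter> B i))) = 0"
      if [measurable]: "a \<in> sets M1" "b \<in> sets M2" for a b
    proof (intro orth L2_indicator)
      show "emeasure M1 (a \<inter> A i) < \<infinity>"
        using emeasure_mono[of "a \<inter> A i" "A i" M1] A(3)[of i] by (auto simp: less_top[symmetric] top_unique)
      show "emeasure M2 (b \<inter> B i) < \<infinity>"
        using emeasure_mono[of "b \<inter> B i" "B i" M2] B(3)[of i] by (auto simp: less_top[symmetric] top_unique)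
    qed measurable
    have ktens: "k = (\<lambda>p. h p * tensor (indicator (A i)) (indicator (B i)) p)"
      by (auto simp: k_def tensor_def indicator_def fun_eq_iff)
    have int: "integrable P k"
      unfolding ktens
      by (intro L2_integrable_mult h tensor_L2 L2_indicator)
         (use A(3)[of i] B(3)[of i] in \<open>auto simp: less_top\<close>)
    have rect0: "set_lebesgue_integral P (a \<times> b) k = 0" if "a \<in> sets M1" "b \<in> sets M2" for a b
    proof -
      have "set_lebesgue_integral P (a \<times> b) k
          = inprod P h (tensor (indicator (a \<inter> A i)) (indicator (b \<inter> B i)))"
        unfolding set_lebesgue_integral_def inprod_def ktens
        by (intro Bochner_Integration.integral_cong) (auto simp: tensor_def indicator_def)
      then show ?thesis by (simp add: rect that)
    qed
    have "AE p in P. k p = 0"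
    proof (rule P.density_zero[OF int])
      fix E assume E: "E \<in> sets P"
      have setint: "set_integrable P S k" if "S \<in> sets P" for S
        unfolding set_integrable_def by (rule integrable_mult_indicator[OF that int])
      have *: "E \<in> sigma_sets (space M1 \<times> space M2) {a \<times> b | a b. a \<in> sets M1 \<and> b \<in> sets M2}"
        using E by (simp add: sets_pair_measure)
      have sub: "{a \<times> b | a b. a \<in> sets M1 \<and> b \<in> sets M2} \<subseteq> Pow (space M1 \<times> space M2)"
        by (rule pair_measure_closed)
      show "set_lebesgue_integral P E k = 0"
        using Int_stable_pair_measure_generator[of M1 M2] sub *
      proof (induction rule: sigma_sets_induct_disjoint)
        case (basic E)
        then show ?case using rect0 by auto
      next
        case empty
        show ?case by (simp add: set_lebesgue_integral_def)
      next
        case (compl E)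
        then have E: "E \<in> sets P" by (simp add: sets_pair_measure)
        then have "E \<subseteq> space M1 \<times> space M2" using sets.sets_into_space space_pair_measure by metis
        then have "set_lebesgue_integral P (space M1 \<times> space M2) k
            = set_lebesgue_integral P (space M1 \<times> space M2 - E) k + set_lebesgue_integral P E k"
          using set_integral_Un[of "space M1 \<times> space M2 - E" E P k] E setint
          by (auto simp: Un_absorb2)
        then show ?case using rect0[OF sets.top sets.top] compl by simp
      next
        case (union F)
        then have F: "F j \<in> sets P" for j by (auto simp: sets_pair_measure)
        have "set_lebesgue_integral P (\<Union>j. F j) k = (\<Sum>j. set_lebesgue_integral P (F j) k)"
          using F union(1)
          by (intro lebesgue_integral_countable_add setint) (auto simp: disjoint_family_on_def)
        then show ?case using union by simp
      qed
    qed
    then show ?thesis by (simp add: k_def)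
  qed
  have "AE p in P. \<forall>i. indicator (A i \<times> B i) p * h p = 0"
    unfolding AE_all_countable using box by blast
  with AE_space show ?thesis
  proof eventually_elim
    case (elim p)
    have "fst p \<in> (\<Union>i. A i)" "snd p \<in> (\<Union>j. B j)"
      unfolding A(2) B(2) using elim(1) by (auto simp: space_pair_measure)
    then obtain i j where "fst p \<in> A i" "snd p \<in> B j" by blast
    then have "p \<in> A (max i j) \<times> B (max i j)"
      using A(4) B(4) monoD[of A i "max i j"] monoD[of B j "max i j"] by (auto simp: mem_Times_iff)
    then show ?case using elim(2) by (auto dest: spec[of _ "max i j"])
  qed
qed

lemma kernel_eq_0_if_op_bound_0:
  assumes h: "h \<in> L2 P" and b: "op_bound M1 M2 h 0"
  shows "AE p in P. h p = 0"
proof (rule kernel_eq_0_if_orthogonal_tensors[OF h])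
  fix f g assume f: "f \<in> L2 M1" and g: "g \<in> L2 M2"
  have f': "(\<lambda>x. cnj (f x)) \<in> L2 M1" by (rule L2_cnj[OF f])
  have "l2norm M2 (HS_op M1 h (\<lambda>x. cnj (f x))) = 0"
    using op_boundD[OF b f'] by (simp add: order_antisym)
  then have "cmod (inprod M2 (HS_op M1 h (\<lambda>x. cnj (f x))) g) \<le> 0"
    using cauchy_schwarz_inprod[OF HS_L2[OF h f'] g] by simp
  then show "inprod P h (tensor f g) = 0"
    using inprod_HS[OF h f' g] by simp
qed

lemma finite_rank_L2: "z \<in> finite_rank M1 M2 \<Longrightarrow> z \<in> L2 P"
  by (induction rule: finite_rank.induct) (auto intro: tensor_L2 L2_add)

text \<open>
  The residual of the projection onto the linear space of finite rank kernels is orthogonal to all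
  products, so it vanishes by totality.
\<close>

lemma finite_rank_dense:
  assumes h: "h \<in> L2 P"
  obtains z where "\<And>n. z n \<in> finite_rank M1 M2" "(\<lambda>n. l2norm P (\<lambda>p. h p - z n p)) \<longlonglongrightarrow> 0"
proof -
  let ?Z = "finite_rank M1 M2"
  have Z: "?Z \<subseteq> L2 P" "?Z \<noteq> {}" using finite_rank_L2 finite_rank.tensor[OF L2_zero L2_zero] by auto
  obtain r z where r: "r \<in> L2 P" and z: "\<And>n. z n \<in> ?Z"
    and lim: "(\<lambda>n. l2norm P (\<lambda>x. (h x - z n x) - r x)) \<longlonglongrightarrow> 0"
    and var: "\<And>w. w \<in> ?Z \<Longrightarrow> Re (inprod P w r) \<le> Re (inprod P h r) - (l2norm P r)\<^sup>2"
  proof (rule L2_projection_convex[OF Z h])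
    show "(\<lambda>p. complex_of_real (1 - t) * v p + complex_of_real t * w p) \<in> ?Z"
      if "v \<in> ?Z" "w \<in> ?Z" for v w t
      by (intro finite_rank.add finite_rank_scale that)
  qed blast
  have "AE p in P. r p = 0"
  proof (rule kernel_eq_0_if_orthogonal_tensors[OF r])
    fix f g assume f: "f \<in> L2 M1" and g: "g \<in> L2 M2"
    define c where "c = inprod P (tensor f g) r"
    define K where "K = Re (inprod P h r) - (l2norm P r)\<^sup>2"
    (* The half space of the projection contains the whole line through any product, which
       forces orthogonality. *)
    have le: "t * (cmod c)\<^sup>2 \<le> K" for t :: real
    proof -
      have "Re (inprod P (\<lambda>p. (complex_of_real t * cnj c) * tensor f g p) r) \<le> K"
        unfolding K_def by (intro var finite_rank_scale finite_rank.tensor f g)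
      also have "inprod P (\<lambda>p. (complex_of_real t * cnj c) * tensor f g p) r = complex_of_real (t * (cmod c)\<^sup>2)"
        unfolding inprod_scale_left c_def[symmetric] by (simp add: complex_norm_square[symmetric] mult_ac)
      finally show ?thesis by simp
    qed
    have "c = 0"
    proof (rule ccontr)
      assume "c \<noteq> 0"
      then have "(cmod c)\<^sup>2 > 0" by simp
      then show False
        using le[of "(K + 1) / (cmod c)\<^sup>2"] by simp
    qed
    then show "inprod P r (tensor f g) = 0"
      unfolding c_def by (subst inprod_commute) simp
  qed
  moreover have "l2norm P (\<lambda>p. h p - z n p) = l2norm P (\<lambda>p. (h p - z n p) - r p)" if "AE p in P. r p = 0" for n
    using that by (intro l2norm_cong_AE L2_measurable L2_intros h r finite_rank_L2 z) auto
  ultimately show ?thesis using that[OF z] lim by simp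
qed

lemma finite_rank_test_functions:
  assumes "z \<in> finite_rank M1 M2"
  shows "\<exists>F. finite F \<and> F \<subseteq> L2 M1 \<and> tests_kernel M1 M2 F z"
  using assms
proof (induction rule: finite_rank.induct)
  case (tensor f g)
  have "\<exists>K. \<forall>m\<ge>K. \<forall>n\<ge>K. l2norm M2 (\<lambda>y. HS_op M1 (tensor f g) (u m) y - HS_op M1 (tensor f g) (u n) y) < e"
    if conv: "convergent (\<lambda>n. \<integral>x. f x * u n x \<partial>M1)" and e: "e > 0" for u :: "nat \<Rightarrow> 'a \<Rightarrow> complex" and e
  proof -
    define a where "a n = (\<integral>x. f x * u n x \<partial>M1)" for n
    define G where "G = l2norm M2 g + 1"
    have G: "G > 0" "l2norm M2 g < G" by (auto simp: G_def add_nonneg_pos)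
    have "Cauchy a" using conv convergent_Cauchy unfolding a_def by blast
    then obtain K where K: "\<forall>m\<ge>K. \<forall>n\<ge>K. norm (a m - a n) < e / G"
      using CauchyD[of a "e / G"] e G by auto
    have "l2norm M2 (\<lambda>y. HS_op M1 (tensor f g) (u m) y - HS_op M1 (tensor f g) (u n) y) < e"
      if "m \<ge> K" "n \<ge> K" for m n
    proof -
      have "l2norm M2 (\<lambda>y. HS_op M1 (tensor f g) (u m) y - HS_op M1 (tensor f g) (u n) y)
          = cmod (a m - a n) * l2norm M2 g"
        unfolding HS_op_tensor a_def[symmetric] left_diff_distrib[symmetric] l2norm_scale ..
      also have "\<dots> \<le> cmod (a m - a n) * G" using G by (intro mult_left_mono) auto
      also have "\<dots> < e" using K that G by (simp add: pos_less_divide_eq)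
      finally show ?thesis .
    qed
    then show ?thesis by blast
  qed
  then have "tests_kernel M1 M2 {f} (tensor f g)" unfolding tests_kernel_def by simp
  with tensor show ?case by (intro exI[of _ "{f}"]) simp
next
  case (add z w)
  obtain F where F: "finite F" "F \<subseteq> L2 M1" "tests_kernel M1 M2 F z"
    using add.IH(1) by blast
  obtain G where G: "finite G" "G \<subseteq> L2 M1" "tests_kernel M1 M2 G w"
    using add.IH(2) by blast
  note zL = finite_rank_L2[OF add.hyps(1)] and wL = finite_rank_L2[OF add.hyps(2)]
  have "\<exists>K. \<forall>m\<ge>K. \<forall>n\<ge>K. l2norm M2 (\<lambda>y. HS_op M1 (\<lambda>p. z p + w p) (u m) y - HS_op M1 (\<lambda>p. z p + w p) (u n) y) < e"
    if u: "\<And>n. u n \<in> L2 M1" and conv: "\<And>f. f \<in> F \<union> G \<Longrightarrow> convergent (\<lambda>n. \<integral>x. f x * u n x \<partial>M1)" and e: "e > 0"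
    for u :: "nat \<Rightarrow> 'a \<Rightarrow> complex" and e
  proof -
    obtain K where K: "\<And>m n. m \<ge> K \<Longrightarrow> n \<ge> K \<Longrightarrow> l2norm M2 (\<lambda>y. HS_op M1 z (u m) y - HS_op M1 z (u n) y) < e / 2"
      by (rule tests_kernelD[OF F(3) u conv, of "e / 2"]) (use e in auto)
    obtain L where L: "\<And>m n. m \<ge> L \<Longrightarrow> n \<ge> L \<Longrightarrow> l2norm M2 (\<lambda>y. HS_op M1 w (u m) y - HS_op M1 w (u n) y) < e / 2"
      by (rule tests_kernelD[OF G(3) u conv, of "e / 2"]) (use e in auto)
    have "l2norm M2 (\<lambda>y. HS_op M1 (\<lambda>p. z p + w p) (u m) y - HS_op M1 (\<lambda>p. z p + w p) (u n) y) < e"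
      if mn: "m \<ge> max K L" "n \<ge> max K L" for m n
    proof -
      have "l2norm M2 (\<lambda>y. HS_op M1 (\<lambda>p. z p + w p) (u m) y - HS_op M1 (\<lambda>p. z p + w p) (u n) y)
          = l2norm M2 (\<lambda>y. (HS_op M1 z (u m) y - HS_op M1 z (u n) y) + (HS_op M1 w (u m) y - HS_op M1 w (u n) y))"
        using HS_kernel_add[OF zL wL u, of m] HS_kernel_add[OF zL wL u, of n]
        by (intro l2norm_cong_AE L2_measurable L2_intros HS_L2 zL wL u) auto
      also have "\<dots> \<le> l2norm M2 (\<lambda>y. HS_op M1 z (u m) y - HS_op M1 z (u n) y)
          + l2norm M2 (\<lambda>y. HS_op M1 w (u m) y - HS_op M1 w (u n) y)"
        by (intro l2norm_triangle L2_intros HS_L2 zL wL u)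
      also have "\<dots> < e / 2 + e / 2" using K L mn by (intro add_strict_mono) auto
      finally show ?thesis by simp
    qed
    then show ?thesis by blast
  qed
  then have "tests_kernel M1 M2 (F \<union> G) (\<lambda>p. z p + w p)" unfolding tests_kernel_def by blast
  then show ?case using F G by (intro exI[of _ "F \<union> G"]) simp
qed

text \<open>
  Finite rank kernels \<open>z\<^sub>j\<close> approximate \<open>h\<close>. A diagonal subsequence makes the coefficients against all test
  functions of all \<open>z\<^sub>j\<close> converge; a three epsilon argument then shows that the images under \<open>I\<^sub>h\<close> are
  Cauchy.
\<close>

lemma HS_compact_subseq:
  assumes h: "h \<in> L2 P" and u: "\<And>n::nat. u n \<in> L2 M1" and u1: "\<And>n. l2norm M1 (u n) \<le> 1"
  obtains r g where "strict_mono (r :: nat \<Rightarrow> nat)" "g \<in> L2 M2"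
    "(\<lambda>n. l2norm M2 (\<lambda>y. HS_op M1 h (u (r n)) y - g y)) \<longlonglongrightarrow> 0"
proof -
  obtain z where z: "\<And>n. z n \<in> finite_rank M1 M2" and zh: "(\<lambda>n. l2norm P (\<lambda>p. h p - z n p)) \<longlonglongrightarrow> 0"
    using finite_rank_dense[OF h] by blast
  note zL = finite_rank_L2[OF z]
  obtain F where F: "\<And>j. finite (F j)" "\<And>j. F j \<subseteq> L2 M1" "\<And>j. tests_kernel M1 M2 (F j) (z j)"
    using finite_rank_test_functions[OF z] by metis
  (* The coefficients are divided by 1 + norm f to have one bound for all test functions,
     as the diagonal lemma requires. *)
  have bounded: "norm ((\<integral>x. f x * u n x \<partial>M1) / complex_of_real (1 + l2norm M1 f)) \<le> 1"
    if "f \<in> (\<Union>j. F j)" for n f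
  proof -
    have f: "f \<in> L2 M1" using that F by auto
    have "cmod (\<integral>x. f x * u n x \<partial>M1) \<le> l2norm M1 f * l2norm M1 (u n)"
      by (rule cauchy_schwarz_integral[OF f u])
    also have "\<dots> \<le> l2norm M1 f * 1" by (intro mult_left_mono u1) simp
    also have "\<dots> \<le> 1 + l2norm M1 f" by simp
    finally have "cmod (\<integral>x. f x * u n x \<partial>M1) / (1 + l2norm M1 f) \<le> 1"
      by (simp add: divide_le_eq add_pos_nonneg)
    then show ?thesis by (simp add: norm_divide del: of_real_add)
  qed
  obtain r :: "nat \<Rightarrow> nat" where r: "strict_mono r"
    and rl: "\<And>f. f \<in> (\<Union>j. F j) \<Longrightarrow> \<exists>l. (\<lambda>n. (\<integral>x. f x * u (r n) x \<partial>M1) / complex_of_real (1 + l2norm M1 f)) \<longlonglongrightarrow> l"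
  proof (rule function_convergent_subsequence[of "\<Union>j. F j"
        "\<lambda>n f. (\<integral>x. f x * u n x \<partial>M1) / complex_of_real (1 + l2norm M1 f)" 1])
    show "countable (\<Union>j. F j)" using F(1) by (intro countable_UN) (auto intro: countable_finite)
    show "norm ((\<integral>x. f x * u n x \<partial>M1) / complex_of_real (1 + l2norm M1 f)) \<le> 1"
      if "f \<in> (\<Union>j. F j)" for n f using that by (rule bounded)
  qed blast
  have conv: "convergent (\<lambda>n. \<integral>x. f x * u (r n) x \<partial>M1)" if f: "f \<in> F j" for f j
  proof -
    have nz: "complex_of_real (1 + l2norm M1 f) \<noteq> 0"
      using l2norm_nonneg[of M1 f] by (metis add_nonneg_eq_0_iff of_real_eq_0_iff zero_le_one zero_neq_one)
    obtain l where "(\<lambda>n. (\<integral>x. f x * u (r n) x \<partial>M1) / complex_of_real (1 + l2norm M1 f)) \<longlonglongrightarrow> l"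
      using rl f by blast
    from tendsto_mult[OF this tendsto_const[of "complex_of_real (1 + l2norm M1 f)"]]
    show ?thesis unfolding convergent_def using nz by auto
  qed
  obtain g where "g \<in> L2 M2" "(\<lambda>n. l2norm M2 (\<lambda>y. HS_op M1 h (u (r n)) y - g y)) \<longlonglongrightarrow> 0"
  proof (rule L2_complete[of "\<lambda>n. HS_op M1 h (u (r n))"])
    show "HS_op M1 h (u (r n)) \<in> L2 M2" for n by (rule HS_L2[OF h u])
  next
    fix e :: real assume e: "e > 0"
    obtain j where j: "l2norm P (\<lambda>p. h p - z j p) < e / 3"
      using order_tendstoD(2)[OF zh, of "e / 3"] e by (auto simp: eventually_sequentially)
    obtain K where K: "\<And>m n. m \<ge> K \<Longrightarrow> n \<ge> K \<Longrightarrow>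
        l2norm M2 (\<lambda>y. HS_op M1 (z j) (u (r m)) y - HS_op M1 (z j) (u (r n)) y) < e / 3"
      by (rule tests_kernelD[OF F(3)[of j], of "\<lambda>n. u (r n)" "e / 3"]) (use u conv e in auto)
    have close: "l2norm M2 (\<lambda>y. HS_op M1 h (u n) y - HS_op M1 (z j) (u n) y) < e / 3" for n
    proof -
      have "l2norm M2 (\<lambda>y. HS_op M1 h (u n) y - HS_op M1 (z j) (u n) y)
          = l2norm M2 (HS_op M1 (\<lambda>p. h p - z j p) (u n))"
        using HS_kernel_diff[OF h zL u, of j n]
        by (intro l2norm_cong_AE L2_measurable L2_intros HS_L2 h zL u) auto
      also have "\<dots> \<le> l2norm P (\<lambda>p. h p - z j p) * l2norm M1 (u n)"
        by (intro HS_bound L2_intros h zL u)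
      also have "\<dots> \<le> l2norm P (\<lambda>p. h p - z j p) * 1"
        by (intro mult_left_mono u1) simp
      finally show ?thesis using j by simp
    qed
    have "l2norm M2 (\<lambda>y. HS_op M1 h (u (r m)) y - HS_op M1 h (u (r n)) y) < e" if "m \<ge> K" "n \<ge> K" for m n
    proof -
      note L = HS_L2[OF h u] HS_L2[OF zL u]
      have "l2norm M2 (\<lambda>y. HS_op M1 h (u (r m)) y - HS_op M1 h (u (r n)) y)
        \<le> l2norm M2 (\<lambda>y. HS_op M1 h (u (r m)) y - HS_op M1 (z j) (u (r m)) y)
         + (l2norm M2 (\<lambda>y. HS_op M1 (z j) (u (r m)) y - HS_op M1 (z j) (u (r n)) y)
         + l2norm M2 (\<lambda>y. HS_op M1 (z j) (u (r n)) y - HS_op M1 h (u (r n)) y))"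
        by (rule order_trans[OF l2norm_triangle_between[OF L(1) L(2) L(1)]
              add_left_mono[OF l2norm_triangle_between[OF L(2) L(2) L(1)]]])
      also have "\<dots> < e / 3 + (e / 3 + e / 3)"
        using K[OF that] close[of "r m"] close[of "r n"]
          l2norm_minus_commute[of M2 "HS_op M1 (z j) (u (r n))" "HS_op M1 h (u (r n))"]
        by linarith
      finally show ?thesis by simp
    qed
    then show "\<exists>K. \<forall>m\<ge>K. \<forall>n\<ge>K. l2norm M2 (\<lambda>y. HS_op M1 h (u (r m)) y - HS_op M1 h (u (r n)) y) < e" by blast
  qed
  with r show ?thesis by (rule that)
qed

lemma HS_op_compact:
  assumes h: "h \<in> L2 P" shows "HS_op M1 h \<in> compact_ops M1 M2"
  unfolding compact_ops_def bounded_op_def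
proof (intro CollectI conjI allI ballI impI)
  show "\<exists>C. \<forall>f\<in>L2 M1. l2norm M2 (HS_op M1 h f) \<le> C * l2norm M1 f"
    using HS_bound[OF h] by blast
next
  fix u :: "nat \<Rightarrow> 'a \<Rightarrow> complex"
  assume u: "\<forall>n. u n \<in> L2 M1 \<and> l2norm M1 (u n) \<le> 1"
  obtain r g where "strict_mono (r :: nat \<Rightarrow> nat)" "g \<in> L2 M2"
    "(\<lambda>n. l2norm M2 (\<lambda>y. HS_op M1 h (u (r n)) y - g y)) \<longlonglongrightarrow> 0"
    by (rule HS_compact_subseq[OF h, of u]) (use u in auto)
  then show "\<exists>r g. strict_mono r \<and> g \<in> L2 M2 \<and> (\<lambda>n. l2norm M2 (\<lambda>y. HS_op M1 h (u (r n)) y - g y)) \<longlonglongrightarrow> 0"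
    by blast
next
  fix c f assume "f \<in> L2 M1"
  show "AE y in M2. HS_op M1 h (\<lambda>x. c * f x) y = c * HS_op M1 h f y"
    by (simp add: HS_op_scale)
next
  fix f assume "f \<in> L2 M1"
  then show "HS_op M1 h f \<in> L2 M2" by (rule HS_L2[OF h])
next
  fix f g assume "f \<in> L2 M1" "g \<in> L2 M1"
  then show "AE y in M2. HS_op M1 h (\<lambda>x. f x + g x) y = HS_op M1 h f y + HS_op M1 h g y"
    by (rule HS_add[OF h])
qed

end

section \<open>Singular values\<close>

lemma inprod_sum_right:
  assumes "\<And>i. i \<in> I \<Longrightarrow> f i \<in> L2 M" "h \<in> L2 M"
  shows "inprod M h (\<lambda>x. \<Sum>i\<in>I. f i x) = (\<Sum>i\<in>I. inprod M h (f i))"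
proof -
  have "inprod M h (\<lambda>x. \<Sum>i\<in>I. f i x) = cnj (inprod M (\<lambda>x. \<Sum>i\<in>I. f i x) h)"
    by (rule inprod_commute)
  also have "\<dots> = (\<Sum>i\<in>I. cnj (inprod M (f i) h))"
    by (simp add: inprod_sum_left[OF assms] cnj_sum)
  finally show ?thesis unfolding inprod_commute[of M h, symmetric] .
qed

lemma l2norm_orthogonal_sum:
  assumes w: "\<And>i::nat. w i \<in> L2 M" and orth: "\<And>i j. i < j \<Longrightarrow> inprod M (w i) (w j) = 0"
  shows "(l2norm M (\<lambda>x. \<Sum>i<n. c i * w i x))\<^sup>2 = (\<Sum>i<n. (cmod (c i))\<^sup>2 * (l2norm M (w i))\<^sup>2)"
proof (induction n)
  case (Suc n)
  have "inprod M (\<lambda>x. \<Sum>i<n. c i * w i x) (\<lambda>x. c n * w n x) = 0"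
    by (subst inprod_sum_left) (auto simp: inprod_scale_left inprod_scale_right orth intro: L2_scale w)
  then show ?case
    using l2norm_add_square[of "\<lambda>x. \<Sum>i<n. c i * w i x" M "\<lambda>x. c n * w n x"] Suc
    by (simp add: L2_sum L2_scale w l2norm_scale power_mult_distrib)
qed simp

text \<open>
  The vectors are only required to have norm at most one, so that zero vectors are admitted; they
  occur as singular vectors for the singular value zero.
\<close>

lemma bessel:
  assumes a: "\<And>i::nat. a i \<in> L2 M" and orth: "\<And>i j. i < j \<Longrightarrow> inprod M (a i) (a j) = 0"
    and norm: "\<And>i. l2norm M (a i) \<le> 1" and f: "f \<in> L2 M"
  shows "(\<Sum>i<n. (cmod (inprod M f (a i)))\<^sup>2) \<le> (l2norm M f)\<^sup>2"
proof -
  define c where "c i = inprod M f (a i)" for i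
  define p where "p x = (\<Sum>i<n. c i * a i x)" for x
  have p: "p \<in> L2 M" unfolding p_def[abs_def] by (intro L2_intros a)
  have "inprod M f p = (\<Sum>i<n. cnj (c i) * c i)"
    unfolding p_def[abs_def] by (subst inprod_sum_right) (auto simp: inprod_scale_right c_def intro: L2_scale a f)
  also have "\<dots> = complex_of_real (\<Sum>i<n. (cmod (c i))\<^sup>2)"
    by (simp add: complex_norm_square mult.commute del: of_real_power)
  finally have fp: "Re (inprod M f p) = (\<Sum>i<n. (cmod (c i))\<^sup>2)" by simp
  have "(l2norm M p)\<^sup>2 = (\<Sum>i<n. (cmod (c i))\<^sup>2 * (l2norm M (a i))\<^sup>2)"
    unfolding p_def[abs_def] by (rule l2norm_orthogonal_sum[OF a orth])
  also have "\<dots> \<le> (\<Sum>i<n. (cmod (c i))\<^sup>2)"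
    using norm by (intro sum_mono mult_left_le) (auto simp: power_le_one)
  finally have "0 \<le> (l2norm M f)\<^sup>2 - (\<Sum>i<n. (cmod (c i))\<^sup>2)"
    using l2norm_diff_square[OF f p] fp zero_le_power2[of "l2norm M (\<lambda>x. f x - p x)"] by linarith
  then show ?thesis by (simp add: c_def)
qed

lemma inprod_cnj: "inprod M (\<lambda>x. cnj (f x)) (\<lambda>x. cnj (g x)) = cnj (inprod M f g)"
  unfolding inprod_def Bochner_Integration.integral_cnj[symmetric] by simp

definition rank_one :: "('a \<Rightarrow> complex) \<Rightarrow> ('b \<Rightarrow> complex) \<Rightarrow> 'a \<times> 'b \<Rightarrow> complex" where
  "rank_one u v = tensor (\<lambda>x. cnj (u x)) v"

lemma HS_op_rank_one: "HS_op M (rank_one u v) f = (\<lambda>y. inprod M f u * v y)"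
  unfolding rank_one_def HS_op_tensor inprod_def by (simp add: mult.commute)

context pair_sigma_finite
begin

lemma rank_one_L2:
  assumes "u \<in> L2 M1" "v \<in> L2 M2"
  shows "rank_one u v \<in> L2 P" "l2norm P (rank_one u v) = l2norm M1 u * l2norm M2 v"
  unfolding rank_one_def using tensor_L2[OF L2_cnj[OF assms(1)] assms(2)] by simp_all

lemma inprod_rank_one:
  assumes "h \<in> L2 P" "u \<in> L2 M1" "v \<in> L2 M2"
  shows "inprod P h (rank_one u v) = inprod M2 (HS_op M1 h u) v"
  unfolding rank_one_def inprod_HS[OF assms] ..

text \<open>
  The operator \<open>f \<mapsto> \<Sum>\<^sub>i \<langle>f, a\<^sub>i\<rangle> w\<^sub>i\<close> is a contraction by Bessel's inequality in the source and Pythagoras in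
  the target.
\<close>

lemma op_bound_orthogonal_sum:
  assumes a: "\<And>i::nat. a i \<in> L2 M1" and aorth: "\<And>i j. i < j \<Longrightarrow> inprod M1 (a i) (a j) = 0"
    and anorm: "\<And>i. l2norm M1 (a i) \<le> 1"
    and w: "\<And>i::nat. w i \<in> L2 M2" and worth: "\<And>i j. i < j \<Longrightarrow> inprod M2 (w i) (w j) = 0"
    and wnorm: "\<And>i. l2norm M2 (w i) \<le> 1"
  shows "op_bound M1 M2 (\<lambda>p. \<Sum>i<n. rank_one (a i) (w i) p) 1"
  unfolding op_bound_def
proof
  fix f assume f: "f \<in> L2 M1"
  have HS: "HS_op M1 (\<lambda>p. \<Sum>i<n. rank_one (a i) (w i) p) f = (\<lambda>y. \<Sum>i<n. inprod M1 f (a i) * w i y)"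
  proof
    fix y
    have int: "integrable M1 (\<lambda>x. rank_one (a i) (w i) (x, y) * f x)" for i
    proof -
      have "integrable M1 (\<lambda>x. (f x * cnj (a i x)) * w i y)"
        by (intro integrable_mult_left L2_integrable_mult_cnj f a)
      then show ?thesis by (simp add: rank_one_def tensor_def mult_ac)
    qed
    have "HS_op M1 (\<lambda>p. \<Sum>i<n. rank_one (a i) (w i) p) f y = (\<Sum>i<n. HS_op M1 (rank_one (a i) (w i)) f y)"
      unfolding HS_op_def sum_distrib_right by (rule Bochner_Integration.integral_sum) (rule int)
    then show "HS_op M1 (\<lambda>p. \<Sum>i<n. rank_one (a i) (w i) p) f y = (\<Sum>i<n. inprod M1 f (a i) * w i y)"
      by (simp add: HS_op_rank_one)
  qed
  have "(l2norm M2 (\<lambda>y. \<Sum>i<n. inprod M1 f (a i) * w i y))\<^sup>2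
      = (\<Sum>i<n. (cmod (inprod M1 f (a i)))\<^sup>2 * (l2norm M2 (w i))\<^sup>2)"
    by (rule l2norm_orthogonal_sum[OF w worth])
  also have "\<dots> \<le> (\<Sum>i<n. (cmod (inprod M1 f (a i)))\<^sup>2)"
    using wnorm by (intro sum_mono mult_left_le) (auto simp: power_le_one)
  also have "\<dots> \<le> (l2norm M1 f)\<^sup>2" by (rule bessel[OF a aorth anorm f])
  finally show "l2norm M2 (HS_op M1 (\<lambda>p. \<Sum>i<n. rank_one (a i) (w i) p) f) \<le> 1 * l2norm M1 f"
    unfolding HS mult_1 by (rule power2_le_imp_le) simp
qed

lemma inprod_rank_one_rank_one:
  assumes "a \<in> L2 M1" "w \<in> L2 M2" "u \<in> L2 M1" "v \<in> L2 M2"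
  shows "inprod P (rank_one a w) (rank_one u v) = inprod M1 u a * inprod M2 w v"
  by (simp add: inprod_rank_one rank_one_L2 assms HS_op_rank_one inprod_scale_left)

text \<open>
  A largest singular value \<open>s\<close> (the operator norm) with left and right singular vectors. For the zero
  operator the vectors are set to zero, so that deflation can be iterated forever even when the rank
  is finite.
\<close>

definition singular_pair ::
  "('a \<times> 'b \<Rightarrow> complex) \<Rightarrow> real \<Rightarrow> ('a \<Rightarrow> complex) \<Rightarrow> ('b \<Rightarrow> complex) \<Rightarrow> bool" where
  "singular_pair h s u v \<longleftrightarrow>
     0 \<le> s \<and> u \<in> L2 M1 \<and> v \<in> L2 M2 \<and> op_bound M1 M2 h s \<and>
     (AE y in M2. HS_op M1 h u y = s * v y) \<and> (AE x in M1. HS_op M2 (adj_kernel h) v x = s * u x) \<and>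
     (if s = 0 then u = (\<lambda>x. 0) \<and> v = (\<lambda>y. 0) else l2norm M1 u = 1 \<and> l2norm M2 v = 1)"

text \<open>
  The norm of \<open>T = I\<^sub>h\<close> is attained. For a maximizing sequence \<open>U\<^sub>n\<close> in the unit ball,
  \<open>\<parallel>s\<^sup>2 U\<^sub>n - T\<^sup>* T U\<^sub>n\<parallel>\<^sup>2 \<le> s\<^sup>2 (s\<^sup>2 - \<parallel>T U\<^sub>n\<parallel>\<^sup>2)\<close> tends to zero, and by compactness \<open>T U\<^sub>n\<close> converges to some \<open>g\<close>
  along a subsequence. Hence \<open>U\<^sub>n\<close> itself converges in norm to \<open>u = T\<^sup>* g / s\<^sup>2\<close>, where the norm is
  attained, and \<open>v = g / s\<close> is the matching left singular vector.
\<close>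

lemma singular_pair_exists:
  assumes h: "h \<in> L2 P"
  shows "\<exists>s u v. singular_pair h s u v"
proof -
  interpret Q: pair_sigma_finite M2 M1 ..
  define D where "D = (\<lambda>f. l2norm M2 (HS_op M1 h f)) ` {f \<in> L2 M1. l2norm M1 f \<le> 1}"
  define s where "s = Sup D"
  have bdd: "bdd_above D"
  proof (rule bdd_aboveI[of _ "l2norm P h"])
    fix d assume "d \<in> D"
    then obtain f where f: "f \<in> L2 M1" "l2norm M1 f \<le> 1" "d = l2norm M2 (HS_op M1 h f)"
      by (auto simp: D_def)
    have "d \<le> l2norm P h * l2norm M1 f" unfolding f(3) by (rule HS_bound[OF h f(1)])
    also have "\<dots> \<le> l2norm P h * 1" by (intro mult_left_mono f) simp
    finally show "d \<le> l2norm P h" by simp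
  qed
  have le_s: "l2norm M2 (HS_op M1 h f) \<le> s" if "f \<in> L2 M1" "l2norm M1 f \<le> 1" for f
    unfolding s_def using that by (intro cSup_upper bdd) (auto simp: D_def)
  have s0: "0 \<le> s"
    using order_trans[OF l2norm_nonneg le_s[OF L2_zero]] by simp
  have bound: "op_bound M1 M2 h s"
    unfolding op_bound_def
  proof
    fix f assume f: "f \<in> L2 M1"
    show "l2norm M2 (HS_op M1 h f) \<le> s * l2norm M1 f"
    proof (cases "l2norm M1 f = 0")
      case True
      then show ?thesis using HS_bound[OF h f] by simp
    next
      case False
      define c where "c = l2norm M1 f"
      have c: "c > 0" using False l2norm_nonneg[of M1 f] unfolding c_def by linarith
      have "l2norm M2 (HS_op M1 h (\<lambda>x. complex_of_real (1 / c) * f x)) \<le> s"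
        using c by (intro le_s L2_scale f) (simp add: l2norm_scale c_def[symmetric] norm_divide del: of_real_divide)
      then have "1 / c * l2norm M2 (HS_op M1 h f) \<le> s"
        unfolding HS_op_scale l2norm_scale using c by (simp del: of_real_divide)
      then show ?thesis using c by (simp add: c_def[symmetric] field_simps)
    qed
  qed
  show ?thesis
  proof (cases "s = 0")
    case True
    then show ?thesis using bound by (auto simp: singular_pair_def L2_zero HS_op_def intro!: exI[of _ "0::real"] exI[of _ "\<lambda>_. 0::complex"])
  next
    case False
    with s0 have s: "s > 0" by simp
    have "\<exists>f. f \<in> L2 M1 \<and> l2norm M1 f \<le> 1 \<and> s - 1 / real (Suc n) < l2norm M2 (HS_op M1 h f)" for n
    proof -
      have "D \<noteq> {}" by (auto simp: D_def intro: exI[of _ "\<lambda>_. 0"] L2_zero)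
      then obtain d where "d \<in> D" "s - 1 / real (Suc n) < d"
        using less_cSupD[of D "s - 1 / real (Suc n)"] unfolding s_def by auto
      then show ?thesis by (auto simp: D_def)
    qed
    then obtain f where f: "\<And>n. f n \<in> L2 M1" "\<And>n. l2norm M1 (f n) \<le> 1"
      and fs: "\<And>n. s - 1 / real (Suc n) < l2norm M2 (HS_op M1 h (f n))"
      by metis
    have "(\<lambda>n. l2norm M2 (HS_op M1 h (f n))) \<longlonglongrightarrow> s"
    proof (rule tendsto_sandwich[OF _ _ _ tendsto_const])
      show "\<forall>\<^sub>F n in sequentially. s - 1 / real (Suc n) \<le> l2norm M2 (HS_op M1 h (f n))"
        by (intro always_eventually allI less_imp_le fs)
      show "\<forall>\<^sub>F n in sequentially. l2norm M2 (HS_op M1 h (f n)) \<le> s"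
        using le_s f by auto
      show "(\<lambda>n. s - 1 / real (Suc n)) \<longlonglongrightarrow> s"
        using tendsto_diff[OF tendsto_const[of s] LIMSEQ_inverse_real_of_nat] by (simp add: inverse_eq_divide)
    qed
    moreover obtain r g where r: "strict_mono (r :: nat \<Rightarrow> nat)" and g: "g \<in> L2 M2"
      and lim: "(\<lambda>n. l2norm M2 (\<lambda>y. HS_op M1 h (f (r n)) y - g y)) \<longlonglongrightarrow> 0"
      by (rule HS_compact_subseq[OF h f])
    ultimately have norm_s: "(\<lambda>n. l2norm M2 (HS_op M1 h (f (r n)))) \<longlonglongrightarrow> s"
      using LIMSEQ_subseq_LIMSEQ[of _ s r] by (simp add: comp_def)
    define U where "U n = f (r n)" for n
    have U: "U n \<in> L2 M1" "l2norm M1 (U n) \<le> 1" for n unfolding U_def using f by auto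
    note lim = lim[folded U_def] and norm_s = norm_s[folded U_def]
    have TU: "HS_op M1 h (U n) \<in> L2 M2" for n by (rule HS_L2[OF h U(1)])
    let ?A = "HS_op M2 (adj_kernel h)"
    note aL = adj_kernel_L2[OF h]
    have adjb: "op_bound M2 M1 (adj_kernel h) s" by (rule op_bound_adj[OF h s0 bound])
    have AL: "?A k \<in> L2 M1" if "k \<in> L2 M2" for k by (rule Q.HS_L2[OF aL that])
    have g_norm: "l2norm M2 g = s"
      by (rule LIMSEQ_unique[OF l2norm_limit[OF TU g lim] norm_s])
    define w where "w = ?A g"
    have w: "w \<in> L2 M1" unfolding w_def by (rule AL[OF g])
    have e1: "(\<lambda>n. l2norm M1 (\<lambda>x. complex_of_real (s\<^sup>2) * U n x - ?A (HS_op M1 h (U n)) x)) \<longlonglongrightarrow> 0"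
    proof -
      have le: "(l2norm M1 (\<lambda>x. complex_of_real (s\<^sup>2) * U n x - ?A (HS_op M1 h (U n)) x))\<^sup>2
          \<le> s\<^sup>2 * (s\<^sup>2 - (l2norm M2 (HS_op M1 h (U n)))\<^sup>2)" for n
      proof -
        define t where "t = l2norm M2 (HS_op M1 h (U n))"
        have "inprod M1 (U n) (?A (HS_op M1 h (U n))) = complex_of_real (t\<^sup>2)"
          unfolding inprod_HS_adj[OF h U(1) TU, symmetric] inprod_self t_def ..
        moreover have "l2norm M1 (?A (HS_op M1 h (U n))) \<le> s * t"
          unfolding t_def by (rule op_boundD[OF adjb TU])
        then have "(l2norm M1 (?A (HS_op M1 h (U n))))\<^sup>2 \<le> s\<^sup>2 * t\<^sup>2"
          unfolding power_mult_distrib[symmetric] by (intro power_mono) auto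
        moreover have "(s\<^sup>2 * l2norm M1 (U n))\<^sup>2 \<le> (s\<^sup>2 * 1)\<^sup>2"
          using U(2) by (intro power_mono mult_left_mono) auto
        moreover have cs: "cmod (complex_of_real (s\<^sup>2)) = s\<^sup>2"
          unfolding norm_of_real by simp
        ultimately show ?thesis
          unfolding l2norm_diff_square[OF L2_scale[OF U(1)] AL[OF TU]] inprod_scale_left l2norm_scale t_def[symmetric] cs
          by (simp add: norm_power power2_eq_square algebra_simps)
      qed
      have "(\<lambda>n. s\<^sup>2 * (s\<^sup>2 - (l2norm M2 (HS_op M1 h (U n)))\<^sup>2)) \<longlonglongrightarrow> s\<^sup>2 * (s\<^sup>2 - s\<^sup>2)"
        by (intro tendsto_intros norm_s)
      then have "(\<lambda>n. (l2norm M1 (\<lambda>x. complex_of_real (s\<^sup>2) * U n x - ?A (HS_op M1 h (U n)) x))\<^sup>2) \<longlonglongrightarrow> 0"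
        using le by (intro Lim_null_comparison[where f="\<lambda>n. (l2norm M1 (\<lambda>x. complex_of_real (s\<^sup>2) * U n x - ?A (HS_op M1 h (U n)) x))\<^sup>2"]) auto
      from tendsto_real_sqrt[OF this] show ?thesis by simp
    qed
    have e2: "(\<lambda>n. l2norm M1 (\<lambda>x. ?A (HS_op M1 h (U n)) x - w x)) \<longlonglongrightarrow> 0"
    proof (rule Lim_null_comparison)
      show "\<forall>\<^sub>F n in sequentially. norm (l2norm M1 (\<lambda>x. ?A (HS_op M1 h (U n)) x - w x))
          \<le> s * l2norm M2 (\<lambda>y. HS_op M1 h (U n) y - g y)"
      proof (rule always_eventually, rule allI)
        fix n
        have "l2norm M1 (\<lambda>x. ?A (HS_op M1 h (U n)) x - w x) = l2norm M1 (?A (\<lambda>y. HS_op M1 h (U n) y - g y))"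
          unfolding w_def using Q.HS_diff[OF aL TU[of n] g]
          by (intro l2norm_cong_AE L2_measurable[OF L2_diff] L2_measurable[OF AL] L2_diff AL TU g) auto
        also have "\<dots> \<le> s * l2norm M2 (\<lambda>y. HS_op M1 h (U n) y - g y)"
          by (intro op_boundD[OF adjb] L2_diff TU g)
        finally show "norm (l2norm M1 (\<lambda>x. ?A (HS_op M1 h (U n)) x - w x)) \<le> s * l2norm M2 (\<lambda>y. HS_op M1 h (U n) y - g y)"
          by simp
      qed
      show "(\<lambda>n. s * l2norm M2 (\<lambda>y. HS_op M1 h (U n) y - g y)) \<longlonglongrightarrow> 0"
        by (rule tendsto_mult_right_zero[OF lim])
    qed
    define u where "u x = complex_of_real (1 / s\<^sup>2) * w x" for x
    have u: "u \<in> L2 M1" unfolding u_def[abs_def] by (rule L2_scale[OF w])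
    have Uu: "(\<lambda>n. l2norm M1 (\<lambda>x. U n x - u x)) \<longlonglongrightarrow> 0"
    proof (rule Lim_null_comparison)
      show "\<forall>\<^sub>F n in sequentially. norm (l2norm M1 (\<lambda>x. U n x - u x))
        \<le> 1 / s\<^sup>2 * (l2norm M1 (\<lambda>x. complex_of_real (s\<^sup>2) * U n x - ?A (HS_op M1 h (U n)) x)
             + l2norm M1 (\<lambda>x. ?A (HS_op M1 h (U n)) x - w x))"
      proof (rule always_eventually, rule allI)
        fix n
        have "U n x - u x = complex_of_real (1 / s\<^sup>2) * (complex_of_real (s\<^sup>2) * U n x - w x)" for x
          using s by (simp add: u_def field_simps)
        then have "l2norm M1 (\<lambda>x. U n x - u x) = 1 / s\<^sup>2 * l2norm M1 (\<lambda>x. complex_of_real (s\<^sup>2) * U n x - w x)"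
          by (simp only: l2norm_scale) (simp add: norm_divide norm_power)
        also have "\<dots> \<le> 1 / s\<^sup>2 * (l2norm M1 (\<lambda>x. complex_of_real (s\<^sup>2) * U n x - ?A (HS_op M1 h (U n)) x)
             + l2norm M1 (\<lambda>x. ?A (HS_op M1 h (U n)) x - w x))"
          by (intro mult_left_mono l2norm_triangle_between L2_scale U AL TU w) simp
        finally show "norm (l2norm M1 (\<lambda>x. U n x - u x))
        \<le> 1 / s\<^sup>2 * (l2norm M1 (\<lambda>x. complex_of_real (s\<^sup>2) * U n x - ?A (HS_op M1 h (U n)) x)
             + l2norm M1 (\<lambda>x. ?A (HS_op M1 h (U n)) x - w x))" by simp
      qed
      show "(\<lambda>n. 1 / s\<^sup>2 * (l2norm M1 (\<lambda>x. complex_of_real (s\<^sup>2) * U n x - ?A (HS_op M1 h (U n)) x)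
             + l2norm M1 (\<lambda>x. ?A (HS_op M1 h (U n)) x - w x))) \<longlonglongrightarrow> 0"
        using tendsto_mult_right_zero[OF tendsto_add_zero[OF e1 e2]] .
    qed
    have u1: "l2norm M1 u \<le> 1"
      using U(2) by (intro LIMSEQ_le_const2[OF l2norm_limit[OF U(1) u Uu]]) auto
    have Tu: "AE y in M2. HS_op M1 h u y = g y"
    proof (rule l2norm_limit_unique[OF TU HS_L2[OF h u] g _ lim])
      show "(\<lambda>n. l2norm M2 (\<lambda>x. HS_op M1 h (U n) x - HS_op M1 h u x)) \<longlonglongrightarrow> 0"
      proof (rule Lim_null_comparison[OF _ tendsto_mult_right_zero[OF Uu, of s]], rule always_eventually, rule allI)
        fix n
        have "l2norm M2 (\<lambda>x. HS_op M1 h (U n) x - HS_op M1 h u x) = l2norm M2 (HS_op M1 h (\<lambda>x. U n x - u x))"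
          using HS_diff[OF h U(1)[of n] u]
          by (intro l2norm_cong_AE L2_measurable[OF L2_diff] L2_measurable[OF HS_L2] L2_diff HS_L2 h U u) auto
        also have "\<dots> \<le> s * l2norm M1 (\<lambda>x. U n x - u x)"
          by (intro op_boundD[OF bound] L2_diff U u)
        finally show "norm (l2norm M2 (\<lambda>x. HS_op M1 h (U n) x - HS_op M1 h u x)) \<le> s * l2norm M1 (\<lambda>x. U n x - u x)"
          by simp
      qed
    qed
    have "s = l2norm M2 (HS_op M1 h u)"
      unfolding g_norm[symmetric] using Tu
      by (intro l2norm_cong_AE L2_measurable[OF g] L2_measurable[OF HS_L2[OF h u]]) auto
    also have "\<dots> \<le> s * l2norm M1 u" by (rule op_boundD[OF bound u])
    finally have "l2norm M1 u = 1" using u1 s by simp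
    define v where "v y = complex_of_real (1 / s) * g y" for y
    have v: "v \<in> L2 M2" unfolding v_def[abs_def] by (rule L2_scale[OF g])
    have "l2norm M2 v = 1" unfolding v_def[abs_def] l2norm_scale g_norm using s by (simp add: norm_divide)
    have "?A v x = s * u x" for x
      unfolding v_def[abs_def] HS_op_scale w_def[symmetric] u_def using s by (simp add: power2_eq_square)
    moreover have "AE y in M2. HS_op M1 h u y = s * v y"
      using Tu s by (simp add: v_def)
    ultimately have "singular_pair h s u v"
      unfolding singular_pair_def using s u v bound \<open>l2norm M1 u = 1\<close> \<open>l2norm M2 v = 1\<close> by simp
    then show ?thesis by blast
  qed
qed

end

section \<open>Functionals bounded in operator norm\<close>

text \<open>
  Kernels of trace class operators have this form: up to null sets \<open>b(x, y)\<close> is the (bilinear) pairing of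
  the vectors \<open>(f\<^sub>i(x))\<^sub>i\<close> and \<open>(g\<^sub>i(y))\<^sub>i\<close> of \<open>\<ell>\<^sup>2\<close>. Of such a factorization, only measurability in \<open>x\<close> and in \<open>y\<close> and pointwise square summability
  are kept, since these are what continuity with respect to rectangles depends on. Summability is
  asked at every point, which is achieved by setting \<open>f\<^sub>i\<close> and \<open>g\<^sub>i\<close> to zero on null sets.
\<close>

definition hilbert_factorable :: "'a measure \<Rightarrow> 'b measure \<Rightarrow> ('a \<times> 'b \<Rightarrow> complex) \<Rightarrow> bool" where
  "hilbert_factorable M N b \<longleftrightarrow> (\<exists>f g.
     (\<forall>i::nat. f i \<in> borel_measurable M) \<and> (\<forall>i. g i \<in> borel_measurable N) \<and>
     (\<forall>x. summable (\<lambda>i. (cmod (f i x))\<^sup>2)) \<and> (\<forall>y. summable (\<lambda>i. (cmod (g i y))\<^sup>2)) \<and>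
     (AE p in M \<Otimes>\<^sub>M N. (\<lambda>i. f i (fst p) * g i (snd p)) sums b p))"

lemma summable_squares_off_null_set:
  assumes w: "\<And>i::nat. w i \<in> L2 M" and sm: "summable (\<lambda>i. (l2norm M (w i))\<^sup>2)"
  obtains X where "X \<in> null_sets M" "\<And>x. x \<in> space M - X \<Longrightarrow> summable (\<lambda>i. (cmod (w i x))\<^sup>2)"
proof -
  note [measurable] = L2_measurable[OF w]
  have "(\<integral>\<^sup>+x. (\<Sum>i. ennreal ((cmod (w i x))\<^sup>2)) \<partial>M) = (\<Sum>i. \<integral>\<^sup>+x. ennreal ((cmod (w i x))\<^sup>2) \<partial>M)"
    by (rule nn_integral_suminf) measurable
  also have "\<dots> = (\<Sum>i. ennreal ((l2norm M (w i))\<^sup>2))"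
    by (simp add: nn_integral_L2[OF w])
  also have "\<dots> \<noteq> \<infinity>"
    unfolding infinity_ennreal_def by (rule ennreal_suminf_neq_top[OF sm]) simp
  finally have "AE x in M. (\<Sum>i. ennreal ((cmod (w i x))\<^sup>2)) \<noteq> \<infinity>"
    by (intro nn_integral_PInf_AE) auto
  then have "AE x in M. summable (\<lambda>i. (cmod (w i x))\<^sup>2)"
    by eventually_elim (auto intro!: summable_suminf_not_top)
  then obtain X where "{x \<in> space M. \<not> summable (\<lambda>i. (cmod (w i x))\<^sup>2)} \<subseteq> X" "X \<in> null_sets M"
    by (auto simp: eventually_ae_filter)
  then show ?thesis by (intro that[of X]) auto
qed

context pair_sigma_finite
begin

lemma hilbert_factorableI:
  assumes f: "\<And>i. f i \<in> L2 M1" and g: "\<And>i. g i \<in> L2 M2"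
    and fs: "summable (\<lambda>i. (l2norm M1 (f i))\<^sup>2)" and gs: "summable (\<lambda>i. (l2norm M2 (g i))\<^sup>2)"
    and b: "b \<in> L2 P"
    and lim: "(\<lambda>n. l2norm P (\<lambda>p. b p - (\<Sum>i<n. tensor (f i) (g i) p))) \<longlonglongrightarrow> 0"
  shows "hilbert_factorable M1 M2 b"
proof -
  note [measurable] = L2_measurable[OF f] L2_measurable[OF g]
  obtain X where X: "X \<in> null_sets M1" "\<And>x. x \<in> space M1 - X \<Longrightarrow> summable (\<lambda>i. (cmod (f i x))\<^sup>2)"
    using summable_squares_off_null_set[OF f fs] by blast
  obtain Y where Y: "Y \<in> null_sets M2" "\<And>y. y \<in> space M2 - Y \<Longrightarrow> summable (\<lambda>i. (cmod (g i y))\<^sup>2)"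
    using summable_squares_off_null_set[OF g gs] by blast
  have [measurable]: "X \<in> sets M1" "Y \<in> sets M2" using X(1) Y(1) by auto
  define F where "F i x = (if x \<in> space M1 - X then f i x else 0)" for i x
  define G where "G i y = (if y \<in> space M2 - Y then g i y else 0)" for i y
  have meas: "F i \<in> borel_measurable M1" "G i \<in> borel_measurable M2" for i
    unfolding F_def[abs_def] G_def[abs_def] by measurable
  have sF: "summable (\<lambda>i. (cmod (F i x))\<^sup>2)" for x using X(2)[of x] unfolding F_def by (cases "x \<in> space M1 - X") (simp_all del: Diff_iff)
  have sG: "summable (\<lambda>i. (cmod (G i y))\<^sup>2)" for y using Y(2)[of y] unfolding G_def by (cases "y \<in> space M2 - Y") (simp_all del: Diff_iff)
  obtain r :: "nat \<Rightarrow> nat" where r: "strict_mono r"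
    and ae: "AE p in P. (\<lambda>n. b p - (\<Sum>i<r n. tensor (f i) (g i) p)) \<longlonglongrightarrow> 0"
  proof -
    have "(\<lambda>p. b p - (\<Sum>i<n. tensor (f i) (g i) p)) \<in> L2 P" for n
      by (intro L2_diff b L2_sum tensor_L2 f g)
    from l2norm_tendsto_0_AE_subseq[OF this lim] show ?thesis using that by blast
  qed
  have "X \<times> space M2 \<in> null_sets P" "space M1 \<times> Y \<in> null_sets P"
    using X(1) Y(1) by (auto intro: M2.times_in_null_sets1 M2.times_in_null_sets2)
  then have "AE p in P. p \<notin> X \<times> space M2" "AE p in P. p \<notin> space M1 \<times> Y"
    by (auto intro: AE_not_in)
  with ae AE_space have "AE p in P. (\<lambda>i. F i (fst p) * G i (snd p)) sums b p"
  proof eventually_elim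
    case (elim p)
    have p: "fst p \<in> space M1 - X" "snd p \<in> space M2 - Y"
      using elim by (auto simp: space_pair_measure)
    have "summable (\<lambda>i. F i (fst p) * G i (snd p))"
    proof (rule summable_comparison_test'[where N=0])
      show "summable (\<lambda>i. (cmod (F i (fst p)))\<^sup>2 + (cmod (G i (snd p)))\<^sup>2)"
        by (intro summable_add sF sG)
      fix n
      have "2 * (cmod (F n (fst p)) * cmod (G n (snd p))) \<le> (cmod (F n (fst p)))\<^sup>2 + (cmod (G n (snd p)))\<^sup>2"
        using sum_squares_bound[of "cmod (F n (fst p))" "cmod (G n (snd p))"] by simp
      moreover have "0 \<le> cmod (F n (fst p)) * cmod (G n (snd p))" by simp
      ultimately show "norm (F n (fst p) * G n (snd p)) \<le> (cmod (F n (fst p)))\<^sup>2 + (cmod (G n (snd p)))\<^sup>2"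
        unfolding norm_mult by linarith
    qed
    then obtain l where l: "(\<lambda>i. F i (fst p) * G i (snd p)) sums l" by (auto simp: summable_def)
    then have "(\<lambda>n. \<Sum>i<r n. F i (fst p) * G i (snd p)) \<longlonglongrightarrow> l"
      unfolding sums_def using LIMSEQ_subseq_LIMSEQ[OF _ r] by (auto simp: comp_def)
    moreover have "(\<Sum>i<n. F i (fst p) * G i (snd p)) = (\<Sum>i<n. tensor (f i) (g i) p)" for n
      using p by (simp add: F_def G_def tensor_def)
    ultimately have "(\<lambda>n. b p - (\<Sum>i<r n. tensor (f i) (g i) p)) \<longlonglongrightarrow> b p - l"
      by (intro tendsto_intros) simp
    with elim have "b p - l = 0" by (blast intro: LIMSEQ_unique)
    with l show ?case by simp
  qed
  with meas sF sG show ?thesis unfolding hilbert_factorable_def by blast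
qed

text \<open>
  Repeatedly subtracting the largest singular component.
\<close>

lemma singular_decomposition:
  assumes b: "b \<in> L2 P"
  obtains s u v h where "h 0 = b" "\<And>n::nat. h n \<in> L2 P" "\<And>n. singular_pair (h n) (s n) (u n) (v n)"
    "\<And>n. h (Suc n) = (\<lambda>p. h n p - complex_of_real (s n) * rank_one (u n) (v n) p)"
proof -
  obtain S U V where F: "\<And>h. h \<in> L2 P \<Longrightarrow> singular_pair h (S h) (U h) (V h)"
    using singular_pair_exists by metis
  define h where "h = rec_nat b (\<lambda>_ h p. h p - complex_of_real (S h) * rank_one (U h) (V h) p)"
  have h0: "h 0 = b" and hS: "h (Suc n) = (\<lambda>p. h n p - complex_of_real (S (h n)) * rank_one (U (h n)) (V (h n)) p)" for n
    by (simp_all add: h_def)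
  have L: "h n \<in> L2 P" for n
  proof (induction n)
    case (Suc n)
    with F[OF Suc] show ?case unfolding hS
      by (intro L2_diff L2_scale rank_one_L2) (auto simp: singular_pair_def)
  qed (simp add: h0 b)
  show ?thesis by (rule that[OF h0 L F[OF L] hS])
qed

text \<open>
  The representation of functionals on the compact operators by the trace class. Let \<open>s\<^sub>i\<close>, \<open>u\<^sub>i\<close>, \<open>v\<^sub>i\<close> be
  produced by repeated deflation, with remainders \<open>h\<^sub>n\<close>. The singular vectors turn out to be orthogonal,
  so \<open>k = \<Sum>\<^sub>i\<^sub><\<^sub>n u\<^sub>i \<otimes> cnj v\<^sub>i\<close> is a contraction with \<open>\<integral> b k = \<Sum>\<^sub>i\<^sub><\<^sub>n s\<^sub>i\<close>, and the hypothesis gives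
  \<open>\<Sum>\<^sub>i s\<^sub>i \<le> C\<close>. The remainders then converge in \<open>L\<^sup>2\<close>, and their operator norms \<open>s\<^sub>n\<close> tend to zero because
  every step lowers \<open>\<parallel>h\<^sub>n\<parallel>\<^sup>2\<close> by \<open>s\<^sub>n\<^sup>2\<close>; so their limit is zero. Splitting each \<open>s\<^sub>i\<close> into two square roots
  gives the factorization.
\<close>

lemma hilbert_factorable_if_op_bounded:
  assumes b: "b \<in> L2 P"
    and C: "\<And>k. k \<in> L2 P \<Longrightarrow> op_bound M1 M2 k 1 \<Longrightarrow> cmod (\<integral>p. b p * k p \<partial>P) \<le> C"
  shows "hilbert_factorable M1 M2 b"
proof -
  interpret Q: pair_sigma_finite M2 M1 ..
  obtain s u v h where h0: "h 0 = b" and h: "\<And>n::nat. h n \<in> L2 P"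
    and sp: "\<And>n. singular_pair (h n) (s n) (u n) (v n)"
    and hS: "\<And>n. h (Suc n) = (\<lambda>p. h n p - complex_of_real (s n) * rank_one (u n) (v n) p)"
    by (rule singular_decomposition[OF b]) (rule that)
  have s: "0 \<le> s n" and u: "u n \<in> L2 M1" and v: "v n \<in> L2 M2" and bd: "op_bound M1 M2 (h n) (s n)"
    and Tu: "AE y in M2. HS_op M1 (h n) (u n) y = s n * v n y"
    and Tv: "AE x in M1. HS_op M2 (adj_kernel (h n)) (v n) x = s n * u n x" for n
    using sp[of n] by (simp_all add: singular_pair_def)
  have zero: "s n = 0 \<Longrightarrow> u n = (\<lambda>x. 0) \<and> v n = (\<lambda>y. 0)"
    and one: "s n \<noteq> 0 \<Longrightarrow> l2norm M1 (u n) = 1 \<and> l2norm M2 (v n) = 1" for n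
    using sp[of n] by (simp_all add: singular_pair_def)
  have norm1: "l2norm M1 (u n) \<le> 1" "l2norm M2 (v n) \<le> 1" for n
    using zero[of n] one[of n] by (cases "s n = 0"; simp)+
  let ?R = "\<lambda>n. rank_one (u n) (v n)"
  note R = rank_one_L2(1)[OF u v]
  have adjS: "adj_kernel (h (Suc n)) = (\<lambda>p. adj_kernel (h n) p - complex_of_real (s n) * rank_one (v n) (u n) p)" for n
    by (auto simp: hS adj_kernel_def rank_one_def tensor_def fun_eq_iff)
  have TS: "AE y in M2. HS_op M1 (h (Suc n)) f y = HS_op M1 (h n) f y - s n * inprod M1 f (u n) * v n y"
    if f: "f \<in> L2 M1" for n f
    unfolding hS using HS_kernel_diff[OF h[of n] L2_scale[OF R[of n n], of "s n"] f]
    by eventually_elim (simp add: HS_op_kernel_scale HS_op_rank_one)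
  have TadjS: "AE x in M1. HS_op M2 (adj_kernel (h (Suc n))) g x
      = HS_op M2 (adj_kernel (h n)) g x - s n * inprod M2 g (v n) * u n x"
    if g: "g \<in> L2 M2" for n g
    unfolding adjS
    using Q.HS_kernel_diff[OF adj_kernel_L2[OF h[of n]] L2_scale[OF Q.rank_one_L2(1)[OF v[of n] u[of n]], of "s n"] g]
    by eventually_elim (simp add: HS_op_kernel_scale HS_op_rank_one)
  have TL: "HS_op M1 (h n) f \<in> L2 M2" if "f \<in> L2 M1" for n f by (rule HS_L2[OF h that])
  have TadjL: "HS_op M2 (adj_kernel (h n)) g \<in> L2 M1" if "g \<in> L2 M2" for n g
    by (rule Q.HS_L2[OF adj_kernel_L2[OF h] that])
  have self: "inprod M1 (u n) (u n) = 1" "inprod M2 (v n) (v n) = 1" if "s n \<noteq> 0" for n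
    using one[OF that] by (simp_all add: inprod_self)
  (* If the n-th remainder annihilates the m-th singular vectors, then these are orthogonal
     to the n-th ones, which lie in the ranges of the remainder and its adjoint. *)
  have orth_step: "inprod M1 (u m) (u n) = 0 \<and> inprod M2 (v m) (v n) = 0"
    if z1: "AE y in M2. HS_op M1 (h n) (u m) y = 0" and z2: "AE x in M1. HS_op M2 (adj_kernel (h n)) (v m) x = 0"
    for m n
  proof (cases "s n = 0")
    case True
    then show ?thesis using zero[of n] by simp
  next
    case False
    have "s n * inprod M1 (u m) (u n) = inprod M1 (u m) (\<lambda>x. complex_of_real (s n) * u n x)"
      by (simp add: inprod_scale_right)
    also have "\<dots> = inprod M1 (u m) (HS_op M2 (adj_kernel (h n)) (v n))"
      using Tv[of n] by (intro inprod_cong_AE L2_measurable[OF u] L2_measurable[OF L2_scale[OF u]] L2_measurable[OF TadjL[OF v]]) auto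
    also have "\<dots> = inprod M2 (HS_op M1 (h n) (u m)) (v n)"
      by (rule inprod_HS_adj[OF h u v, symmetric])
    also have "\<dots> = inprod M2 (\<lambda>y. 0) (v n)"
      using z1 by (intro inprod_cong_AE L2_measurable[OF v] L2_measurable[OF TL[OF u]]) auto
    finally have u0: "inprod M1 (u m) (u n) = 0" using False by simp
    have "s n * inprod M2 (v n) (v m) = inprod M2 (\<lambda>y. complex_of_real (s n) * v n y) (v m)"
      by (simp add: inprod_scale_left)
    also have "\<dots> = inprod M2 (HS_op M1 (h n) (u n)) (v m)"
      using Tu[of n] by (intro inprod_cong_AE L2_measurable[OF v] L2_measurable[OF L2_scale[OF v]] L2_measurable[OF TL[OF u]]) auto
    also have "\<dots> = inprod M1 (u n) (HS_op M2 (adj_kernel (h n)) (v m))"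
      by (rule inprod_HS_adj[OF h u v])
    also have "\<dots> = inprod M1 (u n) (\<lambda>x. 0)"
      using z2 by (intro inprod_cong_AE L2_measurable[OF u] L2_measurable[OF TadjL[OF v]]) auto
    finally have "inprod M2 (v n) (v m) = 0" using False by simp
    then have "inprod M2 (v m) (v n) = 0" using inprod_commute[of M2 "v m" "v n"] by simp
    with u0 show ?thesis by blast
  qed
  (* Deflation removes the m-th singular vectors for good: subtracting a later component
     does not affect them, by orthogonality. *)
  have kill: "(AE y in M2. HS_op M1 (h n) (u m) y = 0) \<and> (AE x in M1. HS_op M2 (adj_kernel (h n)) (v m) x = 0)"
    if "m < n" for m n
    using that
  proof (induction n)
    case (Suc n)
    show ?case
    proof (cases "m = n")
      case True
      have "AE y in M2. HS_op M1 (h (Suc n)) (u n) y = 0"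
        using TS[OF u[of n], of n] Tu[of n]
        by eventually_elim (cases "s n = 0"; simp add: self)
      moreover have "AE x in M1. HS_op M2 (adj_kernel (h (Suc n))) (v n) x = 0"
        using TadjS[OF v[of n], of n] Tv[of n]
        by eventually_elim (cases "s n = 0"; simp add: self)
      ultimately show ?thesis using True by simp
    next
      case False
      with Suc have IH: "AE y in M2. HS_op M1 (h n) (u m) y = 0" "AE x in M1. HS_op M2 (adj_kernel (h n)) (v m) x = 0"
        by auto
      note o = orth_step[OF this]
      have "AE y in M2. HS_op M1 (h (Suc n)) (u m) y = 0"
        using TS[OF u[of m], of n] IH(1) by eventually_elim (simp add: o)
      moreover have "AE x in M1. HS_op M2 (adj_kernel (h (Suc n))) (v m) x = 0"
        using TadjS[OF v[of m], of n] IH(2) by eventually_elim (simp add: o)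
      ultimately show ?thesis by simp
    qed
  qed simp
  have orth: "inprod M1 (u m) (u n) = 0" "inprod M2 (v m) (v n) = 0" if "m < n" for m n
    using orth_step kill[OF that] by blast+
  have h_sum: "h n = (\<lambda>p. b p - (\<Sum>i<n. complex_of_real (s i) * ?R i p))" for n
    by (induction n) (simp_all add: h0 hS fun_eq_iff algebra_simps)
  have hR: "inprod P (h n) (?R n) = s n" for n
  proof -
    have "inprod P (h n) (?R n) = inprod M2 (HS_op M1 (h n) (u n)) (v n)"
      by (rule inprod_rank_one[OF h u v])
    also have "\<dots> = inprod M2 (\<lambda>y. complex_of_real (s n) * v n y) (v n)"
      using Tu[of n] by (intro inprod_cong_AE L2_measurable[OF v] L2_measurable[OF L2_scale[OF v]] L2_measurable[OF TL[OF u]]) auto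
    finally show ?thesis using self[of n] by (cases "s n = 0") (auto simp: inprod_scale_left)
  qed
  have norm_drop: "(l2norm P (h (Suc n)))\<^sup>2 = (l2norm P (h n))\<^sup>2 - (s n)\<^sup>2" for n
  proof -
    have "s n * l2norm P (?R n) = s n"
      using one[of n] by (cases "s n = 0") (auto simp: rank_one_L2(2)[OF u v])
    then show ?thesis
      unfolding hS l2norm_diff_square[OF h L2_scale[OF R]] l2norm_scale inprod_scale_right hR
      using s[of n] by (auto simp: power2_eq_square)
  qed
  have "(\<Sum>i<n. (s i)\<^sup>2) = (l2norm P b)\<^sup>2 - (l2norm P (h n))\<^sup>2" for n
    by (induction n) (simp_all add: h0 norm_drop)
  then have "summable (\<lambda>i. (s i)\<^sup>2)"
    by (intro summableI_nonneg_bounded[where x="(l2norm P b)\<^sup>2"]) auto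
  then have "(\<lambda>n. (s n)\<^sup>2) \<longlonglongrightarrow> 0" by (rule summable_LIMSEQ_zero)
  from tendsto_real_sqrt[OF this] have s_lim: "s \<longlonglongrightarrow> 0" using s by simp
  have bR: "inprod P b (?R i) = s i" for i
  proof -
    have "inprod P (h i) (?R i) = inprod P b (?R i) - (\<Sum>j<i. inprod P (\<lambda>p. complex_of_real (s j) * ?R j p) (?R i))"
      unfolding h_sum[of i]
      by (subst inprod_diff_left inprod_sum_left; (intro b R L2_sum L2_scale)?)+ simp
    moreover have "inprod P (\<lambda>p. complex_of_real (s j) * ?R j p) (?R i) = 0" if "j < i" for j
      unfolding inprod_scale_left inprod_rank_one_rank_one[OF u v u v] by (simp add: orth[OF that])
    ultimately show ?thesis using hR[of i] by simp
  qed
  have s_le: "(\<Sum>i<n. s i) \<le> C" for n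
  proof -
    define k where "k p = (\<Sum>i<n. rank_one (\<lambda>x. cnj (u i x)) (\<lambda>y. cnj (v i y)) p)" for p
    have k: "k \<in> L2 P" unfolding k_def[abs_def] by (intro L2_sum rank_one_L2(1) L2_cnj u v)
    have "op_bound M1 M2 k 1" unfolding k_def[abs_def]
      by (rule op_bound_orthogonal_sum) (simp_all add: L2_cnj u v inprod_cnj orth norm1)
    then have le: "cmod (\<integral>p. b p * k p \<partial>P) \<le> C" by (rule C[OF k])
    have "(\<integral>p. b p * k p \<partial>P) = inprod P b (\<lambda>p. \<Sum>i<n. ?R i p)"
      unfolding inprod_def k_def
      by (intro Bochner_Integration.integral_cong refl arg_cong2[where f="(*)"])
         (simp add: cnj_sum rank_one_def tensor_def)
    also have "\<dots> = (\<Sum>i<n. inprod P b (?R i))" by (intro inprod_sum_right R b)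
    also have "\<dots> = complex_of_real (\<Sum>i<n. s i)" by (simp add: bR)
    finally have "cmod (\<integral>p. b p * k p \<partial>P) = (\<Sum>i<n. s i)"
      by (simp only: norm_of_real abs_of_nonneg[OF sum_nonneg[OF s]])
    with le show ?thesis by simp
  qed
  then have s_summable: "summable s"
    by (intro summableI_nonneg_bounded[where x=C] s)
  obtain k where k: "k \<in> L2 P" and hk: "(\<lambda>n. l2norm P (\<lambda>p. h n p - k p)) \<longlonglongrightarrow> 0"
  proof (rule L2_complete[OF h])
    fix e :: real assume e: "e > 0"
    obtain K where K: "\<And>m n. m \<ge> K \<Longrightarrow> norm (sum s {m..<n}) < e"
      using s_summable e unfolding summable_Cauchy by blast
    have le: "l2norm P (\<lambda>p. h m p - h n p) < e" if mn: "m \<ge> K" "m \<le> n" for m n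
    proof -
      have "h m p - h n p = (\<Sum>i\<in>{m..<n}. complex_of_real (s i) * ?R i p)" for p
        unfolding h_sum using sum_diff_nat_ivl[of 0 m n "\<lambda>i. complex_of_real (s i) * ?R i p"] mn
        by (simp add: atLeast0LessThan)
      then have "l2norm P (\<lambda>p. h m p - h n p) \<le> (\<Sum>i\<in>{m..<n}. l2norm P (\<lambda>p. complex_of_real (s i) * ?R i p))"
        by (simp only:) (intro l2norm_sum_le L2_scale R, simp)
      also have "\<dots> \<le> (\<Sum>i\<in>{m..<n}. s i)"
      proof (rule sum_mono)
        fix i
        have "l2norm M1 (u i) * l2norm M2 (v i) \<le> 1 * 1" by (intro mult_mono norm1) auto
        then have "s i * (l2norm M1 (u i) * l2norm M2 (v i)) \<le> s i * 1" by (intro mult_left_mono s) simp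
        then show "l2norm P (\<lambda>p. complex_of_real (s i) * ?R i p) \<le> s i"
          unfolding l2norm_scale rank_one_L2(2)[OF u v] using s[of i] by simp
      qed
      also have "\<dots> < e" using K[OF mn(1), of n] by simp
      finally show ?thesis .
    qed
    have "l2norm P (\<lambda>p. h m p - h n p) < e" if "m \<ge> K" "n \<ge> K" for m n
      using le[of m n] le[of n m] that l2norm_minus_commute[of P "h m" "h n"] by (cases "m \<le> n") auto
    then show "\<exists>K. \<forall>m\<ge>K. \<forall>n\<ge>K. l2norm P (\<lambda>p. h m p - h n p) < e" by blast
  qed
  have "op_bound M1 M2 k 0"
    unfolding op_bound_def
  proof
    fix f assume f: "f \<in> L2 M1"
    have le: "l2norm M2 (HS_op M1 k f) \<le> (s n + l2norm P (\<lambda>p. h n p - k p)) * l2norm M1 f" for n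
    proof -
      have "op_bound M1 M2 (\<lambda>p. h n p + (-1) * (h n p - k p)) (s n + cmod (-1) * l2norm P (\<lambda>p. h n p - k p))"
        by (intro op_bound_add op_bound_scale op_bound_l2norm bd L2_scale L2_diff h k)
      from op_boundD[OF this f] show ?thesis by simp
    qed
    have "(\<lambda>n. (s n + l2norm P (\<lambda>p. h n p - k p)) * l2norm M1 f) \<longlonglongrightarrow> (0 + 0) * l2norm M1 f"
      by (intro tendsto_intros s_lim hk)
    then have "l2norm M2 (HS_op M1 k f) \<le> (0 + 0) * l2norm M1 f"
      by (rule LIMSEQ_le_const) (use le in blast)
    then show "l2norm M2 (HS_op M1 k f) \<le> 0 * l2norm M1 f" by simp
  qed
  then have k0: "AE p in P. k p = 0" by (rule kernel_eq_0_if_op_bound_0[OF k])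
  have h_norm: "(\<lambda>n. l2norm P (h n)) \<longlonglongrightarrow> 0"
    using l2norm_limit[OF h k hk] k0 l2norm_eq_0_iff[OF k] by simp
  define f where "f i x = complex_of_real (sqrt (s i)) * cnj (u i x)" for i x
  define g where "g i y = complex_of_real (sqrt (s i)) * v i y" for i y
  have fg: "tensor (f i) (g i) p = complex_of_real (s i) * ?R i p" for i p
  proof -
    have "complex_of_real (sqrt (s i)) * complex_of_real (sqrt (s i)) = complex_of_real (s i)"
      using s[of i] by (simp flip: of_real_mult)
    then show ?thesis
      unfolding tensor_def f_def g_def rank_one_def by (metis mult.assoc mult.left_commute)
  qed
  have fn: "(l2norm M1 (f i))\<^sup>2 \<le> s i" "(l2norm M2 (g i))\<^sup>2 \<le> s i" for i
    unfolding f_def[abs_def] g_def[abs_def] l2norm_scale power_mult_distrib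
    using s[of i] norm1[of i] by (auto intro!: mult_left_le power_le_one)
  show ?thesis
  proof (rule hilbert_factorableI[OF _ _ _ _ b])
    show "f i \<in> L2 M1" "g i \<in> L2 M2" for i
      unfolding f_def[abs_def] g_def[abs_def] by (intro L2_scale L2_cnj u v)+
    show "summable (\<lambda>i. (l2norm M1 (f i))\<^sup>2)" "summable (\<lambda>i. (l2norm M2 (g i))\<^sup>2)"
      by (rule summable_comparison_test'[OF s_summable, of 0]; use fn in simp)+
    show "(\<lambda>n. l2norm P (\<lambda>p. b p - (\<Sum>i<n. tensor (f i) (g i) p))) \<longlonglongrightarrow> 0"
      using h_norm unfolding fg h_sum .
  qed
qed

end

section \<open>Closability and the adjoint\<close>

context pair_sigma_finite
begin

lemma op_dist_HS_le:
  assumes h: "h \<in> L2 P" and k: "k \<in> L2 P" and b: "op_bound M1 M2 (\<lambda>p. h p - k p) C" and C: "0 \<le> C"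
  shows "op_dist M1 M2 (HS_op M1 h) (HS_op M1 k) \<le> C"
  unfolding op_dist_def opnorm_def
proof (rule cSUP_least)
  show "{f \<in> L2 M1. l2norm M1 f \<le> 1} \<noteq> {}"
    using L2_zero[of M1] l2norm_zero[of M1] by force
  fix f assume "f \<in> {f \<in> L2 M1. l2norm M1 f \<le> 1}"
  then have f: "f \<in> L2 M1" "l2norm M1 f \<le> 1" by auto
  have "l2norm M2 (\<lambda>y. HS_op M1 h f y - HS_op M1 k f y) = l2norm M2 (HS_op M1 (\<lambda>p. h p - k p) f)"
    using HS_kernel_diff[OF h k f(1)]
    by (intro l2norm_cong_AE L2_measurable[OF L2_diff] L2_measurable[OF HS_L2] HS_L2 L2_diff h k f) auto
  also have "\<dots> \<le> C * l2norm M1 f" by (rule op_boundD[OF b f(1)])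
  also have "\<dots> \<le> C * 1" by (intro mult_left_mono f C)
  finally show "l2norm M2 (\<lambda>y. HS_op M1 h f y - HS_op M1 k f y) \<le> C" by simp
qed

text \<open>
  Rotating \<open>q\<close> by a scalar of modulus one turns a bound on the real part into a bound on the modulus.
\<close>

lemma hilbert_factorable_if_Re_bounded:
  assumes d: "d \<in> L2 P" and \<delta>: "\<delta> > 0"
    and K: "\<And>q. q \<in> L2 P \<Longrightarrow> op_bound M1 M2 q \<delta> \<Longrightarrow> Re (\<integral>p. d p * q p \<partial>P) \<le> K"
  shows "hilbert_factorable M1 M2 d"
proof (rule hilbert_factorable_if_op_bounded[OF d])
  fix q assume q: "q \<in> L2 P" "op_bound M1 M2 q 1"
  define c where "c = (\<integral>p. d p * q p \<partial>P)"
  have "op_bound M1 M2 (\<lambda>p. complex_of_real \<delta> * cnj (sgn c) * q p) (cmod (complex_of_real \<delta> * cnj (sgn c)) * 1)"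
    by (rule op_bound_scale[OF q(2)])
  moreover have "cmod (complex_of_real \<delta> * cnj (sgn c)) * 1 = (if c = 0 then 0 else \<delta>)"
    using \<delta> by (simp add: norm_mult norm_sgn)
  ultimately have "op_bound M1 M2 (\<lambda>p. complex_of_real \<delta> * cnj (sgn c) * q p) \<delta>"
    using \<delta> unfolding op_bound_def by (auto intro: order_trans split: if_splits)
  from K[OF L2_scale[OF q(1)] this]
  have "Re (\<integral>p. d p * (complex_of_real \<delta> * cnj (sgn c) * q p) \<partial>P) \<le> K" .
  also have "(\<integral>p. d p * (complex_of_real \<delta> * cnj (sgn c) * q p) \<partial>P)
      = (\<integral>p. (complex_of_real \<delta> * cnj (sgn c)) * (d p * q p) \<partial>P)"
    by (intro Bochner_Integration.integral_cong refl) (simp only: mult_ac)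
  also have "\<dots> = complex_of_real \<delta> * cnj (sgn c) * c"
    unfolding c_def by (rule integral_mult_right_zero)
  also have "complex_of_real \<delta> * cnj (sgn c) * c = complex_of_real (\<delta> * cmod c)"
  proof (cases "c = 0")
    case False
    have "cnj c * c = complex_of_real (cmod c * cmod c)"
      using complex_norm_square[of c] by (simp add: power2_eq_square mult.commute)
    then show ?thesis using False by (simp add: sgn_eq field_simps)
  qed simp
  finally show "cmod (\<integral>p. d p * q p \<partial>P) \<le> K / \<delta>"
    using \<delta> by (simp add: c_def pos_le_divide_eq mult.commute)
qed

text \<open>
  The Hahn--Banach step. With \<open>c = (1 + |\<phi>|\<^sup>2)\<^sup>-\<^sup>1\<^sup>/\<^sup>2\<close> and \<open>\<sigma> = \<phi> c\<close>, the graph of multiplication by \<open>\<phi>\<close> is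
  \<open>{(c m, \<sigma> m)}\<close>, and a pair \<open>(k, l)\<close> has distance \<open>\<parallel>c l - \<sigma> k\<parallel>\<close> from it in \<open>L\<^sup>2 \<oplus> L\<^sup>2\<close>, because \<open>(c, \<sigma>)\<close>
  is a unit vector at every point. So \<open>(0, I\<^sub>k\<^sub>0)\<close> is in the closure as soon as \<open>c k\<^sub>0\<close> can be approximated
  in \<open>L\<^sup>2\<close> by functions \<open>c q - \<sigma> w\<close> with \<open>I\<^sub>q\<close> and \<open>I\<^sub>w\<close> small in operator norm. If it cannot, the residual \<open>r\<close>
  of the projection onto this convex set makes both \<open>b = c cnj r\<close> and \<open>\<phi> b = \<sigma> cnj r\<close> bounded functionals for
  the operator norm, while \<open>\<integral> k\<^sub>0 b \<noteq> 0\<close>.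
\<close>

lemma graph_closure_or_annihilator:
  assumes \<phi>: "\<phi> \<in> borel_measurable P" and k0: "k0 \<in> L2 P"
    and ann: "\<And>b. b \<in> L2 P \<Longrightarrow> hilbert_factorable M1 M2 b \<Longrightarrow> hilbert_factorable M1 M2 (\<lambda>p. \<phi> p * b p)
      \<Longrightarrow> (\<integral>p. k0 p * b p \<partial>P) = 0"
  shows "(HS_op M1 (\<lambda>p. 0), HS_op M1 k0) \<in> graph_closure M1 M2 (mult_graph M1 M2 \<phi>)"
proof -
  note [measurable] = \<phi> L2_measurable[OF k0]
  define c where "c p = complex_of_real (1 / sqrt (1 + (cmod (\<phi> p))\<^sup>2))" for p
  define \<sigma> where "\<sigma> p = \<phi> p * c p" for p
  have cm [measurable]: "c \<in> borel_measurable P" unfolding c_def[abs_def] by measurable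
  have \<sigma>m [measurable]: "\<sigma> \<in> borel_measurable P" unfolding \<sigma>_def[abs_def] by measurable
  have unit: "c p * c p + \<sigma> p * cnj (\<sigma> p) = 1" and cnj_c: "cnj (c p) = c p" for p
  proof -
    have pos: "1 + (cmod (\<phi> p))\<^sup>2 > 0" by (simp add: add_pos_nonneg)
    define t where "t = 1 / sqrt (1 + (cmod (\<phi> p))\<^sup>2)"
    have "t * t * (1 + (cmod (\<phi> p))\<^sup>2) = 1" using pos by (simp add: t_def)
    then have "complex_of_real (t * t * (1 + (cmod (\<phi> p))\<^sup>2)) = 1" by simp
    moreover have "\<phi> p * cnj (\<phi> p) = complex_of_real ((cmod (\<phi> p))\<^sup>2)"
      by (simp only: complex_norm_square)
    ultimately show "c p * c p + \<sigma> p * cnj (\<sigma> p) = 1"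
      by (simp add: \<sigma>_def c_def t_def[symmetric] algebra_simps)
    show "cnj (c p) = c p" by (simp add: c_def)
  qed
  have sq: "(cmod (c p))\<^sup>2 + (cmod (\<sigma> p))\<^sup>2 = 1" for p
  proof -
    have "complex_of_real ((cmod (c p))\<^sup>2 + (cmod (\<sigma> p))\<^sup>2) = complex_of_real 1"
      using unit[of p] by (simp only: of_real_add complex_norm_square cnj_c of_real_1)
    then show ?thesis by (simp only: of_real_eq_iff)
  qed
  have c1: "cmod (c p) \<le> 1" and \<sigma>1: "cmod (\<sigma> p) \<le> 1" for p
  proof -
    have "(cmod (c p))\<^sup>2 \<le> 1\<^sup>2" "(cmod (\<sigma> p))\<^sup>2 \<le> 1\<^sup>2"
      using sq[of p] zero_le_power2[of "cmod (c p)"] zero_le_power2[of "cmod (\<sigma> p)"]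
      unfolding power_one by linarith+
    then show "cmod (c p) \<le> 1" "cmod (\<sigma> p) \<le> 1" by (auto intro: power2_le_imp_le)
  qed
  have cL: "(\<lambda>p. c p * q p) \<in> L2 P" and \<sigma>L: "(\<lambda>p. \<sigma> p * q p) \<in> L2 P" and \<sigma>cL: "(\<lambda>p. cnj (\<sigma> p) * q p) \<in> L2 P"
    if "q \<in> L2 P" for q
    using c1 \<sigma>1 that by (auto intro!: L2_mult_bounded[where K=1] borel_measurable_cnj)
  have zero_op_bound: "op_bound M1 M2 (\<lambda>p. 0) \<delta>" if "\<delta> > 0" for \<delta>
    using that by (simp add: op_bound_def)
  have approx: "\<exists>q w. q \<in> L2 P \<and> w \<in> L2 P \<and> op_bound M1 M2 q \<delta> \<and> op_bound M1 M2 w \<delta> \<and>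
      l2norm P (\<lambda>p. c p * k0 p - (c p * q p - \<sigma> p * w p)) < \<delta>" if \<delta>: "\<delta> > 0" for \<delta>
  proof -
    define Z where "Z = {(\<lambda>p. c p * q p - \<sigma> p * w p) | q w. q \<in> L2 P \<and> w \<in> L2 P \<and> op_bound M1 M2 q \<delta> \<and> op_bound M1 M2 w \<delta>}"
    have ZI: "(\<lambda>p. c p * q p - \<sigma> p * w p) \<in> Z"
      if "q \<in> L2 P" "w \<in> L2 P" "op_bound M1 M2 q \<delta>" "op_bound M1 M2 w \<delta>" for q w
      unfolding Z_def using that by blast
    have ZL: "Z \<subseteq> L2 P" unfolding Z_def by (auto intro!: L2_diff cL \<sigma>L)
    have Z0: "(\<lambda>p. 0) \<in> Z" using ZI[OF L2_zero L2_zero zero_op_bound[OF \<delta>] zero_op_bound[OF \<delta>]] by simp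
    have mix: "op_bound M1 M2 (\<lambda>p. complex_of_real (1 - t) * q p + complex_of_real t * q' p) \<delta>"
      if "q \<in> L2 P" "q' \<in> L2 P" "op_bound M1 M2 q \<delta>" "op_bound M1 M2 q' \<delta>" "0 \<le> t" "t \<le> 1" for q q' t
    proof -
      have "op_bound M1 M2 (\<lambda>p. complex_of_real (1 - t) * q p + complex_of_real t * q' p)
          (cmod (complex_of_real (1 - t)) * \<delta> + cmod (complex_of_real t) * \<delta>)"
        by (intro op_bound_add op_bound_scale L2_scale that)
      moreover have "cmod (complex_of_real (1 - t)) * \<delta> + cmod (complex_of_real t) * \<delta> = \<delta>"
        unfolding norm_of_real using that by (simp add: algebra_simps)
      ultimately show ?thesis by simp
    qed
    have convex: "(\<lambda>p. complex_of_real (1 - t) * f p + complex_of_real t * g p) \<in> Z"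
      if fg: "f \<in> Z" "g \<in> Z" and t: "0 \<le> t" "t \<le> 1" for f g t
    proof -
      obtain q w where qw: "f = (\<lambda>p. c p * q p - \<sigma> p * w p)" "q \<in> L2 P" "w \<in> L2 P" "op_bound M1 M2 q \<delta>" "op_bound M1 M2 w \<delta>"
        using fg(1) unfolding Z_def by blast
      obtain q' w' where qw': "g = (\<lambda>p. c p * q' p - \<sigma> p * w' p)" "q' \<in> L2 P" "w' \<in> L2 P" "op_bound M1 M2 q' \<delta>" "op_bound M1 M2 w' \<delta>"
        using fg(2) unfolding Z_def by blast
      have "(\<lambda>p. complex_of_real (1 - t) * f p + complex_of_real t * g p)
        = (\<lambda>p. c p * (complex_of_real (1 - t) * q p + complex_of_real t * q' p)
             - \<sigma> p * (complex_of_real (1 - t) * w p + complex_of_real t * w' p))"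
        unfolding qw(1) qw'(1) by (simp add: fun_eq_iff algebra_simps)
      also have "\<dots> \<in> Z" by (intro ZI mix L2_add L2_scale qw qw' t)
      finally show ?thesis .
    qed
    obtain r z where r: "r \<in> L2 P" and z: "\<And>n. z n \<in> Z"
      and lim: "(\<lambda>n. l2norm P (\<lambda>x. (c x * k0 x - z n x) - r x)) \<longlonglongrightarrow> 0"
      and var: "\<And>w. w \<in> Z \<Longrightarrow> Re (inprod P w r) \<le> Re (inprod P (\<lambda>x. c x * k0 x) r) - (l2norm P r)\<^sup>2"
    proof (rule L2_projection_convex[OF ZL _ cL[OF k0] convex])
      show "Z \<noteq> {}" using Z0 by blast
    qed blast+
    define K where "K = Re (inprod P (\<lambda>x. c x * k0 x) r) - (l2norm P r)\<^sup>2"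
    have K0: "0 \<le> K" using var[OF Z0] by (simp add: K_def)
    define b where "b p = c p * cnj (r p)" for p
    have bL: "b \<in> L2 P" unfolding b_def[abs_def] by (intro cL L2_cnj r)
    have \<phi>b: "\<phi> p * b p = \<sigma> p * cnj (r p)" for p by (simp add: b_def \<sigma>_def)
    have "hilbert_factorable M1 M2 b"
    proof (rule hilbert_factorable_if_Re_bounded[OF bL \<delta>])
      fix q assume q: "q \<in> L2 P" "op_bound M1 M2 q \<delta>"
      have "Re (inprod P (\<lambda>p. c p * q p) r) \<le> K"
        using var[OF ZI[OF q(1) L2_zero q(2) zero_op_bound[OF \<delta>]]] by (simp add: K_def)
      also have "inprod P (\<lambda>p. c p * q p) r = (\<integral>p. b p * q p \<partial>P)"
        by (simp add: inprod_def b_def mult_ac)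
      finally show "Re (\<integral>p. b p * q p \<partial>P) \<le> K" .
    qed
    moreover have "hilbert_factorable M1 M2 (\<lambda>p. \<phi> p * b p)"
      unfolding \<phi>b
    proof (rule hilbert_factorable_if_Re_bounded[OF \<sigma>L[OF L2_cnj[OF r]] \<delta>])
      fix w assume w: "w \<in> L2 P" "op_bound M1 M2 w \<delta>"
      have "op_bound M1 M2 (\<lambda>p. (-1) * w p) \<delta>" using op_bound_scale[OF w(2), of "-1"] by simp
      from var[OF ZI[OF L2_zero L2_scale[OF w(1)] zero_op_bound[OF \<delta>] this]]
      have "Re (inprod P (\<lambda>p. \<sigma> p * w p) r) \<le> K" by (simp add: K_def)
      also have "inprod P (\<lambda>p. \<sigma> p * w p) r = (\<integral>p. \<sigma> p * cnj (r p) * w p \<partial>P)"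
        by (simp add: inprod_def mult_ac)
      finally show "Re (\<integral>p. \<sigma> p * cnj (r p) * w p \<partial>P) \<le> K" .
    qed
    ultimately have "(\<integral>p. k0 p * b p \<partial>P) = 0" by (rule ann[OF bL])
    moreover have "inprod P (\<lambda>x. c x * k0 x) r = (\<integral>p. k0 p * b p \<partial>P)"
      by (simp add: inprod_def b_def mult_ac)
    ultimately have "l2norm P r = 0" using K0 by (simp add: K_def)
    then have r0: "AE p in P. r p = 0" using l2norm_eq_0_iff[OF r] by simp
    have "l2norm P (\<lambda>x. (c x * k0 x - z n x) - r x) = l2norm P (\<lambda>x. c x * k0 x - z n x)" for n
      using r0 ZL z by (intro l2norm_cong_AE L2_measurable[OF L2_diff] L2_diff cL k0 r) auto
    with lim have "(\<lambda>n. l2norm P (\<lambda>x. c x * k0 x - z n x)) \<longlonglongrightarrow> 0" by simp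
    then obtain n where "l2norm P (\<lambda>x. c x * k0 x - z n x) < \<delta>"
      using order_tendstoD(2)[of _ 0 sequentially \<delta>] \<delta> by (fastforce simp: eventually_sequentially)
    moreover obtain q w where "z n = (\<lambda>p. c p * q p - \<sigma> p * w p)" "q \<in> L2 P" "w \<in> L2 P"
        "op_bound M1 M2 q \<delta>" "op_bound M1 M2 w \<delta>"
      using z[of n] unfolding Z_def by blast
    ultimately show ?thesis by (intro exI[of _ q] exI[of _ w]) simp
  qed
  have "\<exists>(A, B)\<in>mult_graph M1 M2 \<phi>. op_dist M1 M2 (HS_op M1 (\<lambda>p. 0)) A < \<epsilon> \<and> op_dist M1 M2 (HS_op M1 k0) B < \<epsilon>"
    if \<epsilon>: "\<epsilon> > 0" for \<epsilon>
  proof -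
    define \<delta> where "\<delta> = \<epsilon> / 3"
    have \<delta>: "\<delta> > 0" using \<epsilon> by (simp add: \<delta>_def)
    obtain q w where q: "q \<in> L2 P" "op_bound M1 M2 q \<delta>" and w: "w \<in> L2 P" "op_bound M1 M2 w \<delta>"
      and small: "l2norm P (\<lambda>p. c p * k0 p - (c p * q p - \<sigma> p * w p)) < \<delta>"
      using approx[OF \<delta>] by blast
    define \<rho> where "\<rho> p = c p * k0 p - (c p * q p - \<sigma> p * w p)" for p
    have \<rho>: "\<rho> \<in> L2 P" "l2norm P \<rho> < \<delta>"
      unfolding \<rho>_def[abs_def] using small by (auto intro!: L2_diff cL \<sigma>L k0 q w)
    (* (c m, sigma m) is the pointwise orthogonal projection of (-w, k0 - q) to the line of
       the graph; the error is rho times the unit normal (-cnj sigma, c). *)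
    define m where "m p = cnj (\<sigma> p) * (k0 p - q p) - c p * w p" for p
    have m: "m \<in> L2 P" unfolding m_def[abs_def] by (intro L2_diff cL \<sigma>cL k0 q w)
    define k where "k p = c p * m p" for p
    have k: "k \<in> L2 P" unfolding k_def[abs_def] by (rule cL[OF m])
    have \<phi>k: "(\<lambda>p. \<phi> p * k p) = (\<lambda>p. \<sigma> p * m p)" by (auto simp: k_def \<sigma>_def mult_ac)
    have \<phi>kL: "(\<lambda>p. \<phi> p * k p) \<in> L2 P" unfolding \<phi>k by (rule \<sigma>L[OF m])
    have u: "c p * c p = 1 - \<sigma> p * cnj (\<sigma> p)" for p using unit[of p] by (simp add: algebra_simps)
    have 1: "0 - k p = w p + (-1) * (cnj (\<sigma> p) * \<rho> p)" for p
    proof -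
      have "k p = c p * cnj (\<sigma> p) * (k0 p - q p) - (c p * c p) * w p"
        by (simp add: k_def m_def algebra_simps)
      then show ?thesis unfolding u by (simp add: \<rho>_def algebra_simps)
    qed
    have 2: "k0 p - \<phi> p * k p = q p + c p * \<rho> p" for p
    proof -
      have "\<phi> p * k p = \<sigma> p * m p" using \<phi>k by metis
      also have "\<dots> = (\<sigma> p * cnj (\<sigma> p)) * (k0 p - q p) - c p * \<sigma> p * w p"
        by (simp add: m_def algebra_simps)
      also have "\<sigma> p * cnj (\<sigma> p) = 1 - c p * c p" using u[of p] by simp
      finally show ?thesis by (simp add: \<rho>_def algebra_simps)
    qed
    have n1: "l2norm P (\<lambda>p. cnj (\<sigma> p) * \<rho> p) \<le> \<delta>"
      using l2norm_mono[OF \<rho>(1) \<sigma>cL[OF \<rho>(1)]] \<sigma>1 \<rho>(2)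
      by (force simp: norm_mult intro!: mult_left_le_one_le)
    have n2: "l2norm P (\<lambda>p. c p * \<rho> p) \<le> \<delta>"
      using l2norm_mono[OF \<rho>(1) cL[OF \<rho>(1)]] c1 \<rho>(2)
      by (force simp: norm_mult intro!: mult_left_le_one_le)
    have mono: "op_bound M1 M2 h D" if "op_bound M1 M2 h C" "C \<le> D" for h C D
      using that unfolding op_bound_def by (meson mult_right_mono l2norm_nonneg order_trans)
    have "op_bound M1 M2 (\<lambda>p. 0 - k p) (\<delta> + cmod (-1) * \<delta>)"
      unfolding 1 by (intro op_bound_add op_bound_scale w L2_scale \<sigma>cL \<rho> mono[OF op_bound_l2norm n1])
    then have "op_dist M1 M2 (HS_op M1 (\<lambda>p. 0)) (HS_op M1 k) \<le> \<delta> + cmod (-1) * \<delta>"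
      by (rule op_dist_HS_le[OF L2_zero k]) (use \<delta> in simp)
    then have d1: "op_dist M1 M2 (HS_op M1 (\<lambda>p. 0)) (HS_op M1 k) < \<epsilon>" using \<epsilon> by (simp add: \<delta>_def)
    have "op_bound M1 M2 (\<lambda>p. k0 p - \<phi> p * k p) (\<delta> + \<delta>)"
      unfolding 2 by (intro op_bound_add q cL \<rho> mono[OF op_bound_l2norm n2])
    then have "op_dist M1 M2 (HS_op M1 k0) (HS_op M1 (\<lambda>p. \<phi> p * k p)) \<le> \<delta> + \<delta>"
      by (rule op_dist_HS_le[OF k0 \<phi>kL]) (use \<delta> in simp)
    then have d2: "op_dist M1 M2 (HS_op M1 k0) (HS_op M1 (\<lambda>p. \<phi> p * k p)) < \<epsilon>" using \<epsilon> by (simp add: \<delta>_def)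
    have "(HS_op M1 k, HS_op M1 (\<lambda>p. \<phi> p * k p)) \<in> mult_graph M1 M2 \<phi>"
      unfolding mult_graph_def mult_dom_def using k \<phi>kL by blast
    with d1 d2 show ?thesis by blast
  qed
  then show ?thesis
    unfolding graph_closure_def using HS_op_compact[OF L2_zero] HS_op_compact[OF k0] by blast
qed

text \<open>
  If all \<open>b\<close> annihilate \<open>k\<^sub>0\<close>, then both \<open>(0, I\<^sub>k\<^sub>0)\<close> and \<open>(0, 0)\<close> are in the closure of the graph, so
  \<open>I\<^sub>k\<^sub>0 = 0\<close>.
\<close>

lemma closable_imp_annihilator_total:
  assumes cl: "closable_multiplier M1 M2 \<phi>" and k0: "k0 \<in> L2 P"
    and ann: "\<And>b. b \<in> L2 P \<Longrightarrow> hilbert_factorable M1 M2 b \<Longrightarrow> hilbert_factorable M1 M2 (\<lambda>p. \<phi> p * b p)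
      \<Longrightarrow> (\<integral>p. k0 p * b p \<partial>P) = 0"
  shows "AE p in P. k0 p = 0"
proof -
  let ?G = "graph_closure M1 M2 (mult_graph M1 M2 \<phi>)"
  have \<phi>: "\<phi> \<in> borel_measurable P" and sv: "is_op_graph M1 M2 ?G"
    using cl by (auto simp: closable_multiplier_def)
  have g1: "(HS_op M1 (\<lambda>p. 0), HS_op M1 k0) \<in> ?G"
    by (rule graph_closure_or_annihilator[OF \<phi> k0 ann])
  have g2: "(HS_op M1 (\<lambda>p. 0), HS_op M1 (\<lambda>p. 0)) \<in> ?G"
    by (rule graph_closure_or_annihilator[OF \<phi> L2_zero]) simp
  have "op_eq M1 M2 (HS_op M1 k0) (HS_op M1 (\<lambda>p. 0))"
    using sv g1 g2 unfolding is_op_graph_def by (fastforce simp: op_eq_def)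
  then have eq: "AE y in M2. HS_op M1 k0 f y = 0" if "f \<in> L2 M1" for f
    using that by (simp add: op_eq_def)
  have "op_bound M1 M2 k0 0"
    unfolding op_bound_def using eq l2norm_eq_0_iff[OF HS_L2[OF k0]] by simp
  then show ?thesis by (rule kernel_eq_0_if_op_bound_0[OF k0])
qed

end

section \<open>Countable unions of rectangles\<close>

text \<open>
  Here the set is a countable union of rectangles exactly, not only up to a null set. This makes
  the class stable under countable unions and finite intersections without bookkeeping of null sets.
\<close>

definition rect_open :: "'a measure \<Rightarrow> 'b measure \<Rightarrow> ('a \<times> 'b) set \<Rightarrow> bool" where
  "rect_open M N E \<longleftrightarrow> (\<exists>R. countable R \<and> R \<subseteq> rectangles M N \<and> E = \<Union>R)"

definition rect_continuous :: "'a measure \<Rightarrow> 'b measure \<Rightarrow> ('a \<times> 'b \<Rightarrow> 'c::topological_space) \<Rightarrow> bool" where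
  "rect_continuous M N \<psi> \<longleftrightarrow> (\<forall>U. open U \<longrightarrow> rect_open M N {p \<in> space (M \<Otimes>\<^sub>M N). \<psi> p \<in> U})"

lemma rect_continuousD:
  "rect_continuous M N \<psi> \<Longrightarrow> open U \<Longrightarrow> rect_open M N {p \<in> space (M \<Otimes>\<^sub>M N). \<psi> p \<in> U}"
  by (simp add: rect_continuous_def)

lemma rect_open_Times: "A \<in> sets M \<Longrightarrow> B \<in> sets N \<Longrightarrow> rect_open M N (A \<times> B)"
  unfolding rect_open_def rectangles_def by (intro exI[of _ "{A \<times> B}"]) auto

lemma rect_open_UN:
  assumes "countable I" "\<And>i. i \<in> I \<Longrightarrow> rect_open M N (E i)"
  shows "rect_open M N (\<Union>i\<in>I. E i)"
proof -
  from assms(2) obtain R where R: "\<And>i. i \<in> I \<Longrightarrow> countable (R i)"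
    "\<And>i. i \<in> I \<Longrightarrow> R i \<subseteq> rectangles M N" "\<And>i. i \<in> I \<Longrightarrow> E i = \<Union>(R i)"
    unfolding rect_open_def by metis
  have "countable (\<Union>i\<in>I. R i)" by (intro countable_UN assms(1) R(1))
  moreover have "(\<Union>i\<in>I. E i) = \<Union>(\<Union>i\<in>I. R i)" using R(3) by simp blast
  moreover have "(\<Union>i\<in>I. R i) \<subseteq> rectangles M N" using R(2) by (rule UN_least)
  ultimately show ?thesis unfolding rect_open_def by blast
qed

lemma rectangles_Int: "A \<in> rectangles M N \<Longrightarrow> B \<in> rectangles M N \<Longrightarrow> A \<inter> B \<in> rectangles M N"
  unfolding rectangles_def by (auto simp: Times_Int_Times) (metis sets.Int)

lemma rect_open_Int:
  assumes "rect_open M N E" "rect_open M N F"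
  shows "rect_open M N (E \<inter> F)"
proof -
  obtain R S where R: "countable R" "R \<subseteq> rectangles M N" "E = \<Union>R"
    and S: "countable S" "S \<subseteq> rectangles M N" "F = \<Union>S"
    using assms unfolding rect_open_def by blast
  have "E \<inter> F = \<Union>((\<lambda>(A, B). A \<inter> B) ` (R \<times> S))" unfolding R(3) S(3) by auto
  moreover have "countable ((\<lambda>(A, B). A \<inter> B) ` (R \<times> S))" using R(1) S(1) by simp
  moreover have "(\<lambda>(A, B). A \<inter> B) ` (R \<times> S) \<subseteq> rectangles M N"
    using R(2) S(2) by (auto intro: rectangles_Int)
  ultimately show ?thesis unfolding rect_open_def by blast
qed

lemma rect_open_sets: "rect_open M N E \<Longrightarrow> E \<in> sets (M \<Otimes>\<^sub>M N)"
  unfolding rect_open_def rectangles_def by (auto intro!: sets.countable_Union)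

lemma rect_continuous_fst:
  fixes f :: "'a \<Rightarrow> 'c::topological_space"
  assumes f: "f \<in> borel_measurable M" shows "rect_continuous M N (\<lambda>p. f (fst p))"
  unfolding rect_continuous_def
proof (intro allI impI)
  fix U :: "'c set" assume "open U"
  then have "f -` U \<inter> space M \<in> sets M" by (intro measurable_sets[OF f] borel_open)
  moreover have "{p \<in> space (M \<Otimes>\<^sub>M N). f (fst p) \<in> U} = (f -` U \<inter> space M) \<times> space N"
    by (auto simp: space_pair_measure)
  ultimately show "rect_open M N {p \<in> space (M \<Otimes>\<^sub>M N). f (fst p) \<in> U}"
    by (simp add: rect_open_Times)
qed

lemma rect_continuous_snd:
  fixes g :: "'b \<Rightarrow> 'c::topological_space"
  assumes g: "g \<in> borel_measurable N" shows "rect_continuous M N (\<lambda>p. g (snd p))"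
  unfolding rect_continuous_def
proof (intro allI impI)
  fix U :: "'c set" assume "open U"
  then have "g -` U \<inter> space N \<in> sets N" by (intro measurable_sets[OF g] borel_open)
  moreover have "{p \<in> space (M \<Otimes>\<^sub>M N). g (snd p) \<in> U} = space M \<times> (g -` U \<inter> space N)"
    by (auto simp: space_pair_measure)
  ultimately show "rect_open M N {p \<in> space (M \<Otimes>\<^sub>M N). g (snd p) \<in> U}"
    by (simp add: rect_open_Times)
qed

lemma rect_continuous_const: "rect_continuous M N (\<lambda>p. c)"
  using rect_continuous_fst[of "\<lambda>_. c" M N] by simp

text \<open>
  Second countability is essential: an open set of the product is a union of countably many boxes.
\<close>

lemma rect_continuous_Pair:
  fixes \<psi> :: "'a \<times> 'b \<Rightarrow> 'c::second_countable_topology" and \<theta> :: "'a \<times> 'b \<Rightarrow> 'd::second_countable_topology"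
  assumes \<psi>: "rect_continuous M N \<psi>" and \<theta>: "rect_continuous M N \<theta>"
  shows "rect_continuous M N (\<lambda>p. (\<psi> p, \<theta> p))"
  unfolding rect_continuous_def
proof (intro allI impI)
  fix U :: "('c \<times> 'd) set" assume U: "open U"
  obtain B :: "'c set set" where B: "countable B" "topological_basis B"
    using ex_countable_basis by blast
  obtain C :: "'d set set" where C: "countable C" "topological_basis C"
    using ex_countable_basis by blast
  define I where "I = {(V, W). V \<in> B \<and> W \<in> C \<and> V \<times> W \<subseteq> U}"
  have "I \<subseteq> B \<times> C" by (auto simp: I_def)
  moreover have "countable (B \<times> C)" using B(1) C(1) by simp
  ultimately have "countable I" by (rule countable_subset)
  have "{p \<in> space (M \<Otimes>\<^sub>M N). (\<psi> p, \<theta> p) \<in> U}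
      = (\<Union>(V, W)\<in>I. {p \<in> space (M \<Otimes>\<^sub>M N). \<psi> p \<in> V} \<inter> {p \<in> space (M \<Otimes>\<^sub>M N). \<theta> p \<in> W})" (is "?L = ?R")
  proof
    show "?R \<subseteq> ?L" by (auto simp: I_def)
    show "?L \<subseteq> ?R"
    proof
      fix p assume p: "p \<in> ?L"
      obtain V W where VW: "open V" "open W" "(\<psi> p, \<theta> p) \<in> V \<times> W" "V \<times> W \<subseteq> U"
        using open_prod_elim[OF U, of "(\<psi> p, \<theta> p)"] p by auto
      obtain V' where V': "V' \<in> B" "\<psi> p \<in> V'" "V' \<subseteq> V"
        using topological_basisE[OF B(2) VW(1), of "\<psi> p"] VW(3) by auto
      obtain W' where W': "W' \<in> C" "\<theta> p \<in> W'" "W' \<subseteq> W"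
        using topological_basisE[OF C(2) VW(2), of "\<theta> p"] VW(3) by auto
      have "(V', W') \<in> I" using V' W' VW(4) by (auto simp: I_def)
      then show "p \<in> ?R" using V' W' p by auto
    qed
  qed
  moreover have "rect_open M N ?R"
  proof (rule rect_open_UN[OF \<open>countable I\<close>])
    fix i assume "i \<in> I"
    then have "open (fst i)" "open (snd i)"
      using topological_basis_open[OF B(2)] topological_basis_open[OF C(2)] by (auto simp: I_def)
    then show "rect_open M N (case i of (V, W) \<Rightarrow> {p \<in> space (M \<Otimes>\<^sub>M N). \<psi> p \<in> V} \<inter> {p \<in> space (M \<Otimes>\<^sub>M N). \<theta> p \<in> W})"
      by (auto simp: case_prod_unfold intro!: rect_open_Int rect_continuousD \<psi> \<theta>)
  qed
  ultimately show "rect_open M N {p \<in> space (M \<Otimes>\<^sub>M N). (\<psi> p, \<theta> p) \<in> U}" by simp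
qed

lemma rect_continuous_compose:
  fixes g :: "'c::topological_space \<Rightarrow> 'd::topological_space"
  assumes "rect_continuous M N \<psi>" "continuous_on UNIV g"
  shows "rect_continuous M N (\<lambda>p. g (\<psi> p))"
  unfolding rect_continuous_def
proof (intro allI impI)
  fix U :: "'d set" assume "open U"
  then have "open (g -` U)" using assms(2) by (rule open_vimage)
  from rect_continuousD[OF assms(1) this]
  show "rect_open M N {p \<in> space (M \<Otimes>\<^sub>M N). g (\<psi> p) \<in> U}" by simp
qed

lemma rect_continuous_sum_products:
  fixes f :: "nat \<Rightarrow> 'a \<Rightarrow> complex" and g :: "nat \<Rightarrow> 'b \<Rightarrow> complex"
  assumes f: "\<And>i. f i \<in> borel_measurable M" and g: "\<And>i. g i \<in> borel_measurable N"
  shows "rect_continuous M N (\<lambda>p. \<Sum>i<n. f i (fst p) * g i (snd p))"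
proof (induction n)
  case 0
  show ?case by (simp add: rect_continuous_const)
next
  case (Suc n)
  have "rect_continuous M N (\<lambda>p. (\<lambda>(s, a, b). s + a * b) ((\<Sum>i<n. f i (fst p) * g i (snd p)), f n (fst p), g n (snd p)))"
    by (rule rect_continuous_compose[where \<psi>="\<lambda>p. ((\<Sum>i<n. f i (fst p) * g i (snd p)), f n (fst p), g n (snd p))"
          and g="\<lambda>(s, a, b). s + a * b"])
       (auto simp: case_prod_unfold intro!: rect_continuous_Pair Suc rect_continuous_fst rect_continuous_snd f g continuous_intros)
  then show ?case by simp
qed

text \<open>
  A uniform limit argument that is local with respect to countable covers by unions of rectangles:
  \<open>\<psi>\<close> takes a value in \<open>U\<close> at \<open>p\<close> iff for some precision \<open>\<eta>\<close> an approximation valid at \<open>p\<close> takes a value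
  lying \<open>\<eta>\<close>-deep inside \<open>U\<close>.
\<close>

lemma rect_continuous_approx:
  fixes \<psi> :: "'a \<times> 'b \<Rightarrow> 'c::metric_space"
  assumes approx: "\<And>\<eta>::real. \<eta> > 0 \<Longrightarrow> \<exists>E \<theta>. (\<forall>n::nat. rect_open M N (E n) \<and> rect_continuous M N (\<theta> n) \<and>
       (\<forall>p\<in>E n. dist (\<psi> p) (\<theta> n p) < \<eta>)) \<and> space (M \<Otimes>\<^sub>M N) \<subseteq> (\<Union>n. E n)"
  shows "rect_continuous M N \<psi>"
  unfolding rect_continuous_def
proof (intro allI impI)
  fix U :: "'c set" assume U: "open U"
  define \<eta> where "\<eta> m = 1 / real (Suc m)" for m
  have "\<forall>m. \<exists>E \<theta>. (\<forall>n::nat. rect_open M N (E n) \<and> rect_continuous M N (\<theta> n) \<and>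
       (\<forall>p\<in>E n. dist (\<psi> p) (\<theta> n p) < \<eta> m)) \<and> space (M \<Otimes>\<^sub>M N) \<subseteq> (\<Union>n. E n)"
    using approx by (simp add: \<eta>_def)
  then obtain E \<theta> where E: "\<And>m n::nat. rect_open M N (E m n)" and \<theta>: "\<And>m n. rect_continuous M N (\<theta> m n)"
    and close: "\<And>m n p. p \<in> E m n \<Longrightarrow> dist (\<psi> p) (\<theta> m n p) < \<eta> m"
    and cover: "\<And>m. space (M \<Otimes>\<^sub>M N) \<subseteq> (\<Union>n. E m n)"
    by metis
  (* The part of U that is eta-deep, taken as a union of balls so that it is open. *)
  define V where "V m = \<Union>{ball z r | z r. ball z (r + \<eta> m) \<subseteq> U}" for m
  have V: "open (V m)" for m unfolding V_def by auto
  have "{p \<in> space (M \<Otimes>\<^sub>M N). \<psi> p \<in> U} = (\<Union>m. \<Union>n. E m n \<inter> {p \<in> space (M \<Otimes>\<^sub>M N). \<theta> m n p \<in> V m})" (is "?L = ?R")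
  proof
    show "?R \<subseteq> ?L"
    proof
      fix p assume "p \<in> ?R"
      then obtain m n where p: "p \<in> E m n" "p \<in> space (M \<Otimes>\<^sub>M N)" "\<theta> m n p \<in> V m" by blast
      then obtain z r where zr: "dist z (\<theta> m n p) < r" "ball z (r + \<eta> m) \<subseteq> U" by (auto simp: V_def)
      have "dist z (\<psi> p) < r + \<eta> m"
        using dist_triangle[of z "\<psi> p" "\<theta> m n p"] zr(1) close[OF p(1)] by (simp add: dist_commute)
      then show "p \<in> ?L" using zr(2) p(2) by auto
    qed
    show "?L \<subseteq> ?R"
    proof
      fix p assume p: "p \<in> ?L"
      then obtain e where e: "e > 0" "ball (\<psi> p) e \<subseteq> U" using U by (auto elim: openE)
      obtain m where m: "2 / e < real (Suc m)" using reals_Archimedean2 less_trans by (metis lessI of_nat_less_iff)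
      then have "2 * \<eta> m \<le> e" using e(1) by (simp add: \<eta>_def field_simps)
      then have "ball (\<psi> p) (\<eta> m + \<eta> m) \<subseteq> U" using e(2) subset_ball[of "\<eta> m + \<eta> m" e "\<psi> p"] by simp
      then have "ball (\<psi> p) (\<eta> m) \<subseteq> V m" unfolding V_def by blast
      moreover obtain n where n: "p \<in> E m n" using cover[of m] p by blast
      ultimately have "\<theta> m n p \<in> V m" using close[OF n] by auto
      then show "p \<in> ?R" using n p by blast
    qed
  qed
  moreover have "rect_open M N ?R"
    by (intro rect_open_UN rect_open_Int E rect_continuousD \<theta> V) auto
  ultimately show "rect_open M N {p \<in> space (M \<Otimes>\<^sub>M N). \<psi> p \<in> U}" by simp
qed

lemma cmod_suminf_mult_le:
  fixes a b :: "nat \<Rightarrow> complex"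
  assumes a: "summable (\<lambda>i. (cmod (a i))\<^sup>2)" and b: "summable (\<lambda>i. (cmod (b i))\<^sup>2)"
  shows "summable (\<lambda>i. a i * b i)"
    and "cmod (\<Sum>i. a i * b i) \<le> ((\<Sum>i. (cmod (a i))\<^sup>2) + (\<Sum>i. (cmod (b i))\<^sup>2)) / 2"
proof -
  have s: "summable (\<lambda>i. ((cmod (a i))\<^sup>2 + (cmod (b i))\<^sup>2) / 2)"
    by (intro summable_divide summable_add a b)
  have le: "norm (a i * b i) \<le> ((cmod (a i))\<^sup>2 + (cmod (b i))\<^sup>2) / 2" for i
    using sum_squares_bound[of "cmod (a i)" "cmod (b i)"] by (simp add: norm_mult)
  show "summable (\<lambda>i. a i * b i)" by (rule summable_comparison_test'[OF s le])
  have "cmod (\<Sum>i. a i * b i) \<le> (\<Sum>i. ((cmod (a i))\<^sup>2 + (cmod (b i))\<^sup>2) / 2)"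
    by (rule norm_suminf_le[OF le s])
  also have "\<dots> = ((\<Sum>i. (cmod (a i))\<^sup>2) + (\<Sum>i. (cmod (b i))\<^sup>2)) / 2"
    by (simp add: suminf_divide suminf_add[symmetric] a b summable_add)
  finally show "cmod (\<Sum>i. a i * b i) \<le> ((\<Sum>i. (cmod (a i))\<^sup>2) + (\<Sum>i. (cmod (b i))\<^sup>2)) / 2" .
qed

text \<open>
  On the rectangle where the tails from \<open>n\<close> on of \<open>\<Sum>\<^sub>i |f\<^sub>i(x)|\<^sup>2\<close> and \<open>\<Sum>\<^sub>i |g\<^sub>i(y)|\<^sup>2\<close> are below \<open>\<eta>\<close>, the \<open>n\<close>-th partial
  sum is \<open>\<eta>\<close>-close to the full sum; for fixed \<open>\<eta>\<close> these rectangles cover the product.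
\<close>

lemma hilbert_factorable_rect_continuous:
  assumes "hilbert_factorable M N b"
  obtains \<beta> where "rect_continuous M N \<beta>" "AE p in M \<Otimes>\<^sub>M N. b p = \<beta> p"
proof -
  obtain f g where f: "\<And>i::nat. f i \<in> borel_measurable M" and g: "\<And>i. g i \<in> borel_measurable N"
    and fs: "\<And>x. summable (\<lambda>i. (cmod (f i x))\<^sup>2)" and gs: "\<And>y. summable (\<lambda>i. (cmod (g i y))\<^sup>2)"
    and ae: "AE p in M \<Otimes>\<^sub>M N. (\<lambda>i. f i (fst p) * g i (snd p)) sums b p"
    using assms unfolding hilbert_factorable_def by blast
  note [measurable] = f g
  define \<beta> where "\<beta> p = (\<Sum>i. f i (fst p) * g i (snd p))" for p
  have "rect_continuous M N \<beta>"
  proof (rule rect_continuous_approx)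
    fix \<eta> :: real assume \<eta>: "\<eta> > 0"
    define X where "X n = {x \<in> space M. (\<Sum>i. (cmod (f (i + n) x))\<^sup>2) < \<eta>}" for n
    define Y where "Y n = {y \<in> space N. (\<Sum>i. (cmod (g (i + n) y))\<^sup>2) < \<eta>}" for n
    define \<theta> where "\<theta> n p = (\<Sum>i<n. f i (fst p) * g i (snd p))" for n p
    have XY: "X n \<in> sets M" "Y n \<in> sets N" for n unfolding X_def Y_def by measurable
    have close: "dist (\<beta> p) (\<theta> n p) < \<eta>" if p: "p \<in> X n \<times> Y n" for n p
    proof -
      note fs' = summable_ignore_initial_segment[OF fs[of "fst p"], of n]
        and gs' = summable_ignore_initial_segment[OF gs[of "snd p"], of n]
      have "\<beta> p - \<theta> n p = (\<Sum>i. f (i + n) (fst p) * g (i + n) (snd p))"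
        unfolding \<beta>_def \<theta>_def
        using suminf_minus_initial_segment[of "\<lambda>i. f i (fst p) * g i (snd p)" n]
          cmod_suminf_mult_le(1)[OF fs[of "fst p"] gs[of "snd p"]] by simp
      then have "dist (\<beta> p) (\<theta> n p) \<le> ((\<Sum>i. (cmod (f (i + n) (fst p)))\<^sup>2) + (\<Sum>i. (cmod (g (i + n) (snd p)))\<^sup>2)) / 2"
        unfolding dist_norm using cmod_suminf_mult_le(2)[OF fs' gs'] by simp
      also have "\<dots> < \<eta>" using p by (auto simp: X_def Y_def)
      finally show ?thesis .
    qed
    have cover: "p \<in> (\<Union>n. X n \<times> Y n)" if p: "p \<in> space (M \<Otimes>\<^sub>M N)" for p
    proof -
      obtain n1 where n1: "\<forall>n\<ge>n1. norm (\<Sum>i. (cmod (f (i + n) (fst p)))\<^sup>2) < \<eta>"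
        using suminf_exist_split[OF \<eta> fs[of "fst p"]] by blast
      obtain n2 where n2: "\<forall>n\<ge>n2. norm (\<Sum>i. (cmod (g (i + n) (snd p)))\<^sup>2) < \<eta>"
        using suminf_exist_split[OF \<eta> gs[of "snd p"]] by blast
      have "fst p \<in> X (max n1 n2)" "snd p \<in> Y (max n1 n2)"
        using n1 n2 p by (auto simp: X_def Y_def space_pair_measure dest: spec[of _ "max n1 n2"])
      then show ?thesis by (auto simp: mem_Times_iff)
    qed
    show "\<exists>E \<theta>. (\<forall>n::nat. rect_open M N (E n) \<and> rect_continuous M N (\<theta> n) \<and>
       (\<forall>p\<in>E n. dist (\<beta> p) (\<theta> n p) < \<eta>)) \<and> space (M \<Otimes>\<^sub>M N) \<subseteq> (\<Union>n. E n)"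
    proof (intro exI[of _ "\<lambda>n. X n \<times> Y n"] exI[of _ \<theta>] conjI allI ballI subsetI close cover)
      show "rect_open M N (X n \<times> Y n)" for n by (intro rect_open_Times XY)
      show "rect_continuous M N (\<theta> n)" for n
        unfolding \<theta>_def[abs_def] by (rule rect_continuous_sum_products[OF f g])
    qed
  qed
  moreover have "AE p in M \<Otimes>\<^sub>M N. b p = \<beta> p"
    using ae by eventually_elim (simp add: \<beta>_def sums_iff)
  ultimately show ?thesis by (rule that)
qed

section \<open>Essential supports and the quotient representation\<close>

text \<open>
  Exhaustion: among countable unions of supports choose one of maximal measure with respect to a
  finite measure having the same null sets. No member of \<open>B\<close> can enlarge it.
\<close>

lemma (in sigma_finite_measure) countable_essential_support:
  fixes B :: "('a \<Rightarrow> complex) set"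
  assumes B: "B \<subseteq> borel_measurable M" "B \<noteq> {}"
  obtains b where "\<And>n::nat. b n \<in> B" "\<And>b'. b' \<in> B \<Longrightarrow> AE x in M. b' x \<noteq> 0 \<longrightarrow> (\<exists>n. b n x \<noteq> 0)"
proof -
  obtain w :: "'a \<Rightarrow> real" where [measurable]: "w \<in> borel_measurable M"
    and w0: "\<And>x. 0 < w x" and w: "integrable M w"
    using obtain_positive_integrable_function by metis
  define S where "S b = {x \<in> space M. \<exists>n::nat. b n x \<noteq> (0::complex)}" for b
  define J where "J b = (\<integral>x. indicator (S b) x * w x \<partial>M)" for b
  define seqs :: "(nat \<Rightarrow> 'a \<Rightarrow> complex) set" where "seqs = {b. range b \<subseteq> B}"
  have S [measurable]: "S b \<in> sets M" if "b \<in> seqs" for b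
  proof -
    have [measurable]: "b n \<in> borel_measurable M" for n using that B(1) by (auto simp: seqs_def)
    show ?thesis unfolding S_def by measurable
  qed
  have int: "integrable M (\<lambda>x. indicator (S b) x * w x)" if "b \<in> seqs" for b
    using integrable_mult_indicator[OF S[OF that] w] by simp
  have J_mono: "J b \<le> J b'" if "b \<in> seqs" "b' \<in> seqs" "S b \<subseteq> S b'" for b b'
    unfolding J_def
  proof (rule integral_mono)
    show "indicator (S b) x * w x \<le> indicator (S b') x * w x" for x
      using that(3) w0[of x] by (auto simp: indicator_def)
  qed (use int that in auto)
  have "bdd_above (J ` seqs)"
  proof (rule bdd_aboveI2)
    fix b assume "b \<in> seqs"
    then show "J b \<le> (\<integral>x. w x \<partial>M)" unfolding J_def
      by (intro integral_mono int w) (use w0 in \<open>auto simp: indicator_def less_imp_le\<close>)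
  qed
  have ne: "J ` seqs \<noteq> {}" using B(2) by (auto simp: seqs_def)
  define s where "s = Sup (J ` seqs)"
  have "\<exists>b\<in>seqs. s - 1 / real (Suc j) < J b" for j
    using less_cSupD[OF ne, of "s - 1 / real (Suc j)"] unfolding s_def by auto
  then obtain bb where bb: "\<And>j. bb j \<in> seqs" and bbs: "\<And>j. s - 1 / real (Suc j) < J (bb j)"
    by metis
  (* A single sequence running through all members of a maximizing family of sequences. *)
  define b where "b n = bb (fst (prod_decode n)) (snd (prod_decode n))" for n
  have b: "b \<in> seqs" using bb by (auto simp: b_def seqs_def)
  have "S (bb j) \<subseteq> S b" for j
  proof
    fix x assume "x \<in> S (bb j)"
    then obtain n where "x \<in> space M" "bb j n x \<noteq> 0" by (auto simp: S_def)
    then show "x \<in> S b" unfolding S_def b_def by (auto intro!: exI[of _ "prod_encode (j, n)"])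
  qed
  then have le: "s - 1 / real (Suc j) \<le> J b" for j
    using less_imp_le[OF bbs[of j]] J_mono[OF bb[of j] b] by (meson order_trans)
  have "s \<le> J b"
  proof (rule LIMSEQ_le_const2)
    show "(\<lambda>j. s - 1 / real (Suc j)) \<longlonglongrightarrow> s"
      using tendsto_diff[OF tendsto_const[of s] LIMSEQ_inverse_real_of_nat] by (simp add: inverse_eq_divide)
  qed (use le in blast)
  show ?thesis
  proof (rule that)
    show "b n \<in> B" for n using b by (auto simp: seqs_def)
    fix b' assume b': "b' \<in> B"
    define d where "d = case_nat b' b"
    have d: "d \<in> seqs" using b b' by (auto simp: d_def seqs_def range_subsetD split: nat.splits)
    have sub: "S b \<subseteq> S d"
    proof
      fix x assume "x \<in> S b"
      then obtain n where "x \<in> space M" "b n x \<noteq> 0" by (auto simp: S_def)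
      then show "x \<in> S d" unfolding S_def d_def by (auto intro!: exI[of _ "Suc n"])
    qed
    have "J d \<le> s" unfolding s_def using d \<open>bdd_above (J ` seqs)\<close> by (intro cSup_upper) auto
    then have "J d - J b = 0" using \<open>s \<le> J b\<close> J_mono[OF b d sub] by linarith
    then have "(\<integral>x. indicator (S d) x * w x - indicator (S b) x * w x \<partial>M) = 0"
      unfolding J_def using int[OF d] int[OF b] by simp
    moreover have "AE x in M. 0 \<le> indicator (S d) x * w x - indicator (S b) x * w x"
      using sub w0 by (auto simp: indicator_def less_imp_le)
    ultimately have "AE x in M. indicator (S d) x * w x - indicator (S b) x * w x = 0"
      using integral_nonneg_eq_0_iff_AE[of M "\<lambda>x. indicator (S d) x * w x - indicator (S b) x * w x"] int[OF d] int[OF b] by simp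
    with AE_space show "AE x in M. b' x \<noteq> 0 \<longrightarrow> (\<exists>n. b n x \<noteq> 0)"
    proof eventually_elim
      case (elim x)
      show ?case
      proof
        assume "b' x \<noteq> 0"
        then have "x \<in> S d" using elim(1) unfolding S_def d_def by (auto intro!: exI[of _ 0])
        then have "x \<in> S b" using elim(2) w0[of x] by (auto simp: indicator_def split: if_splits)
        then show "\<exists>n. b n x \<noteq> 0" by (auto simp: S_def)
      qed
    qed
  qed
qed

context pair_sigma_finite
begin

text \<open>
  The function \<open>k\<^sub>0\<close> equal to zero on the essential union of the sets \<open>{b \<noteq> 0}\<close> and positive elsewhere is
  annihilated by all \<open>b\<close>, so that union has full measure. It is a union of countably many sets on each of
  which \<open>\<phi>\<close> is, up to null sets, a quotient of two functions continuous with respect to rectangles.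
\<close>

lemma closable_imp_tau_continuous:
  assumes cl: "closable_multiplier M1 M2 \<phi>"
  shows "tau_continuous M1 M2 \<phi>"
proof -
  have \<phi> [measurable]: "\<phi> \<in> borel_measurable P" using cl by (simp add: closable_multiplier_def)
  define B where "B = {b \<in> L2 P. hilbert_factorable M1 M2 b \<and> hilbert_factorable M1 M2 (\<lambda>p. \<phi> p * b p)}"
  have hf0: "hilbert_factorable M1 M2 (\<lambda>p. 0)"
    unfolding hilbert_factorable_def
    by (intro exI[of _ "\<lambda>_ _. 0"]) auto
  have "(\<lambda>p. 0) \<in> B" by (simp add: B_def hf0 L2_zero)
  moreover have "B \<subseteq> borel_measurable P" using L2_measurable by (auto simp: B_def)
  ultimately obtain b where b: "\<And>n::nat. b n \<in> B"
    and max: "\<And>b'. b' \<in> B \<Longrightarrow> AE p in P. b' p \<noteq> 0 \<longrightarrow> (\<exists>n. b n p \<noteq> 0)"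
    using P.countable_essential_support[of B] by blast
  have [measurable]: "b n \<in> borel_measurable P" for n using b[of n] by (auto simp: B_def dest: L2_measurable)
  obtain w :: "'a \<times> 'b \<Rightarrow> real" where [measurable]: "w \<in> borel_measurable P"
    and w0: "\<And>p. 0 < w p" and w: "integrable P w"
    using P.obtain_positive_integrable_function by metis
  define k0 where "k0 p = (if \<exists>n. b n p \<noteq> 0 then 0 else complex_of_real (sqrt (w p)))" for p
  have k0: "k0 \<in> L2 P"
  proof (rule L2_dominated[OF _ w])
    show "k0 \<in> borel_measurable P" unfolding k0_def[abs_def] by measurable
    show "AE p in P. (cmod (k0 p))\<^sup>2 \<le> w p" using w0 by (auto simp: k0_def less_imp_le)
  qed
  have "AE p in P. k0 p = 0"
  proof (rule closable_imp_annihilator_total[OF cl k0])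
    fix b' assume "b' \<in> L2 P" "hilbert_factorable M1 M2 b'" "hilbert_factorable M1 M2 (\<lambda>p. \<phi> p * b' p)"
    then have "AE p in P. b' p \<noteq> 0 \<longrightarrow> (\<exists>n. b n p \<noteq> 0)" by (intro max) (simp add: B_def)
    then have "AE p in P. k0 p * b' p = 0" by eventually_elim (auto simp: k0_def)
    then show "(\<integral>p. k0 p * b' p \<partial>P) = 0" by (rule integral_eq_zero_AE)
  qed
  then have conull: "AE p in P. \<exists>n. b n p \<noteq> 0"
  proof eventually_elim
    case (elim p)
    then show ?case using w0[of p] by (auto simp: k0_def split: if_splits)
  qed
  have "\<exists>\<beta>. rect_continuous M1 M2 \<beta> \<and> (AE p in P. b n p = \<beta> p)" for n
    by (rule hilbert_factorable_rect_continuous[of M1 M2 "b n"]) (use b[of n] in \<open>auto simp: B_def\<close>)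
  then obtain \<beta> where \<beta>: "\<And>n. rect_continuous M1 M2 (\<beta> n)" "\<And>n. AE p in P. b n p = \<beta> n p"
    by metis
  have "\<exists>\<alpha>. rect_continuous M1 M2 \<alpha> \<and> (AE p in P. \<phi> p * b n p = \<alpha> p)" for n
    by (rule hilbert_factorable_rect_continuous[of M1 M2 "\<lambda>p. \<phi> p * b n p"]) (use b[of n] in \<open>auto simp: B_def\<close>)
  then obtain \<alpha> where \<alpha>: "\<And>n. rect_continuous M1 M2 (\<alpha> n)" "\<And>n. AE p in P. \<phi> p * b n p = \<alpha> n p"
    by metis
  show ?thesis
    unfolding tau_continuous_def
  proof (intro allI impI)
    fix U :: "complex set" assume U: "open U"
    then have [measurable]: "U \<in> sets borel" by simp
    define V where "V = {z :: complex \<times> complex. fst z \<noteq> 0 \<and> snd z / fst z \<in> U}"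
    have "open V"
    proof -
      have nz: "open {z :: complex \<times> complex. fst z \<noteq> 0}"
        by (intro open_Collect_neq continuous_intros)
      have "continuous_on {z :: complex \<times> complex. fst z \<noteq> 0} (\<lambda>z. snd z / fst z)"
        by (intro continuous_intros) auto
      moreover have "V = {z. fst z \<noteq> 0} \<inter> (\<lambda>z. snd z / fst z) -` U" by (auto simp: V_def)
      ultimately show ?thesis using continuous_open_preimage[OF _ nz U] by simp
    qed
    define E where "E = (\<Union>n. {p \<in> space P. (\<beta> n p, \<alpha> n p) \<in> V})"
    have E: "rect_open M1 M2 E" unfolding E_def
      by (intro rect_open_UN rect_continuousD rect_continuous_Pair \<beta> \<alpha> \<open>open V\<close>) auto
    let ?D = "sym_diff (\<phi> -` U \<inter> space P) E"
    have "AE p in P. \<forall>n. b n p = \<beta> n p \<and> \<phi> p * b n p = \<alpha> n p"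
      unfolding AE_all_countable
    proof
      fix n show "AE p in P. b n p = \<beta> n p \<and> \<phi> p * b n p = \<alpha> n p"
        using \<beta>(2)[of n] \<alpha>(2)[of n] by eventually_elim simp
    qed
    with conull AE_space have "AE p in P. p \<notin> ?D"
    proof eventually_elim
      case (elim p)
      have ratio: "\<alpha> n p / \<beta> n p = \<phi> p" if "\<beta> n p \<noteq> 0" for n
        using elim(3) that by (metis nonzero_mult_div_cancel_right)
      obtain n where "\<beta> n p \<noteq> 0" using elim(1,3) by metis
      with ratio elim(2) show ?case by (auto simp: E_def V_def)
    qed
    moreover have "?D \<in> sets P"
      using rect_open_sets[OF E] measurable_sets[OF \<phi> \<open>U \<in> sets borel\<close>] by auto
    ultimately have "?D \<in> null_sets P" by (simp add: AE_iff_null_sets)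
    then show "tau_open M1 M2 (\<phi> -` U \<inter> space P)"
      using E unfolding tau_open_def rect_open_def by auto
  qed
qed

end

theorem proposition5p11:
  fixes M :: "'a measure" and N :: "'b measure" and \<phi> :: "'a \<times> 'b \<Rightarrow> complex"
  assumes "standard_sigma_finite M"
    and "standard_sigma_finite N"
    and "closable_multiplier M N \<phi>"
  shows "tau_continuous M N \<phi>"
proof -
  interpret pair_sigma_finite M N
    using assms(1,2) by (simp add: standard_sigma_finite_def pair_sigma_finite_def)
  show ?thesis by (rule closable_imp_tau_continuous[OF assms(3)])
qed

end
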